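(* Let $a$ be a prime of the form $a=2^r\cdot 3+1$ with \[ r\in\{1,2,5,6,8,12,18,30,36,41,66,189,201,209,276,353,408,438,534,2208,2816,3168,3189,3912\}. \] Let $b,c$ be positive integers with $b>1$ such that $a,b,c$ are pairwise relatively prime. Then the equation $a^x-b^y=c$ has at most one solution in positive integers $x,y$, except for $(a,b,c)=(13,3,10)$, for which it has exactly two solutions. *)

theory Defs
  imports Main "HOL-Computational_Algebra.Primes"
begin

definition exceptional_exponents :: "nat set" where
  "exceptional_exponents = {1,2,5,6,8,12,18,30,36,41,66,189,201,209,276,353,408,438,534,2208,2816,3168,3189,3912}"

definition sol_set :: "nat \<Rightarrow> nat \<Rightarrow> nat \<Rightarrow> (nat \<times> nat) set" where
  "sol_set a b c = {(x, y). x > 0 \<and> y > 0 \<and> int a ^ x - int b ^ y = int c}"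

end

theory Submission
  imports Defs Complex_Main "Jordan_Normal_Form.Determinant" "HOL-Library.FuncSet" "HOL-Number_Theory.Number_Theory"
begin

text \<open>Let \<open>b ^ y1 + c = a ^ x1\<close> and \<open>b ^ y2 + c = a ^ x2\<close> with \<open>x1 < x2\<close>.

  If \<open>y1\<close> and \<open>y2\<close> have the same parity, both equations say that some \<open>u \<surd>\<beta> + v \<surd>(-c)\<close> with
  \<open>\<beta> \<in> {1, b}\<close> has norm a power of \<open>a\<close>, where every prime factor of \<open>b\<close> divides \<open>\<beta> u\<close>.
  Up to signs, all these elements are odd powers of the one of least norm. Comparing the prime factors
  of the first coordinate of a \<open>p\<close>-th power leaves only \<open>p = 3\<close> and \<open>3 ^ 7 + 10 = 13 ^ 3\<close>.

  If the parities differ, \<open>a = 3 * 2 ^ r + 1\<close> forces \<open>b ^ 3\<close> to be \<open>1\<close> modulo \<open>a\<close>, so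
  \<open>b ^ n0 = 1 + a ^ k n\<close> with \<open>n0 \<in> {1, 3}\<close>, and \<open>x1 = k + j\<close> for the exponent \<open>j\<close> of \<open>a\<close> in
  \<open>N = (y2 - y1) / n0\<close>. An interpolation determinant, divisible by a high power of \<open>a\<close>, bounds \<open>N\<close>.
  The binomial expansion of \<open>(1 + a ^ k n) ^ N\<close> modulo powers of \<open>a\<close> then bounds \<open>a ^ k\<close>, and the
  finitely many remaining cases violate these congruences.\<close>

text \<open>The parity of \<open>y2 - y1\<close> decides the method. If it is odd, the order of
  \<open>b\<close> modulo \<open>a\<close> divides an odd number and also
  \<open>a - 1 = 2 ^ r * 3\<close>, hence divides 3; here the shape of \<open>a\<close> enters.
  Lifting the exponent then gives \<open>x1 = k + j\<close>, while \<open>- c\<close> equals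
  \<open>b ^ (y1 + n0 * N)\<close> modulo the far larger \<open>a ^ x2\<close>. The determinant
  exploits this contrast: powers of \<open>c\<close> stand for huge powers of \<open>b\<close>, so
  its entries are small in absolute value, and yet modulo \<open>a ^ x2\<close> they are functions
  of one integer variable. Its constants have to be sharp: the cases left over are evaluated inside
  the logic, so \<open>N\<close> has to come down to a few thousand at most. The second-order
  congruence finally bounds \<open>a ^ k\<close> by an absolute constant, which excludes every
  exponent \<open>r \<ge> 41\<close> at once and leaves nine primes. If the parity is even, the
  element of least norm plays the role of a generator of a power of a prime ideal above
  \<open>a\<close>. The divisibility of \<open>\<beta> * u\<close> by the primes of \<open>b\<close>
  keeps norm 1 out of the descent.\<close>

section \<open>Determinants: nonvanishing at suitable points, and divisibility\<close>

lemma permutes_less: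
  fixes p :: "nat \<Rightarrow> nat"
  assumes "p permutes {0..<n}" "i < n"
  shows "p i < n"
  using permutes_in_image[OF assms(1), of i] assms(2) by simp

text \<open>Expanded along the last row with the last point left free, the determinant is a
  combination of the \<open>f j\<close> with cofactors as coefficients. The coefficient of the last
  function is the smaller determinant, nonzero by induction, so the hypothesis supplies a last
  point.\<close>

lemma exists_points_det_nonzero:
  fixes f :: "nat \<Rightarrow> 'p \<Rightarrow> 'a :: idom"
  assumes "\<And>c. \<exists>i<n. c i \<noteq> 0 \<Longrightarrow> \<exists>x\<in>X. (\<Sum>i<n. c i * f i x) \<noteq> 0"
  shows "\<exists>P. (\<forall>i<n. P i \<in> X) \<and> det (mat n n (\<lambda>(i,j). f j (P i))) \<noteq> 0"
  using assms
proof (induction n)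
  case 0
  show ?case by (auto simp: det_dim_zero)
next
  case (Suc n)
  have "\<exists>x\<in>X. (\<Sum>i<n. c i * f i x) \<noteq> 0" if c: "\<exists>i<n. c i \<noteq> 0" for c
  proof -
    have "\<exists>x\<in>X. (\<Sum>i<Suc n. (c(n:=0)) i * f i x) \<noteq> 0"
      using c by (intro Suc.prems) auto
    then show ?thesis by (auto simp: sum.lessThan_Suc)
  qed
  from Suc.IH[OF this] obtain P where P: "\<forall>i<n. P i \<in> X" "det (mat n n (\<lambda>(i,j). f j (P i))) \<noteq> 0"
    by blast
  define M where "M x = mat (Suc n) (Suc n) (\<lambda>(i,j). f j ((P(n:=x)) i))" for x
  have M: "M x \<in> carrier_mat (Suc n) (Suc n)" for x by (simp add: M_def)
  \<comment> \<open>The cofactors of the last row do not involve the last point, so any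
    \<open>x0\<close> serves to compute them.\<close>
  obtain x0 where "x0 = (undefined :: 'p)" by simp
  define c where "c j = cofactor (M x0) n j" for j
  have del: "mat_delete (M x) n j = mat_delete (M x0) n j" if "j < Suc n" for x j
    by (rule eq_matI) (use that in \<open>auto simp: M_def mat_delete_def\<close>)
  have cof: "cofactor (M x) n j = c j" if "j < Suc n" for x j
    unfolding c_def cofactor_def del[OF that, of x] ..
  have "mat_delete (M x0) n n = mat n n (\<lambda>(i,j). f j (P i))"
    by (rule eq_matI) (auto simp: M_def mat_delete_def)
  then have "c n \<noteq> 0" using P(2) by (simp add: c_def cofactor_def)
  then have "\<exists>x\<in>X. (\<Sum>i<Suc n. c i * f i x) \<noteq> 0" by (intro Suc.prems) auto
  then obtain x where x: "x \<in> X" "(\<Sum>i<Suc n. c i * f i x) \<noteq> 0" by blast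
  have Mn: "M x $$ (n,j) = f j x" if "j < Suc n" for j using that by (simp add: M_def)
  have "det (M x) = (\<Sum>j<Suc n. M x $$ (n,j) * cofactor (M x) n j)"
    by (rule laplace_expansion_row[OF M]) simp
  also have "\<dots> = (\<Sum>j<Suc n. c j * f j x)"
    by (rule sum.cong) (auto simp: Mn cof mult.commute)
  finally have "det (M x) \<noteq> 0" using x(2) by simp
  then show ?case using P(1) x(1)
    by (intro exI[of _ "P(n:=x)"]) (auto simp: M_def less_Suc_eq)
qed

lemma sum_card_le_sum_nat:
  fixes S :: "nat set"
  assumes "finite S"
  shows "\<Sum>{..<card S} \<le> \<Sum>S"
  using assms
proof (induction "card S" arbitrary: S)
  case 0 then show ?case by simp
next
  case (Suc n)
  define m where "m = Max S"
  have ne: "S \<noteq> {}" using Suc by auto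
  have m: "m \<in> S" using ne Suc by (simp add: m_def)
  have "S \<subseteq> {..m}" using Suc by (auto simp: m_def)
  then have "card S \<le> Suc m" using card_mono[of "{..m}" S] by simp
  then have nm: "n \<le> m" using Suc by simp
  have "\<Sum>{..<card (S - {m})} \<le> \<Sum>(S - {m})"
    using Suc m by (intro Suc(1)) auto
  moreover have "card (S - {m}) = n" using Suc.hyps(2) m Suc.prems by simp
  ultimately have "\<Sum>{..<n} \<le> \<Sum>(S - {m})" by simp
  then show ?case using Suc.hyps(2)[symmetric] nm m Suc.prems
    by (simp add: lessThan_Suc sum.remove[of S m])
qed

text \<open>The distinct values below \<open>D\<close> sum to at least 0 + 1 + 2 + ..., and every
  other index contributes the maximum \<open>D\<close>. This counts the exponent of the surviving
  terms in the determinant expansion below.\<close>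

lemma sum_ge_if_inj_below:
  fixes \<phi> :: "nat \<Rightarrow> nat"
  assumes le: "\<And>i. i < Suc D \<Longrightarrow> \<phi> i \<le> D"
    and inj: "inj_on \<phi> {i. i < Suc D \<and> \<phi> i < D}"
  shows "\<Sum>{..<Suc D} \<le> (\<Sum>i<Suc D. \<phi> i)"
proof -
  define I where "I = {i. i < Suc D \<and> \<phi> i < D}"
  have fin: "finite I" and sub: "I \<subseteq> {..<Suc D}" by (auto simp: I_def)
  have "\<Sum>{..<card I} \<le> \<Sum>(\<phi> ` I)"
    using sum_card_le_sum_nat[of "\<phi> ` I"] fin inj by (simp add: I_def card_image)
  also have "\<dots> = (\<Sum>i\<in>I. \<phi> i)" using inj by (simp add: sum.reindex I_def)
  finally have 1: "\<Sum>{..<card I} \<le> (\<Sum>i\<in>I. \<phi> i)" .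
  have cI: "card I \<le> Suc D" using card_mono[OF _ sub] by simp
  have eq: "{..<Suc D} = {..<card I} \<union> {card I..<Suc D}" using cI by auto
  have "\<Sum>{..<Suc D} = \<Sum>{..<card I} + \<Sum>{card I..<Suc D}"
    unfolding eq by (rule sum.union_disjoint) auto
  also have "\<Sum>{card I..<Suc D} \<le> (\<Sum>i\<in>{card I..<Suc D}. D)" by (rule sum_mono) auto
  also have "\<dots> = (\<Sum>i\<in>{..<Suc D} - I. D)" using card_Diff_subset[OF fin sub] by simp
  also have "\<dots> = (\<Sum>i\<in>{..<Suc D} - I. \<phi> i)"
    using le by (intro sum.cong) (auto simp: I_def dest: le less_antisym)
  also note 1
  also have "(\<Sum>i\<in>I. \<phi> i) + (\<Sum>i\<in>{..<Suc D} - I. \<phi> i) = (\<Sum>i<Suc D. \<phi> i)"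
    using sum.subset_diff[OF sub, of \<phi>] by simp
  finally show ?thesis by simp
qed

text \<open>By multilinearity every row selects one summand. Two rows selecting the same \<tau>
  below \<open>D\<close> both become multiples of the row \<open>W \<tau>\<close>, and that term
  vanishes. The remaining selections are injective below \<open>D\<close>, so their exponents of
  \<open>A\<close> add up to at least 0 + ... + \<open>D\<close>. Only the remainder
  \<open>H\<close> depends on the row, and it carries the full \<open>A ^ D\<close>.\<close>

lemma power_dvd_det_filtered:
  fixes V W H :: "nat \<Rightarrow> nat \<Rightarrow> int" and A :: int
  assumes E: "\<And>i j. i < Suc D \<Longrightarrow> j < Suc D \<Longrightarrow>
     E i j = (\<Sum>d<D. V i d * A^d * W d j) + A^D * H i j"
  shows "A ^ (\<Sum>{..<Suc D}) dvd det (mat (Suc D) (Suc D) (\<lambda>(i,j). E i j))"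
proof -
  define n where "n = Suc D"
  define a where "a i \<tau> = A^\<tau> * (if \<tau> < D then V i \<tau> else 1)" for i \<tau>
  define G where "G i \<tau> j = (if \<tau> < D then W \<tau> j else H i j)" for i \<tau> j
  have En: "E i j = (\<Sum>\<tau>\<in>{..D}. a i \<tau> * G i \<tau> j)" if "i < n" "j < n" for i j
  proof -
    have "{..D} = insert D {..<D}" by auto
    then have "(\<Sum>\<tau>\<in>{..D}. a i \<tau> * G i \<tau> j) = a i D * G i D j + (\<Sum>\<tau><D. a i \<tau> * G i \<tau> j)" by simp
    also have "(\<Sum>\<tau><D. a i \<tau> * G i \<tau> j) = (\<Sum>d<D. V i d * A^d * W d j)"
      by (rule sum.cong) (auto simp: a_def G_def)
    finally show ?thesis using E[of i j] that by (simp add: n_def a_def G_def)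
  qed
  let ?P = "{p. p permutes {0..<n}}" and ?F = "PiE {0..<n} (\<lambda>_. {..D})"
  define M where "M \<phi> = mat n n (\<lambda>(i,j). G i (\<phi> i) j)" for \<phi>
  have M: "M \<phi> \<in> carrier_mat n n" for \<phi> by (simp add: M_def)
  have "det (mat n n (\<lambda>(i,j). E i j)) = (\<Sum>p\<in>?P. signof p * (\<Prod>i=0..<n. E i (p i)))"
    by (subst det_def'[of _ n]) (auto intro!: sum.cong prod.cong simp: permutes_less)
  also have "\<dots> = (\<Sum>p\<in>?P. signof p * (\<Prod>i=0..<n. \<Sum>\<tau>\<in>{..D}. a i \<tau> * G i \<tau> (p i)))"
    by (intro sum.cong prod.cong arg_cong2[of _ _ _ _ "(*)"] refl En) (auto simp: permutes_less)
  also have "\<dots> = (\<Sum>p\<in>?P. signof p * (\<Sum>\<phi>\<in>?F. \<Prod>i=0..<n. a i (\<phi> i) * G i (\<phi> i) (p i)))"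
    by (subst prod_sum_PiE) auto
  also have "\<dots> = (\<Sum>\<phi>\<in>?F. \<Sum>p\<in>?P. signof p * (\<Prod>i=0..<n. a i (\<phi> i) * G i (\<phi> i) (p i)))"
    by (subst sum_distrib_left, subst sum.swap) simp
  also have "\<dots> = (\<Sum>\<phi>\<in>?F. (\<Prod>i=0..<n. a i (\<phi> i)) * det (M \<phi>))"
  proof (rule sum.cong[OF refl])
    fix \<phi>
    have "det (M \<phi>) = (\<Sum>p\<in>?P. signof p * (\<Prod>i=0..<n. G i (\<phi> i) (p i)))"
      by (subst det_def'[OF M]) (auto intro!: sum.cong prod.cong simp: permutes_less M_def)
    then show "(\<Sum>p\<in>?P. signof p * (\<Prod>i=0..<n. a i (\<phi> i) * G i (\<phi> i) (p i))) = (\<Prod>i=0..<n. a i (\<phi> i)) * det (M \<phi>)"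
      by (simp add: prod.distrib sum_distrib_left mult_ac)
  qed
  finally have det: "det (mat n n (\<lambda>(i,j). E i j)) = (\<Sum>\<phi>\<in>?F. (\<Prod>i=0..<n. a i (\<phi> i)) * det (M \<phi>))" .
  have "A ^ (\<Sum>{..<n}) dvd (\<Prod>i=0..<n. a i (\<phi> i)) * det (M \<phi>)" if \<phi>: "\<phi> \<in> ?F" for \<phi>
  proof (cases "inj_on \<phi> {i. i < Suc D \<and> \<phi> i < D}")
    case True
    have "\<Sum>{..<Suc D} \<le> (\<Sum>i<Suc D. \<phi> i)"
      using \<phi> by (intro sum_ge_if_inj_below True) (auto simp: n_def PiE_iff)
    then have "A ^ (\<Sum>{..<n}) dvd A ^ (\<Sum>i<n. \<phi> i)" by (intro le_imp_power_dvd) (simp add: n_def)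
    also have "A ^ (\<Sum>i<n. \<phi> i) dvd (\<Prod>i=0..<n. a i (\<phi> i))"
      unfolding a_def prod.distrib power_sum[symmetric] by (simp add: atLeast0LessThan power_sum)
    finally show ?thesis by simp
  next
    case False
    then obtain i i' where i: "i < n" "i' < n" "i \<noteq> i'" "\<phi> i = \<phi> i'" "\<phi> i < D"
      by (auto simp: inj_on_def n_def)
    have "row (M \<phi>) i = row (M \<phi>) i'"
      by (rule eq_vecI) (use i in \<open>auto simp: M_def G_def\<close>)
    then have "det (M \<phi>) = 0" using det_identical_rows[OF M i(3) i(1) i(2)] by simp
    then show ?thesis by simp
  qed
  then show ?thesis using det by (simp add: n_def dvd_sum)
qed

section \<open>A zero estimate for exponential polynomials on a grid\<close>

text \<open>With mere degree bounds in place of degrees, the coefficient at the bound is still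
  multiplicative: if a bound is not attained, both sides are zero. This reads off the top
  coefficient of a determinant of polynomials.\<close>

lemma coeff_mult_top:
  fixes p q :: "'a :: idom poly"
  assumes "degree p \<le> m" "degree q \<le> n"
  shows "poly.coeff (p * q) (m + n) = poly.coeff p m * poly.coeff q n"
proof (cases "degree p = m \<and> degree q = n")
  case True then show ?thesis using coeff_mult_degree_sum[of p q] by simp
next
  case False
  then have "degree p < m \<or> degree q < n" using assms by auto
  then have "poly.coeff p m * poly.coeff q n = 0" by (auto simp: coeff_eq_0)
  moreover have "degree (p * q) < m + n"
    using degree_mult_le[of p q] False assms by linarith
  ultimately show ?thesis by (simp add: coeff_eq_0)
qed

lemma coeff_prod_top:
  fixes f :: "'b \<Rightarrow> 'a :: idom poly"
  assumes "finite S" "\<And>i. i \<in> S \<Longrightarrow> degree (f i) \<le> d i"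
  shows "degree (\<Prod>i\<in>S. f i) \<le> (\<Sum>i\<in>S. d i) \<and>
     poly.coeff (\<Prod>i\<in>S. f i) (\<Sum>i\<in>S. d i) = (\<Prod>i\<in>S. poly.coeff (f i) (d i))"
  using assms
proof (induction S rule: finite_induct)
  case (insert x S)
  have 1: "degree (\<Prod>i\<in>S. f i) \<le> (\<Sum>i\<in>S. d i)" "poly.coeff (\<Prod>i\<in>S. f i) (\<Sum>i\<in>S. d i) = (\<Prod>i\<in>S. poly.coeff (f i) (d i))"
    using insert by auto
  have 2: "degree (f x) \<le> d x" using insert by auto
  show ?case using insert(1,2) coeff_mult_top[OF 2 1(1)] 1 2 degree_mult_le[of "f x" "\<Prod>i\<in>S. f i"]
    by simp
qed simp

text \<open>A kernel vector of the transpose is the coefficient vector of a polynomial of degree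
  below \<open>l\<close> with the \<open>l\<close> distinct roots \<open>v m\<close>.\<close>

lemma det_vandermonde_columns_nonzero:
  fixes v lc :: "nat \<Rightarrow> real"
  assumes inj: "inj_on v {..<l}" and lc: "\<And>m. m < l \<Longrightarrow> lc m \<noteq> 0"
  shows "det (mat l l (\<lambda>(i,m). lc m * v m ^ i)) \<noteq> 0"
proof
  let ?A = "mat l l (\<lambda>(i,m). lc m * v m ^ i)"
  have A: "?A \<in> carrier_mat l l" by simp
  assume "det ?A = 0"
  then have "det (transpose_mat ?A) = 0" using det_transpose[OF A] by simp
  then obtain x where x: "x \<in> carrier_vec l" "x \<noteq> 0\<^sub>v l" "transpose_mat ?A *\<^sub>v x = 0\<^sub>v l"
    using det_0_iff_vec_prod_zero[of "transpose_mat ?A" l] by auto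
  define p where "p = (\<Sum>i<l. Polynomial.monom (x $ i) i)"
  have cp: "poly.coeff p i = (if i < l then x $ i else 0)" for i
    unfolding p_def coeff_sum by (simp add: sum.delta)
  have "poly p (v m) = 0" if m: "m < l" for m
  proof -
    have "(transpose_mat ?A *\<^sub>v x) $ m = (\<Sum>i=0..<l. lc m * v m ^ i * x $ i)"
      using m x(1) by (simp add: mult_mat_vec_def scalar_prod_def)
    then have "(\<Sum>i=0..<l. lc m * v m ^ i * x $ i) = 0" using x(3) m by simp
    then have "lc m * (\<Sum>i<l. v m ^ i * x $ i) = 0"
      by (simp add: sum_distrib_left atLeast0LessThan mult.assoc)
    then show ?thesis using lc[OF m] by (simp add: p_def poly_sum poly_monom mult.commute)
  qed
  then have sub: "v ` {..<l} \<subseteq> {z. poly p z = 0}" by auto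
  have "p \<noteq> 0"
  proof
    assume "p = 0"
    then have "x = 0\<^sub>v l" using cp x(1) by (intro eq_vecI) (auto dest!: spec, metis)
    then show False using x(2) by simp
  qed
  moreover from this have "l > 0" by (cases l) (auto simp: p_def)
  ultimately have "card (v ` {..<l}) \<le> degree p"
    using card_mono[OF poly_roots_finite sub] card_poly_roots_bound[of p] by linarith
  moreover have "degree p < l"
    using \<open>l > 0\<close> cp by (intro le_less_trans[OF degree_le[of "l - 1"]]) auto
  ultimately show False using inj by (simp add: card_image)
qed

text \<open>Shifting \<open>r\<close> by 0, ..., \<open>l - 1\<close> turns the vanishing into a
  linear system whose matrix is polynomial in \<open>x = r + N * s\<close> and whose nonzero
  solution consists of the powers \<open>(u ^ r * w ^ s) ^ q\<close>. So its determinant vanishes at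
  \<open>R * S\<close> values of \<open>x\<close>, distinct because \<open>R \<le> N\<close>, which
  is more than its degree allows. It is therefore the zero polynomial; but its top coefficient is a
  Vandermonde determinant in the numbers \<open>u ^ q\<close>, distinct because
  \<open>u > 1\<close>. The grid has \<open>L - 1\<close> additional columns to make room for the
  shifts.\<close>

lemma exp_poly_grid_zero:
  fixes c :: "nat \<Rightarrow> real poly" and u w :: real
  assumes u: "u > 1" and w: "w \<noteq> 0"
    and deg: "\<And>q. q < L \<Longrightarrow> degree (c q) \<le> k"
    and R: "R \<le> N" and RS: "k * L < R * S"
    and zero: "\<And>r s. r + 1 < R + L \<Longrightarrow> s < S \<Longrightarrow>
       (\<Sum>q<L. poly (c q) (real (r + N * s)) * (u ^ r * w ^ s) ^ q) = 0"
    and q: "q < L"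
  shows "c q = 0"
proof (rule ccontr)
  assume "c q \<noteq> 0"
  \<comment> \<open>Only indices with a nonzero coefficient polynomial are kept, so that every
    column has a leading coefficient for the Vandermonde determinant.\<close>
  define Q where "Q = {q. q < L \<and> c q \<noteq> 0}"
  have finQ: "finite Q" by (simp add: Q_def)
  define qs where "qs = sorted_list_of_set Q"
  define l where "l = length qs"
  have setq: "set qs = Q" and dist: "distinct qs" using finQ by (simp_all add: qs_def)
  have l: "l = card Q" by (simp add: l_def qs_def)
  have lL: "l \<le> L" unfolding l using card_mono[of "{..<L}" Q] by (auto simp: Q_def)
  have qsm: "qs ! m < L" "c (qs ! m) \<noteq> 0" if "m < l" for m
    using nth_mem[of m qs] that setq by (auto simp: Q_def l_def)
  define A where "A = mat l l (\<lambda>(i,m). smult (u ^ (i * (qs ! m))) (pcompose (c (qs ! m)) [:real i, 1:]))"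
  have A: "A \<in> carrier_mat l l" by (simp add: A_def)
  have dA: "degree (A $$ (i,m)) = degree (c (qs ! m))"
    and cA: "poly.coeff (A $$ (i,m)) (degree (c (qs ! m))) = lead_coeff (c (qs ! m)) * (u ^ (qs ! m)) ^ i"
    if "i < l" "m < l" for i m
  proof -
    have d: "degree (pcompose (c (qs ! m)) [:real i, 1:]) = degree (c (qs ! m))"
      by (simp add: degree_pcompose)
    then show "degree (A $$ (i,m)) = degree (c (qs ! m))" using that u by (simp add: A_def)
    have "lead_coeff (pcompose (c (qs ! m)) [:real i, 1:]) = lead_coeff (c (qs ! m))"
      by (subst lead_coeff_comp) auto
    then show "poly.coeff (A $$ (i,m)) (degree (c (qs ! m))) = lead_coeff (c (qs ! m)) * (u ^ (qs ! m)) ^ i"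
      using that d by (simp add: A_def power_mult[symmetric] mult.commute)
  qed
  have "degree (det A) \<le> k * l"
    by (rule degree_det_le[OF _ A]) (use dA deg qsm in auto)
  also have "\<dots> \<le> k * L" using lL by simp
  finally have degA: "degree (det A) < R * S" using RS by simp
  have root: "poly (det A) (real (r + N * s)) = 0" if rs: "r < R" "s < S" for r s
  proof -
    let ?x = "real (r + N * s)"
    interpret ph: comm_ring_hom "\<lambda>p. poly p ?x" by unfold_locales auto
    let ?B = "map_mat (\<lambda>p. poly p ?x) A"
    have B: "?B \<in> carrier_mat l l" using A by simp
    define v where "v = vec l (\<lambda>m. (u ^ r * w ^ s) ^ (qs ! m))"
    have "l > 0" unfolding l using \<open>c q \<noteq> 0\<close> q finQ by (auto simp: card_gt_0_iff Q_def)
    have "v $ 0 \<noteq> 0" using u w \<open>l > 0\<close> by (simp add: v_def)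
    then have v0: "v \<noteq> 0\<^sub>v l" using \<open>l > 0\<close> by auto
    have "?B *\<^sub>v v = 0\<^sub>v l"
    proof (rule eq_vecI)
      fix i assume "i < dim_vec (0\<^sub>v l :: real vec)"
      then have i: "i < l" by simp
      have "(?B *\<^sub>v v) $ i = (\<Sum>m=0..<l. ?B $$ (i,m) * v $ m)"
        using i A by (simp add: mult_mat_vec_def scalar_prod_def v_def)
      also have "\<dots> = (\<Sum>m=0..<l. poly (c (qs ! m)) (real (r + i + N * s)) * (u ^ (r + i) * w ^ s) ^ (qs ! m))"
        by (rule sum.cong) (use i in \<open>auto simp: A_def v_def poly_pcompose algebra_simps power_add power_mult_distrib power_mult[symmetric]\<close>)
      also have "\<dots> = (\<Sum>q\<in>Q. poly (c q) (real (r + i + N * s)) * (u ^ (r + i) * w ^ s) ^ q)"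
      proof -
        have "bij_betw ((!) qs) {0..<l} Q" using bij_betw_nth[OF dist, of "{0..<l}" Q] setq by (auto simp: l_def atLeast0LessThan)
        then show ?thesis by (rule sum.reindex_bij_betw)
      qed
      also have "\<dots> = (\<Sum>q<L. poly (c q) (real (r + i + N * s)) * (u ^ (r + i) * w ^ s) ^ q)"
        by (rule sum.mono_neutral_left) (auto simp: Q_def)
      also have "\<dots> = 0" using zero[of "r + i" s] rs i lL by simp
      finally show "(?B *\<^sub>v v) $ i = 0\<^sub>v l $ i" using i by simp
    qed (use A in simp)
    moreover have "v \<in> carrier_vec l" by (simp add: v_def)
    ultimately have "det ?B = 0" using det_0_iff_vec_prod_zero[OF B] v0 by blast
    then show ?thesis using ph.hom_det[of A] by argo
  qed
  define X where "X = (\<lambda>(r,s). real (r + N * s)) ` ({..<R} \<times> {..<S})"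
  have "inj_on (\<lambda>(r,s). real (r + N * s)) ({..<R} \<times> {..<S})"
  proof (rule inj_onI, clarsimp)
    fix r s r' s' assume h: "r < R" "r' < R" "real r + real N * real s = real r' + real N * real s'"
    then have e: "r + N * s = r' + N * s'" by (metis of_nat_add of_nat_eq_iff of_nat_mult)
    have "(r + N * s) mod N = r" "(r' + N * s') mod N = r'" using h R by auto
    then have "r = r'" using e by simp
    moreover have "N > 0" using h R by simp
    ultimately show "r = r' \<and> s = s'" using e by simp
  qed
  then have cX: "card X = R * S" by (simp add: X_def card_image)
  have "det A = 0"
  proof (rule ccontr)
    assume ne: "det A \<noteq> 0"
    have "X \<subseteq> {x. poly (det A) x = 0}" using root by (auto simp: X_def)
    then have "card X \<le> degree (det A)"
      using card_mono[OF poly_roots_finite[OF ne]] card_poly_roots_bound[OF ne] by (meson le_trans)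
    then show False using cX degA by simp
  qed
  define d where "d m = degree (c (qs ! m))" for m
  have "poly.coeff (det A) (\<Sum>m=0..<l. d m) = det (mat l l (\<lambda>(i,m). lead_coeff (c (qs ! m)) * (u ^ (qs ! m)) ^ i))"
  proof -
    have "poly.coeff (det A) (\<Sum>m=0..<l. d m) = (\<Sum>p\<in>{p. p permutes {0..<l}}. poly.coeff (signof p * (\<Prod>i=0..<l. A $$ (i, p i))) (\<Sum>m=0..<l. d m))"
      by (subst det_def'[OF A]) (simp add: coeff_sum)
    also have "\<dots> = (\<Sum>p\<in>{p. p permutes {0..<l}}. signof p * (\<Prod>i=0..<l. lead_coeff (c (qs ! p i)) * (u ^ (qs ! p i)) ^ i))"
    proof (rule sum.cong[OF refl])
      fix p assume "p \<in> {p. p permutes {0..<l}}"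
      then have p: "p permutes {0..<l}" by simp
      have "(\<Sum>i=0..<l. d (p i)) = (\<Sum>m=0..<l. d m)"
        using sum.permute[OF p, of d] by (simp add: o_def)
      then have "poly.coeff (\<Prod>i=0..<l. A $$ (i, p i)) (\<Sum>m=0..<l. d m) = (\<Prod>i=0..<l. poly.coeff (A $$ (i, p i)) (d (p i)))"
        using coeff_prod_top[of "{0..<l}" "\<lambda>i. A $$ (i, p i)" "\<lambda>i. d (p i)"] dA permutes_less[OF p]
        by (simp add: d_def)
      also have "\<dots> = (\<Prod>i=0..<l. lead_coeff (c (qs ! p i)) * (u ^ (qs ! p i)) ^ i)"
        by (rule prod.cong) (use cA permutes_less[OF p] in \<open>auto simp: d_def\<close>)
      finally show "poly.coeff (signof p * (\<Prod>i=0..<l. A $$ (i, p i))) (\<Sum>m=0..<l. d m) = signof p * (\<Prod>i=0..<l. lead_coeff (c (qs ! p i)) * (u ^ (qs ! p i)) ^ i)"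
        by (simp add: sign_def)
    qed
    also have "\<dots> = det (mat l l (\<lambda>(i,m). lead_coeff (c (qs ! m)) * (u ^ (qs ! m)) ^ i))"
      by (subst det_def'[of _ l]) (auto intro!: sum.cong prod.cong simp: permutes_less)
    finally show ?thesis .
  qed
  moreover have "\<dots> \<noteq> 0"
  proof (rule det_vandermonde_columns_nonzero)
    show "inj_on (\<lambda>m. u ^ (qs ! m)) {..<l}"
      using u dist by (intro inj_onI) (auto simp: l_def nth_eq_iff_index_eq)
  qed (use qsm in auto)
  ultimately show False using \<open>det A = 0\<close> by simp
qed

section \<open>Mean-square deviations and the spread of permuted sums\<close>

text \<open>The exact value is \<open>(L ^ 3 - L) / 12\<close>, the variance of equally spaced
  points; every later factor 1/12 originates here.\<close>

lemma sum_sq_dev: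
  "(\<Sum>q<L. (real q - (real L - 1) / 2)^2) \<le> real L ^ 3 / 12"
proof -
  have 1: "(\<Sum>q<L. real q) = real L * (real L - 1) / 2"
    by (induction L) (auto simp: field_simps)
  have 2: "(\<Sum>q<L. real q ^ 2) = real L * (real L - 1) * (2 * real L - 1) / 6"
    by (induction L) (auto simp: field_simps power2_eq_square)
  have "(\<Sum>q<L. (real q - (real L - 1) / 2)^2) = (\<Sum>q<L. real q ^ 2 - (real L - 1) * real q + ((real L - 1) / 2)^2)"
    by (intro sum.cong) (auto simp: power2_eq_square field_simps)
  also have "\<dots> = (\<Sum>q<L. real q ^ 2) - (real L - 1) * (\<Sum>q<L. real q) + real L * ((real L - 1) / 2)^2"
    by (simp add: sum.distrib sum_subtractf sum_distrib_left)
  also have "\<dots> = real L ^ 3 / 12 - real L / 12" unfolding 1 2 by (simp add: field_simps power2_eq_square power3_eq_cube)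
  finally show ?thesis by simp
qed

text \<open>An additive form of Cauchy--Schwarz from
  \<open>(t * \<bar>f\<bar> - \<bar>g\<bar>) ^ 2 \<ge> 0\<close>; the free weight \<open>t\<close>
  takes the place of square roots.\<close>

lemma weighted_inner_bound:
  fixes f g :: "'a \<Rightarrow> real"
  assumes t: "t > 0" and f: "(\<Sum>i\<in>I. f i ^ 2) \<le> F" and g: "(\<Sum>i\<in>I. g i ^ 2) \<le> G"
  shows "\<bar>\<Sum>i\<in>I. f i * g i\<bar> \<le> (t * F + G / t) / 2"
proof -
  have "\<bar>\<Sum>i\<in>I. f i * g i\<bar> \<le> (\<Sum>i\<in>I. \<bar>f i * g i\<bar>)" by (rule sum_abs)
  also have "\<dots> \<le> (\<Sum>i\<in>I. (t * f i ^ 2 + g i ^ 2 / t) / 2)"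
  proof (rule sum_mono)
    fix i
    have "0 \<le> (t * \<bar>f i\<bar> - \<bar>g i\<bar>)^2" by simp
    then have "2 * t * (\<bar>f i\<bar> * \<bar>g i\<bar>) \<le> t^2 * f i ^ 2 + g i ^ 2"
      by (simp add: power2_diff power_mult_distrib algebra_simps)
    then show "\<bar>f i * g i\<bar> \<le> (t * f i ^ 2 + g i ^ 2 / t) / 2"
      using t by (simp add: abs_mult field_simps power2_eq_square)
  qed
  also have "\<dots> = (t * (\<Sum>i\<in>I. f i ^ 2) + (\<Sum>i\<in>I. g i ^ 2) / t) / 2"
    by (simp add: sum.distrib sum_distrib_left sum_divide_distrib[symmetric])
  also have "\<dots> \<le> (t * F + G / t) / 2"
    using t f g by (intro divide_right_mono add_mono mult_left_mono) auto
  finally show ?thesis .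
qed

text \<open>The sums of products of the row index \<open>q\<close> with the point coordinate \<open>r\<close> vary little over
  all permutations: both families are close to equidistributed, so Cauchy--Schwarz after centering
  is efficient.\<close>

lemma permuted_product_spread:
  fixes q r :: "nat \<Rightarrow> nat"
  assumes p: "p permutes {0..<n}" "p' permutes {0..<n}"
    and q: "(\<Sum>j<n. (real (q j) - (real L - 1) / 2)^2) \<le> real n * real L ^ 2 / 12"
    and r: "(\<Sum>i<n. (real (r i) - (real R - 1) / 2)^2) \<le> real S * real R ^ 3 / 12"
    and pos: "L > 0" "R > 0"
  shows "real (\<Sum>i<n. q (p i) * r i) - real (\<Sum>i<n. q (p' i) * r i) \<le> real L * real R * (real n + real R * real S) / 12"
proof -
  define a where "a = (real L - 1) / 2"
  define b where "b = (real R - 1) / 2"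
  have bound: "\<bar>\<Sum>i<n. (real (q (p i)) - a) * (real (r i) - b)\<bar> \<le> real L * real R * (real n + real R * real S) / 24"
    if p: "p permutes {0..<n}" for p
  proof -
    have "(\<Sum>i<n. (real (q (p i)) - a)^2) = (\<Sum>j<n. (real (q j) - a)^2)"
      using sum.permute[OF p, of "\<lambda>j. (real (q j) - a)^2"] by (simp add: o_def atLeast0LessThan)
    \<comment> \<open>The weight \<open>R / L\<close> turns both halves of the bound into multiples
      of \<open>L * R\<close>.\<close>
    then have "\<bar>\<Sum>i<n. (real (q (p i)) - a) * (real (r i) - b)\<bar> \<le>
      ((real R / real L) * (real n * real L ^ 2 / 12) + (real S * real R ^ 3 / 12) / (real R / real L)) / 2"
      using pos q r by (intro weighted_inner_bound) (auto simp: a_def b_def)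
    also have "\<dots> = real L * real R * (real n + real R * real S) / 24"
      using pos by (simp add: field_simps power2_eq_square power3_eq_cube)
    finally show ?thesis .
  qed
  have expand: "real (\<Sum>i<n. q (p i) * r i) = (\<Sum>i<n. (real (q (p i)) - a) * (real (r i) - b)) +
      a * (\<Sum>i<n. real (r i)) + b * (\<Sum>j<n. real (q j)) - real n * a * b"
    if p: "p permutes {0..<n}" for p
  proof -
    have s: "(\<Sum>i<n. real (q (p i))) = (\<Sum>j<n. real (q j))"
      using sum.permute[OF p, of "\<lambda>j. real (q j)"] by (simp add: o_def atLeast0LessThan)
    have "(\<Sum>i<n. (real (q (p i)) - a) * (real (r i) - b)) =
       (\<Sum>i<n. real (q (p i)) * real (r i) - a * real (r i) - b * real (q (p i)) + a * b)"
      by (intro sum.cong) (auto simp: algebra_simps)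
    also have "\<dots> = (\<Sum>i<n. real (q (p i)) * real (r i)) - a * (\<Sum>i<n. real (r i)) - b * (\<Sum>j<n. real (q j)) + real n * a * b"
      by (simp add: sum.distrib sum_subtractf sum_distrib_left[symmetric] s)
    finally show ?thesis by simp
  qed
  show ?thesis using bound[OF p(1)] bound[OF p(2)] unfolding expand[OF p(1)] expand[OF p(2)]
    by linarith
qed

section \<open>Binomial coefficients times powers as interpolation functions\<close>

text \<open>This is the Newton expansion in \<open>m\<close>: expand \<open>v ^ (m - p)\<close> in
  powers of \<open>A * z\<close> and use C(m,p) C(m-p,e) = C(m,p+e) C(p+e,p). Thanks to the factor
  \<open>A ^ p\<close> on the left, the coefficient of C(m,d) is divisible by
  \<open>A ^ d\<close>.\<close>

lemma binomial_power_expansion: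
  fixes v A z :: int
  assumes v: "v = 1 + A * z"
  shows "A ^ p * int (m choose p) * v ^ m =
    (\<Sum>d\<le>m. int (m choose d) * A ^ d * (int (d choose p) * z ^ (d - p) * v ^ p))"
proof (cases "p \<le> m")
  case False
  then show ?thesis by (auto simp: binomial_eq_0 intro!: sum.neutral[symmetric])
next
  case True
  have "v ^ (m - p) = (\<Sum>e\<le>m - p. int ((m - p) choose e) * (A * z) ^ e)"
    unfolding v using binomial_ring[of "A * z" 1 "m - p"] by (simp add: add.commute)
  then have "A ^ p * int (m choose p) * v ^ m = (\<Sum>e\<le>m - p. int (m choose p) * int ((m - p) choose e) * A ^ (p + e) * z ^ e * v ^ p)"
  proof -
    assume h: "v ^ (m - p) = (\<Sum>e\<le>m - p. int ((m - p) choose e) * (A * z) ^ e)"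
    have "v ^ m = v ^ (m - p) * v ^ p" using True by (simp flip: power_add)
    then show ?thesis unfolding h by (simp add: sum_distrib_left sum_distrib_right power_add power_mult_distrib mult_ac)
  qed
  also have "\<dots> = (\<Sum>e\<le>m - p. int (m choose (p + e)) * A ^ (p + e) * (int ((p + e) choose p) * z ^ e * v ^ p))"
  proof (rule sum.cong[OF refl])
    fix e assume e: "e \<in> {..m - p}"
    have "(m choose (p + e)) * ((p + e) choose p) = (m choose p) * ((m - p) choose e)"
      using choose_mult[of p "p + e" m] e True by simp
    then have "int (m choose p) * int ((m - p) choose e) = int (m choose (p + e)) * int ((p + e) choose p)"
      by (metis of_nat_mult)
    then show "int (m choose p) * int ((m - p) choose e) * A ^ (p + e) * z ^ e * v ^ p =
       int (m choose (p + e)) * A ^ (p + e) * (int ((p + e) choose p) * z ^ e * v ^ p)" by simp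
  qed
  also have "\<dots> = (\<Sum>d\<in>{p..m}. int (m choose d) * A ^ d * (int (d choose p) * z ^ (d - p) * v ^ p))"
    by (rule sum.reindex_bij_witness[of _ "\<lambda>d. d - p" "\<lambda>e. p + e"]) (use True in auto)
  also have "\<dots> = (\<Sum>d\<le>m. int (m choose d) * A ^ d * (int (d choose p) * z ^ (d - p) * v ^ p))"
    by (rule sum.mono_neutral_left) (auto simp: binomial_eq_0)
  finally show ?thesis .
qed

definition binom_poly :: "nat \<Rightarrow> real poly" where
  "binom_poly p = smult (1 / fact p) (\<Prod>i=0..<p. [:- real i, 1:])"

lemma poly_binom_poly: "poly (binom_poly p) (real m) = real (m choose p)"
proof -
  have "real (m choose p) = real m gchoose p" by (simp add: binomial_gbinomial)
  also have "\<dots> = (\<Prod>i=0..<p. real m - real i) / fact p" by (simp add: gbinomial_prod_rev)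
  finally show ?thesis by (simp add: binom_poly_def poly_prod)
qed

lemma degree_binom_poly: "degree (binom_poly p) \<le> p"
proof -
  have "degree (\<Prod>i=0..<p. [:- real i, 1:]) \<le> (\<Sum>i=0..<p. degree [:- real i, 1:])"
    using degree_prod_sum_le[of "{0..<p}" "\<lambda>i. [:- real i, 1:]"] by (simp add: o_def)
  then show ?thesis by (simp add: binom_poly_def)
qed

text \<open>Evaluation at \<open>m\<close> kills every basis element of larger index, so the system
  is triangular.\<close>

lemma binom_poly_independent:
  assumes z: "(\<Sum>p<K. smult (c p) (binom_poly p)) = 0" and p: "p < K"
  shows "c p = 0"
  using p
proof (induction p rule: less_induct)
  case (less m)
  have "0 = poly (\<Sum>p<K. smult (c p) (binom_poly p)) (real m)" using z by simp
  also have "\<dots> = (\<Sum>p<K. c p * real (m choose p))" by (simp add: poly_sum poly_binom_poly)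
  also have "\<dots> = (\<Sum>p\<in>{m}. c p * real (m choose p))"
    by (rule sum.mono_neutral_right) (use less in \<open>auto simp: binomial_eq_0 not_less_iff_gr_or_eq\<close>)
  finally show ?case by simp
qed

text \<open>A column index \<open>j = q * K + p\<close> encodes a pair: \<open>q\<close> is the
  multiplier in the exponents and \<open>p\<close> the degree of the binomial coefficient.\<close>

lemma sum_div_mod_group:
  fixes g :: "nat \<Rightarrow> 'a :: comm_monoid_add"
  shows "(\<Sum>j<K*L. g j) = (\<Sum>q<L. \<Sum>p<K. g (q * K + p))"
proof -
  have "(\<Sum>j<K*L. g j) = (\<Sum>q<L. sum g {q*K..<q*K+K})"
    using sum.nat_group[of g K L] by (simp add: mult.commute)
  also have "\<dots> = (\<Sum>q<L. \<Sum>p<K. g (q * K + p))"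
  proof (rule sum.cong[OF refl])
    fix q
    show "sum g {q*K..<q*K+K} = (\<Sum>p<K. g (q * K + p))"
      by (rule sum.reindex_bij_witness[of _ "\<lambda>p. q*K+p" "\<lambda>j. j - q*K"]) auto
  qed
  finally show ?thesis .
qed

lemma sum_sq_dev_mult:
  "(\<Sum>j<K*L. (real (j div K) - (real L - 1) / 2)^2) \<le> real (K*L) * real L ^ 2 / 12"
proof -
  have "(\<Sum>j<K*L. (real (j div K) - (real L - 1) / 2)^2) = real K * (\<Sum>q<L. (real q - (real L - 1) / 2)^2)"
    unfolding sum_div_mod_group by (auto simp: sum_distrib_left intro!: sum.cong)
  also have "\<dots> \<le> real K * (real L ^ 3 / 12)" by (intro mult_left_mono sum_sq_dev) auto
  finally show ?thesis by (simp add: power2_eq_square power3_eq_cube mult_ac)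
qed

text \<open>The points are distinct, so a sum of squares over them is at most the sum over the whole
  grid.\<close>

lemma sum_sq_dev_fst:
  assumes inj: "inj_on P {..<n}" and P: "\<And>i. i < n \<Longrightarrow> P i \<in> {..<R} \<times> {..<S}"
  shows "(\<Sum>i<n. (real (fst (P i)) - (real R - 1) / 2)^2) \<le> real S * real R ^ 3 / 12"
    and "(\<Sum>i<n. (real (snd (P i)) - (real S - 1) / 2)^2) \<le> real R * real S ^ 3 / 12"
proof -
  have gen: "(\<Sum>i<n. h (P i)) \<le> (\<Sum>x\<in>{..<R} \<times> {..<S}. h x)" if "\<And>x. h x \<ge> 0" for h :: "nat \<times> nat \<Rightarrow> real"
  proof -
    have "(\<Sum>i<n. h (P i)) = sum h (P ` {..<n})" using inj by (simp add: sum.reindex)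
    also have "\<dots> \<le> (\<Sum>x\<in>{..<R} \<times> {..<S}. h x)"
    proof (rule sum_mono2)
      show "P ` {..<n} \<subseteq> {..<R} \<times> {..<S}" using P by blast
    qed (use that in auto)
    finally show ?thesis .
  qed
  have "(\<Sum>i<n. (real (fst (P i)) - (real R - 1) / 2)^2) \<le> (\<Sum>x\<in>{..<R} \<times> {..<S}. (real (fst x) - (real R - 1) / 2)^2)"
    by (rule gen) simp
  also have "\<dots> = real S * (\<Sum>r<R. (real r - (real R - 1) / 2)^2)"
    by (subst sum.cartesian_product') (simp add: sum_distrib_left)
  also have "\<dots> \<le> real S * (real R ^ 3 / 12)" by (intro mult_left_mono sum_sq_dev) auto
  finally show "(\<Sum>i<n. (real (fst (P i)) - (real R - 1) / 2)^2) \<le> real S * real R ^ 3 / 12" by simp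
  have "(\<Sum>i<n. (real (snd (P i)) - (real S - 1) / 2)^2) \<le> (\<Sum>x\<in>{..<R} \<times> {..<S}. (real (snd x) - (real S - 1) / 2)^2)"
    by (rule gen) simp
  also have "\<dots> = real R * (\<Sum>r<S. (real r - (real S - 1) / 2)^2)"
    by (subst sum.cartesian_product') simp
  also have "\<dots> \<le> real R * (real S ^ 3 / 12)" by (intro mult_left_mono sum_sq_dev) auto
  finally show "(\<Sum>i<n. (real (snd (P i)) - (real S - 1) / 2)^2) \<le> real R * real S ^ 3 / 12" by simp
qed

text \<open>Combines C(m,p) \<le> X^p / p! with K^p / p! \<le> exp K. The bound is exponential in
  \<open>p\<close>, so a product of such bounds over a permutation depends only on the sum of the
  \<open>p\<close>.\<close>

lemma binomial_le_exp_power: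
  assumes X: "real m \<le> X" and K: "K > 0"
  shows "real (m choose p) \<le> exp (real K) * (X / real K) ^ p"
proof -
  have "real (m choose p) * fact p \<le> real m ^ p"
    using binomial_fact_pow[of m p] by (metis of_nat_fact of_nat_le_iff of_nat_mult of_nat_power)
  also have "\<dots> \<le> X ^ p" using X by (intro power_mono) auto
  finally have 1: "real (m choose p) \<le> X ^ p / fact p" by (simp add: field_simps)
  have "real K ^ p / fact p \<le> exp (real K)"
  proof -
    have "(\<Sum>i\<in>{p}. real K ^ i /\<^sub>R fact i) \<le> exp (real K)"
      unfolding exp_def by (rule sum_le_suminf) (use summable_exp[of "real K"] in auto)
    then show ?thesis by (simp add: field_simps)
  qed
  then have "(X / real K) ^ p * (real K ^ p / fact p) \<le> (X / real K) ^ p * exp (real K)"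
    using X by (intro mult_left_mono zero_le_power) (auto intro: divide_nonneg_nonneg order_trans[OF of_nat_0_le_iff])
  moreover have "X ^ p / fact p = (X / real K) ^ p * (real K ^ p / fact p)"
    using K by (simp add: power_divide)
  ultimately show ?thesis using 1 by (simp add: mult.commute)
qed

section \<open>The interpolation determinant: arithmetic against archimedean size\<close>

text \<open>Since \<open>- c\<close> is \<open>b ^ (y1 + n0 * N)\<close> modulo
  \<open>a ^ x2\<close>, the entry \<open>E j\<close> at (r,s) agrees modulo \<open>a ^ x2\<close>
  with \<open>b ^ (y1 * (q * (S - 1)))\<close> times C(\<xi>,p) times
  \<open>b ^ (n0 * q * \<xi>)\<close>, where \<open>\<xi> = r + N * s\<close>. The zero estimate
  yields points with nonzero determinant. Its divisibility by a power of \<open>a ^ k\<close> gives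
  the left side. On the right stand the contributions of \<open>n!\<close>, of the binomial
  coefficients, of the powers of \<open>b ^ n0\<close>, and of the powers of \<open>b ^ y1\<close>
  and \<open>c\<close> together.\<close>

lemma interpolation_inequality:
  fixes a b c N k K L R S n0 y1 x1 x2 :: nat and X :: real
  assumes a: "a > 1" "coprime a b" "coprime a c" and b: "b > 1" and c: "c > 0"
    and dvd: "int a ^ k dvd int b ^ n0 - 1" and n0: "n0 > 0"
    and e1: "b ^ y1 + c = a ^ x1"
    and e2: "b ^ (y1 + n0 * N) + c = a ^ x2"
    and K: "K > 0" and L: "L > 0"
    and R: "R \<le> N" and RS: "(K - 1) * L < R * S"
    and x2: "k * (K * L - 1) \<le> x2"
    and X0: "X > 0" and X: "real (R + L - 2 + N * (S - 1)) \<le> X"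
  shows "real k * (real (K * L) * (real (K * L) - real K) / 2) * ln a \<le>
     real (K*L) * ln (real (K*L)) + real (K*L) * (real K + (real K - 1) / 2 * ln (X / real K))
     + real L * real (R + L - 1) * (real (K*L) + real (R + L - 1) * real S) / 12 * real n0 * ln b
     + real L * real S * (real (K*L) + real S * real (R + L - 1)) / 12 * real x1 * ln a"
proof -
  define n where "n = K * L"
  define T where "T = R + L - 1"
  define q where "q j = j div K" for j
  define p where "p j = j mod K" for j
  have n: "n > 0" using K L by (simp add: n_def)
  have qL: "q j < L" if "j < n" for j using that K by (simp add: q_def n_def less_mult_imp_div_less mult.commute)
  have pK: "p j < K" for j using K by (simp add: p_def)
  have RS0: "R > 0" "S > 0" using RS by (auto intro!: Nat.gr0I)
  define E :: "nat \<Rightarrow> nat \<times> nat \<Rightarrow> int" where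
    "E j = (\<lambda>(r,s). int ((r + N * s) choose p j) * int b ^ (n0 * (q j * r)) * (- int c) ^ (q j * s) * int b ^ (y1 * (q j * (S - 1 - s))))" for j
  let ?\<Omega> = "{..<T} \<times> {..<S}"
  have "\<exists>P. (\<forall>i<n. P i \<in> ?\<Omega>) \<and> det (mat n n (\<lambda>(i,j). real_of_int (E j (P i)))) \<noteq> 0"
  proof (rule exists_points_det_nonzero)
    fix cc :: "nat \<Rightarrow> real" assume cc: "\<exists>i<n. cc i \<noteq> 0"
    show "\<exists>x\<in>?\<Omega>. (\<Sum>j<n. cc j * real_of_int (E j x)) \<noteq> 0"
    proof (rule ccontr)
      assume "\<not> ?thesis"
      then have z: "(\<Sum>j<n. cc j * real_of_int (E j (r,s))) = 0" if "r < T" "s < S" for r s using that by auto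
      \<comment> \<open>Divided by \<open>b ^ (y1 * (q * (S - 1)))\<close> the entries are
        exponential polynomials in \<open>u\<close> and \<open>w\<close>; the exponent
        \<open>S - 1 - s\<close> in \<open>E\<close> only clears the denominators of
        \<open>w\<close>. Modulo \<open>a ^ x2\<close>, \<open>w\<close> is
        \<open>u ^ N\<close>.\<close>
      define u where "u = real b ^ n0"
      define w where "w = - (real c / real b ^ y1)"
      define C where "C Q = (\<Sum>P<K. smult (cc (Q * K + P) * real b ^ (y1 * (Q * (S - 1)))) (binom_poly P))" for Q
      have C0: "C Q = 0" if Q: "Q < L" for Q
      proof (rule exp_poly_grid_zero[where u = u and w = w and L = L and k = "K - 1" and R = R and S = S and N = N])
        show "u > 1" using b n0 by (simp add: u_def one_less_power)
        show "w \<noteq> 0" using b c by (simp add: w_def)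
        show "degree (C Q) \<le> K - 1" for Q
          unfolding C_def using K by (intro degree_sum_le) (auto intro!: order_trans[OF degree_smult_le] order_trans[OF degree_binom_poly])
        show "(\<Sum>q<L. poly (C q) (real (r + N * s)) * (u ^ r * w ^ s) ^ q) = 0" if r: "r + 1 < R + L" and s: "s < S" for r s
        proof -
          have "(\<Sum>q<L. poly (C q) (real (r + N * s)) * (u ^ r * w ^ s) ^ q) =
             (\<Sum>Q<L. \<Sum>P<K. cc (Q * K + P) * real_of_int (E (Q * K + P) (r, s)))"
          proof (rule sum.cong[OF refl])
            fix Q
            have "real b ^ (y1 * (Q * (S - 1))) * (u ^ r * w ^ s) ^ Q = real b ^ (n0 * (Q * r)) * (- real c) ^ (Q * s) * real b ^ (y1 * (Q * (S - 1 - s)))"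
            proof -
              have "y1 * (Q * (S - 1)) = y1 * (Q * (S - 1 - s)) + y1 * (Q * s)" using s
                by (metis add_mult_distrib2 add_diff_inverse_nat add.commute less_Suc_eq_le not_less Suc_pred' RS0(2))
              then have "real b ^ (y1 * (Q * (S - 1))) = real b ^ (y1 * (Q * (S - 1 - s))) * (real b ^ y1) ^ (s * Q)"
                by (simp add: power_add power_mult mult.commute)
              moreover have "(u ^ r * w ^ s) ^ Q = real b ^ (n0 * (Q * r)) * w ^ (s * Q)"
                by (simp add: u_def power_mult_distrib power_mult[symmetric] mult_ac)
              moreover have "w ^ (s * Q) = (- real c) ^ (s * Q) / (real b ^ y1) ^ (s * Q)"
                by (simp add: w_def flip: power_divide)
              ultimately show ?thesis using b by (simp add: mult_ac)
            qed
            then have *: "real b ^ (y1 * (Q * (S - 1))) * (u ^ r * w ^ s) ^ Q * x = real b ^ (n0 * (Q * r)) * (- real c) ^ (Q * s) * real b ^ (y1 * (Q * (S - 1 - s))) * x" for x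
              by simp
            show "poly (C Q) (real (r + N * s)) * (u ^ r * w ^ s) ^ Q = (\<Sum>P<K. cc (Q * K + P) * real_of_int (E (Q * K + P) (r, s)))"
              unfolding C_def poly_sum sum_distrib_right
            proof (rule sum.cong[OF refl])
              fix P assume "P \<in> {..<K}"
              then have "q (Q * K + P) = Q" "p (Q * K + P) = P" by (auto simp: q_def p_def)
              then show "poly (smult (cc (Q * K + P) * real b ^ (y1 * (Q * (S - 1)))) (binom_poly P)) (real (r + N * s)) * (u ^ r * w ^ s) ^ Q =
                 cc (Q * K + P) * real_of_int (E (Q * K + P) (r, s))"
                using *[of "cc (Q * K + P) * real (r + N * s choose P)"]
                by (simp add: E_def poly_binom_poly mult_ac flip: of_nat_add of_nat_mult)
            qed
          qed
          also have "\<dots> = (\<Sum>j<n. cc j * real_of_int (E j (r, s)))" unfolding n_def sum_div_mod_group ..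
          finally show ?thesis using z[of r s] r s by (simp add: T_def)
        qed
      qed (use R RS Q in auto)
      obtain i where i: "i < n" "cc i \<noteq> 0" using cc by blast
      have "cc (q i * K + p i) * real b ^ (y1 * (q i * (S - 1))) = 0"
        using C0[OF qL[OF i(1)]] unfolding C_def by (rule binom_poly_independent[where c = "\<lambda>P. cc (q i * K + P) * real b ^ (y1 * (q i * (S - 1)))"]) (rule pK)
      then show False using i(2) b by (simp add: q_def p_def)
    qed
  qed
  then obtain P where P: "\<And>i. i < n \<Longrightarrow> P i \<in> ?\<Omega>" and det0: "det (mat n n (\<lambda>(i,j). real_of_int (E j (P i)))) \<noteq> 0" by blast
  define M where "M = mat n n (\<lambda>(i,j). E j (P i))"
  have M: "M \<in> carrier_mat n n" by (simp add: M_def)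
  have "map_mat real_of_int M = mat n n (\<lambda>(i,j). real_of_int (E j (P i)))"
    by (rule eq_matI) (auto simp: M_def)
  then have dM: "det M \<noteq> 0" using det0 by (metis of_int_hom.hom_det of_int_0)
  have injP: "inj_on P {..<n}"
  proof (rule inj_onI, rule ccontr)
    fix i j assume ij: "i \<in> {..<n}" "j \<in> {..<n}" "P i = P j" "i \<noteq> j"
    have "row M i = row M j" by (rule eq_vecI) (use ij in \<open>auto simp: M_def\<close>)
    then show False using det_identical_rows[OF M ij(4)] ij dM by auto
  qed
  define r where "r i = fst (P i)" for i
  define s where "s i = snd (P i)" for i
  have rs: "r i < T" "s i < S" if "i < n" for i using P[OF that] by (auto simp: r_def s_def mem_Times_iff)
  define \<xi> where "\<xi> i = r i + N * s i" for i
  have Eij: "E j (P i) = int (\<xi> i choose p j) * int b ^ (n0 * (q j * r i)) * (- int c) ^ (q j * s i) * int b ^ (y1 * (q j * (S - 1 - s i)))" for i j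
    by (simp add: E_def r_def s_def \<xi>_def case_prod_unfold)
  text \<open>Divisibility: modulo \<open>a ^ x2\<close> the entry is a function of \<open>\<xi> i\<close> alone, which has a Newton
    expansion with \<open>a\<close>-adically decreasing coefficients.\<close>
  define A where "A = int a ^ k"
  have pd: "A ^ (\<Sum>{..<n}) dvd A ^ (\<Sum>j<n. p j) * det M"
  proof -
    define D where "D = n - 1"
    have nD: "n = Suc D" using n by (simp add: D_def)
    have "\<exists>z. int b ^ (n0 * Q) = 1 + A * z" for Q
    proof -
      have "int b ^ n0 - 1 dvd (int b ^ n0) ^ Q - 1" by (metis dvd_triv_left power_diff_1_eq)
      then have "A dvd (int b ^ n0) ^ Q - 1" using dvd unfolding A_def by (rule dvd_trans[rotated])
      then obtain z where "(int b ^ n0) ^ Q - 1 = A * z" by (elim dvdE)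
      then show ?thesis by (intro exI[of _ z]) (simp add: power_mult)
    qed
    then obtain z where z: "\<And>Q. int b ^ (n0 * Q) = 1 + A * z Q" by metis
    define v where "v j = int b ^ (n0 * q j)" for j
    define W where "W d j = int b ^ (y1 * (q j * (S - 1))) * (int (d choose p j) * z (q j) ^ (d - p j) * v j ^ p j)" for d j
    define V where "V i d = int (\<xi> i choose d)" for i d
    have cong: "A ^ D dvd A ^ p j * E j (P i) - (\<Sum>d<D. V i d * A ^ d * W d j)" if i: "i < n" and j: "j < n" for i j
    proof -
      let ?e = "int b ^ (y1 * (q j * (S - 1)))"
      have AX: "A ^ D dvd int a ^ x2"
        unfolding A_def power_mult[symmetric] using x2 by (intro le_imp_power_dvd) (simp add: D_def n_def)
      have "int a ^ x2 = int b ^ y1 * int b ^ (n0 * N) - (- int c)" using e2 by (simp add: power_add flip: of_nat_power of_nat_mult of_nat_add)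
      then have 1: "A ^ D dvd (int b ^ y1 * int b ^ (n0 * N)) ^ (q j * s i) - (- int c) ^ (q j * s i)"
        using AX by (metis dvd_trans dvd_triv_left power_diff_sumr2)
      have ex: "y1 * (q j * (S - 1)) = y1 * (q j * (S - 1 - s i)) + y1 * (q j * s i)"
        using rs(2)[OF i] by (metis add_mult_distrib2 add_diff_inverse_nat add.commute less_Suc_eq_le not_less Suc_pred' RS0(2))
      have "(int b ^ y1 * int b ^ (n0 * N)) ^ (q j * s i) * (int b ^ (n0 * (q j * r i)) * int b ^ (y1 * (q j * (S - 1 - s i)))) = ?e * v j ^ \<xi> i"
        unfolding ex v_def \<xi>_def by (simp add: power_add power_mult_distrib power_mult[symmetric] algebra_simps)
      then have "A ^ p j * int (\<xi> i choose p j) * (?e * v j ^ \<xi> i) - A ^ p j * E j (P i) =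
         (A ^ p j * int (\<xi> i choose p j) * (int b ^ (n0 * (q j * r i)) * int b ^ (y1 * (q j * (S - 1 - s i))))) * ((int b ^ y1 * int b ^ (n0 * N)) ^ (q j * s i) - (- int c) ^ (q j * s i))"
        unfolding Eij by (simp add: algebra_simps)
      then have 2: "A ^ D dvd A ^ p j * int (\<xi> i choose p j) * (?e * v j ^ \<xi> i) - A ^ p j * E j (P i)"
        using 1 by simp
      have "A ^ p j * int (\<xi> i choose p j) * (?e * v j ^ \<xi> i) = ?e * (A ^ p j * int (\<xi> i choose p j) * v j ^ \<xi> i)" by simp
      also have "\<dots> = (\<Sum>d\<le>\<xi> i. V i d * A ^ d * W d j)"
        unfolding binomial_power_expansion[OF z[of "q j", folded v_def], of "p j" "\<xi> i"]
        by (simp add: sum_distrib_left V_def W_def mult_ac)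
      also have "\<dots> = (\<Sum>d<D + Suc (\<xi> i). V i d * A ^ d * W d j)"
        by (rule sum.mono_neutral_left) (auto simp: V_def binomial_eq_0)
      also have "\<dots> = (\<Sum>d<D. V i d * A ^ d * W d j) + (\<Sum>d\<in>{D..<D + Suc (\<xi> i)}. V i d * A ^ d * W d j)"
      proof -
        have eq: "{..<D + Suc (\<xi> i)} = {..<D} \<union> {D..<D + Suc (\<xi> i)}" by auto
        show ?thesis unfolding eq by (rule sum.union_disjoint) auto
      qed
      finally have 3: "A ^ p j * int (\<xi> i choose p j) * (?e * v j ^ \<xi> i) - (\<Sum>d<D. V i d * A ^ d * W d j) = (\<Sum>d\<in>{D..<D + Suc (\<xi> i)}. V i d * A ^ d * W d j)" by simp
      have "A ^ D dvd (\<Sum>d\<in>{D..<D + Suc (\<xi> i)}. V i d * A ^ d * W d j)"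
        by (intro dvd_sum dvd_mult2 dvd_mult le_imp_power_dvd) auto
      then have 4: "A ^ D dvd A ^ p j * int (\<xi> i choose p j) * (?e * v j ^ \<xi> i) - (\<Sum>d<D. V i d * A ^ d * W d j)"
        unfolding 3 .
      have "x - y - (x - z) = z - y" for x y z :: int by simp
      with dvd_diff[OF 4 2] show ?thesis by simp
    qed
    define H where "H i j = (A ^ p j * E j (P i) - (\<Sum>d<D. V i d * A ^ d * W d j)) div A ^ D" for i j
    have "A ^ p j * E j (P i) = (\<Sum>d<D. V i d * A ^ d * W d j) + A ^ D * H i j" if "i < n" "j < n" for i j
      using dvd_mult_div_cancel[OF cong[OF that]] unfolding H_def by simp
    then have "A ^ (\<Sum>{..<n}) dvd det (mat n n (\<lambda>(i,j). A ^ p j * E j (P i)))"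
      unfolding nD by (rule power_dvd_det_filtered)
    also have "det (mat n n (\<lambda>(i,j). A ^ p j * E j (P i))) = A ^ (\<Sum>j<n. p j) * det M"
    proof -
      have "(\<Sum>pp\<in>{p. p permutes {0..<n}}. signof pp * (\<Prod>i=0..<n. A ^ p (pp i) * E (pp i) (P i))) =
         (\<Sum>pp\<in>{p. p permutes {0..<n}}. A ^ (\<Sum>j<n. p j) * (signof pp * (\<Prod>i=0..<n. E (pp i) (P i))))"
      proof (rule sum.cong[OF refl])
        fix pp assume "pp \<in> {p. p permutes {0..<n}}"
        then have pp: "pp permutes {0..<n}" by simp
        have "(\<Prod>i=0..<n. A ^ p (pp i)) = A ^ (\<Sum>i=0..<n. p (pp i))" by (simp add: power_sum)
        also have "(\<Sum>i=0..<n. p (pp i)) = (\<Sum>j<n. p j)"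
          using sum.permute[OF pp, of p] by (simp add: o_def atLeast0LessThan)
        finally show "signof pp * (\<Prod>i=0..<n. A ^ p (pp i) * E (pp i) (P i)) = A ^ (\<Sum>j<n. p j) * (signof pp * (\<Prod>i=0..<n. E (pp i) (P i)))"
          by (simp add: prod.distrib)
      qed
      then show ?thesis unfolding M_def
        by (subst (1 2) det_def'[of _ n]) (auto simp: sum_distrib_left permutes_less intro!: sum.cong)
    qed
    finally show ?thesis .
  qed
  have sump: "real (\<Sum>j<n. p j) = real n * (real K - 1) / 2"
  proof -
    have "real (\<Sum>j<n. p j) = (\<Sum>Q<L. \<Sum>P<K. real ((Q * K + P) mod K))"
      unfolding n_def p_def of_nat_sum sum_div_mod_group ..
    also have "\<dots> = (\<Sum>Q<L. \<Sum>P<K. real P)" by (intro sum.cong) auto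
    also have "(\<Sum>P<K. real P) = real K * (real K - 1) / 2"
      by (induction K) (auto simp: field_simps)
    finally show ?thesis by (simp add: n_def)
  qed
  have sumn: "real (\<Sum>{..<n}) = real n * (real n - 1) / 2"
    by (induction n) (auto simp: field_simps)
  have "(\<Sum>j<n. p j) \<le> (\<Sum>{..<n})"
  proof -
    have "K \<le> n" using L by (simp add: n_def)
    then have "real n * (real K - 1) / 2 \<le> real n * (real n - 1) / 2"
      by (intro divide_right_mono mult_left_mono) auto
    then show ?thesis using sump sumn by linarith
  qed
  \<comment> \<open>The determinant with columns scaled by \<open>A ^ p j\<close> is divisible by
    \<open>A\<close> to the power 0 + ... + (n - 1); \<open>v\<close> is what remains once the
    scaling is taken out.\<close>
  then obtain v where v: "(\<Sum>{..<n}) = (\<Sum>j<n. p j) + v" using le_Suc_ex by blast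
  have A0: "A > 0" using a by (simp add: A_def)
  have Av: "A ^ v dvd det M"
    using pd A0 unfolding v power_add by (simp add: mult_ac dvd_times_left_cancel_iff)
  let ?P = "{\<pi>. \<pi> permutes {0..<n}}"
  have finP: "finite ?P" by (simp add: finite_permutations)
  have idP: "id \<in> ?P" by (simp add: permutes_id)
  then have neP: "?P \<noteq> {}" by blast
  define X1 where "X1 \<pi> = (\<Sum>i<n. q (\<pi> i) * r i)" for \<pi> :: "nat \<Rightarrow> nat"
  define X2 where "X2 \<pi> = (\<Sum>i<n. q (\<pi> i) * s i)" for \<pi> :: "nat \<Rightarrow> nat"
  define Z where "Z \<pi> = (\<Sum>i<n. q (\<pi> i) * (S - 1 - s i))" for \<pi> :: "nat \<Rightarrow> nat"
  define CC where "CC \<pi> = (\<Prod>i<n. \<xi> i choose p (\<pi> i))" for \<pi> :: "nat \<Rightarrow> nat"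
  \<comment> \<open>The smallest exponents are factored out of all terms. The common factor
    \<open>g\<close> is prime to \<open>a\<close>, so the cofactor \<Delta> keeps the whole power of
    \<open>A\<close>, and its size depends only on differences of exponents.\<close>
  define m1 where "m1 = Min (X1 ` ?P)"
  define m2 where "m2 = Min (X2 ` ?P)"
  define mz where "mz = Min (Z ` ?P)"
  have mle: "m1 \<le> X1 \<pi>" "m2 \<le> X2 \<pi>" "mz \<le> Z \<pi>" if "\<pi> \<in> ?P" for \<pi>
    using that finP by (auto simp: m1_def m2_def mz_def)
  \<comment> \<open>\<open>X2\<close> and \<open>Z\<close> have a constant sum, so the exponents of
    \<open>c\<close> and of \<open>b ^ y1\<close> together contribute one spread of
    \<open>X2\<close> rather than two.\<close>
  have XZ: "X2 \<pi> + Z \<pi> = (S - 1) * (\<Sum>j<n. q j)" if "\<pi> \<in> ?P" for \<pi>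
  proof -
    have "X2 \<pi> + Z \<pi> = (\<Sum>i<n. q (\<pi> i) * (S - 1))"
      unfolding X2_def Z_def sum.distrib[symmetric]
    proof (rule sum.cong[OF refl])
      fix i assume "i \<in> {..<n}"
      then have "s i + (S - 1 - s i) = S - 1" using rs(2)[of i] by simp
      then show "q (\<pi> i) * s i + q (\<pi> i) * (S - 1 - s i) = q (\<pi> i) * (S - 1)"
        by (metis add_mult_distrib2)
    qed
    also have "\<dots> = (S - 1) * (\<Sum>i<n. q (\<pi> i))" by (simp add: sum_distrib_left mult.commute)
    also have "(\<Sum>i<n. q (\<pi> i)) = (\<Sum>j<n. q j)"
      using sum.permute[of \<pi> "{0..<n}" q] that by (simp add: o_def atLeast0LessThan)
    finally show ?thesis .
  qed
  define G where "G \<pi> = signof \<pi> * ((- 1) ^ X2 \<pi> * int (CC \<pi>) * int b ^ (n0 * (X1 \<pi> - m1)) * int b ^ (y1 * (Z \<pi> - mz)) * int c ^ (X2 \<pi> - m2))" for \<pi>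
  define g where "g = int b ^ (n0 * m1 + y1 * mz) * int c ^ m2"
  define \<Delta> where "\<Delta> = (\<Sum>\<pi>\<in>?P. G \<pi>)"
  have detg: "det M = g * \<Delta>"
  proof -
    have "det M = (\<Sum>\<pi>\<in>?P. signof \<pi> * (\<Prod>i=0..<n. E (\<pi> i) (P i)))"
      by (subst det_def'[OF M]) (auto intro!: sum.cong prod.cong simp: M_def permutes_less)
    also have "\<dots> = (\<Sum>\<pi>\<in>?P. g * G \<pi>)"
    proof (rule sum.cong[OF refl])
      fix \<pi> assume \<pi>: "\<pi> \<in> ?P"
      have "(\<Prod>i=0..<n. E (\<pi> i) (P i)) = int (CC \<pi>) * int b ^ (n0 * X1 \<pi>) * (- int c) ^ X2 \<pi> * int b ^ (y1 * Z \<pi>)"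
        unfolding Eij prod.distrib by (simp add: CC_def X1_def X2_def Z_def power_sum sum_distrib_left atLeast0LessThan)
      moreover have "int b ^ (n0 * X1 \<pi>) = int b ^ (n0 * m1) * int b ^ (n0 * (X1 \<pi> - m1))"
        "int b ^ (y1 * Z \<pi>) = int b ^ (y1 * mz) * int b ^ (y1 * (Z \<pi> - mz))"
        "int c ^ X2 \<pi> = int c ^ m2 * int c ^ (X2 \<pi> - m2)"
        using mle[OF \<pi>] by (simp_all flip: power_add add_mult_distrib2)
      moreover have "(- int c) ^ X2 \<pi> = (- 1) ^ X2 \<pi> * int c ^ X2 \<pi>"
        by (rule power_minus)
      ultimately show "signof \<pi> * (\<Prod>i=0..<n. E (\<pi> i) (P i)) = g * G \<pi>"
        by (simp add: g_def G_def power_add)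
    qed
    finally show ?thesis by (simp add: \<Delta>_def sum_distrib_left)
  qed
  have "coprime (A ^ v) g"
    using a unfolding A_def g_def by (simp add: coprime_power_left_iff coprime_power_right_iff)
  then have Avd: "A ^ v dvd \<Delta>" using Av unfolding detg by (simp add: coprime_dvd_mult_right_iff)
  have "\<Delta> \<noteq> 0" using dM detg by auto
  then have "A ^ v \<le> \<bar>\<Delta>\<bar>" using Avd dvd_imp_le_int by (metis abs_of_pos A0 zero_less_power)
  define B where "B = exp (real n * real K) * (X / real K) ^ (\<Sum>j<n. p j) *
     exp (real L * real T * (real n + real T * real S) / 12 * real n0 * ln b) *
     exp (real L * real S * (real n + real S * real T) / 12 * real x1 * ln a)"
  have T0: "T > 0" using RS0 L by (simp add: T_def)
  have XT: "real (\<xi> i) \<le> X" if "i < n" for i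
  proof -
    have "r i \<le> R + L - 2" "s i \<le> S - 1" using rs[OF that] by (auto simp: T_def)
    then have "\<xi> i \<le> R + L - 2 + N * (S - 1)" unfolding \<xi>_def by (intro add_mono mult_left_mono) auto
    then show ?thesis using X by linarith
  qed
  have "(\<Sum>j<n. (real (q j) - (real L - 1) / 2)^2) \<le> real n * real L ^ 2 / 12"
    unfolding n_def q_def by (rule sum_sq_dev_mult)
  note spread = permuted_product_spread[OF _ _ this]
  have D1: "real (X1 \<pi>) - real (X1 \<pi>') \<le> real L * real T * (real n + real T * real S) / 12"
    if "\<pi> \<in> ?P" "\<pi>' \<in> ?P" for \<pi> \<pi>'
    unfolding X1_def using that sum_sq_dev_fst(1)[OF injP P] L T0 by (intro spread) (auto simp: r_def)
  have D2: "real (X2 \<pi>) - real (X2 \<pi>') \<le> real L * real S * (real n + real S * real T) / 12"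
    if "\<pi> \<in> ?P" "\<pi>' \<in> ?P" for \<pi> \<pi>'
    unfolding X2_def using that sum_sq_dev_fst(2)[OF injP P] L RS0 by (intro spread) (auto simp: s_def)
  have Gb: "real_of_int \<bar>G \<pi>\<bar> \<le> B" if \<pi>: "\<pi> \<in> ?P" for \<pi>
  proof -
    have sg: "\<bar>signof \<pi> :: int\<bar> = 1" by (simp add: sign_def)
    have c0: "real_of_int \<bar>G \<pi>\<bar> = real (CC \<pi>) * real b ^ (n0 * (X1 \<pi> - m1)) * (real b ^ (y1 * (Z \<pi> - mz)) * real c ^ (X2 \<pi> - m2))"
      unfolding G_def abs_mult sg by (simp add: power_abs)
    have c1: "real (CC \<pi>) \<le> exp (real n * real K) * (X / real K) ^ (\<Sum>j<n. p j)"
    proof -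
      have "real (CC \<pi>) \<le> (\<Prod>i<n. exp (real K) * (X / real K) ^ p (\<pi> i))"
        unfolding CC_def of_nat_prod using binomial_le_exp_power[OF XT K] by (intro prod_mono) auto
      also have "\<dots> = exp (real n * real K) * (X / real K) ^ (\<Sum>i<n. p (\<pi> i))"
        by (simp add: prod.distrib power_sum exp_of_nat_mult)
      also have "(\<Sum>i<n. p (\<pi> i)) = (\<Sum>j<n. p j)"
        using sum.permute[of \<pi> "{0..<n}" p] \<pi> by (simp add: o_def atLeast0LessThan)
      finally show ?thesis .
    qed
    have c2: "real b ^ (n0 * (X1 \<pi> - m1)) \<le> exp (real L * real T * (real n + real T * real S) / 12 * real n0 * ln b)"
    proof -
      have "m1 \<in> X1 ` ?P" unfolding m1_def by (rule Min_in) (use finP neP in auto)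
      then obtain \<pi>' where "\<pi>' \<in> ?P" "m1 = X1 \<pi>'" by blast
      then have "real (X1 \<pi> - m1) \<le> real L * real T * (real n + real T * real S) / 12"
        using D1[OF \<pi>] mle(1)[OF \<pi>] by (simp add: of_nat_diff)
      moreover have "0 \<le> real n0 * ln b" using b by simp
      ultimately have "real (X1 \<pi> - m1) * (real n0 * ln b) \<le> real L * real T * (real n + real T * real S) / 12 * (real n0 * ln b)"
        by (rule mult_right_mono)
      moreover have "real b ^ (n0 * (X1 \<pi> - m1)) = exp (real (X1 \<pi> - m1) * (real n0 * ln b))"
        using b by (simp add: exp_of_nat_mult power_mult mult_ac flip: powr_realpow) (simp add: powr_def mult_ac)
      ultimately show ?thesis by (simp add: mult_ac)
    qed
    have c3: "real b ^ (y1 * (Z \<pi> - mz)) * real c ^ (X2 \<pi> - m2) \<le> exp (real L * real S * (real n + real S * real T) / 12 * real x1 * ln a)"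
    proof -
      have "mz \<in> Z ` ?P" unfolding mz_def by (rule Min_in) (use finP neP in auto)
      then obtain \<pi>' where p': "\<pi>' \<in> ?P" "mz = Z \<pi>'" by blast
      have "m2 \<in> X2 ` ?P" unfolding m2_def by (rule Min_in) (use finP neP in auto)
      then obtain \<pi>'' where p'': "\<pi>'' \<in> ?P" "m2 = X2 \<pi>''" by blast
      have "real b ^ (y1 * (Z \<pi> - mz)) * real c ^ (X2 \<pi> - m2) \<le> (real a ^ x1) ^ (Z \<pi> - mz) * (real a ^ x1) ^ (X2 \<pi> - m2)"
      proof (rule mult_mono)
        have "real b ^ y1 \<le> real a ^ x1" "real c \<le> real a ^ x1" using e1 by (metis le_add1 le_add2 of_nat_le_iff of_nat_power)+
        then show "real b ^ (y1 * (Z \<pi> - mz)) \<le> (real a ^ x1) ^ (Z \<pi> - mz)" "real c ^ (X2 \<pi> - m2) \<le> (real a ^ x1) ^ (X2 \<pi> - m2)"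
          unfolding power_mult by (auto intro!: power_mono)
      qed auto
      also have "\<dots> = exp (real ((Z \<pi> - mz) + (X2 \<pi> - m2)) * (real x1 * ln a))"
        using a by (simp add: power_add[symmetric] power_mult[symmetric] flip: powr_realpow)
          (simp add: powr_def algebra_simps flip: exp_add)
      also have "\<dots> \<le> exp (real L * real S * (real n + real S * real T) / 12 * (real x1 * ln a))"
      proof -
        have "real ((Z \<pi> - mz) + (X2 \<pi> - m2)) = real (X2 \<pi>') - real (X2 \<pi>'')"
          using XZ[OF \<pi>] XZ[OF p'(1)] mle[OF \<pi>] p'(2) p''(2) by linarith
        then have "real ((Z \<pi> - mz) + (X2 \<pi> - m2)) \<le> real L * real S * (real n + real S * real T) / 12"
          using D2[OF p'(1) p''(1)] by simp
        moreover have "0 \<le> real x1 * ln a" using a by simp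
        ultimately show ?thesis unfolding exp_le_cancel_iff by (rule mult_right_mono)
      qed
      finally show ?thesis by (simp add: mult_ac)
    qed
    show ?thesis unfolding c0 B_def
      using X0 by (intro mult_mono c1 c2 c3) auto
  qed
  have "real_of_int (A ^ v) \<le> real_of_int \<bar>\<Delta>\<bar>" using \<open>A ^ v \<le> \<bar>\<Delta>\<bar>\<close> by linarith
  also have "\<dots> \<le> (\<Sum>\<pi>\<in>?P. real_of_int \<bar>G \<pi>\<bar>)"
    unfolding \<Delta>_def of_int_sum[symmetric] of_int_le_iff by (rule sum_abs)
  also have "\<dots> \<le> (\<Sum>\<pi>\<in>?P. B)" by (intro sum_mono Gb)
  also have "\<dots> = fact n * B" by (simp add: card_permutations[OF refl])
  also have "\<dots> \<le> real n ^ n * B"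
    using fact_le_power[of n, where 'a = real] X0 by (intro mult_right_mono) (auto simp: B_def)
  finally have f1: "ln (real_of_int (A ^ v)) \<le> ln (real n ^ n * B)"
    using A0 by (intro ln_mono) auto
  have f2: "ln (real n ^ n * B) = real n * ln (real n) + real n * real K + real (\<Sum>j<n. p j) * ln (X / real K) +
     real L * real T * (real n + real T * real S) / 12 * real n0 * ln b +
     real L * real S * (real n + real S * real T) / 12 * real x1 * ln a"
    using n X0 K by (simp add: B_def ln_mult ln_realpow del: of_nat_sum)
  have f3: "ln (real_of_int (A ^ v)) = real v * (real k * ln a)"
    using a by (simp add: A_def ln_realpow)
  have f4: "real v = real n * (real n - real K) / 2"
    using arg_cong[OF v, of real] sump sumn by (simp add: field_simps del: of_nat_sum)
  have fin: "real n * (real n - real K) / 2 * (real k * ln a) \<le> real n * ln (real n) + real n * real K +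
     real n * (real K - 1) / 2 * ln (X / real K) +
     real L * real T * (real n + real T * real S) / 12 * real n0 * ln b +
     real L * real S * (real n + real S * real T) / 12 * real x1 * ln a"
    using f1 unfolding f2 f3 f4 sump .
  have "real k * (real n * (real n - real K) / 2) * ln a = real n * (real n - real K) / 2 * (real k * ln a)"
    by simp
  moreover have "real n * (real K + (real K - 1) / 2 * ln (X / real K)) = real n * real K + real n * (real K - 1) / 2 * ln (X / real K)"
    by (simp add: distrib_left)
  ultimately show ?thesis using fin unfolding n_def[symmetric] T_def[symmetric] by linarith
qed

section \<open>Choice of the parameters of the determinant\<close>

text \<open>Uses \<open>ln (y / x) \<le> y / x - 1\<close>, enlarged by the factor
  \<open>ln x \<ge> 1\<close>.\<close>

lemma ln_div_self_antimono:
  fixes x y :: real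
  assumes "exp 1 \<le> x" "x \<le> y"
  shows "ln y / y \<le> ln x / x"
proof -
  have x: "x > 0" using assms(1) exp_gt_zero[of "1::real"] by linarith
  have "ln (y / x) \<le> y / x - 1" using assms x by (intro ln_le_minus_one) auto
  then have "ln y \<le> ln x + (y / x - 1)" using assms x by (simp add: ln_div)
  also have "\<dots> \<le> ln x + (y / x - 1) * ln x"
  proof -
    have "1 \<le> ln x" using assms x by (metis ln_exp ln_le_cancel_iff exp_gt_zero)
    then have "(y / x - 1) * 1 \<le> (y / x - 1) * ln x" using assms x by (intro mult_left_mono) auto
    then show ?thesis by simp
  qed
  also have "\<dots> = y * (ln x / x)" using x by (simp add: field_simps)
  finally show ?thesis using assms x by (simp add: field_simps)
qed

text \<open>\<open>R\<close> and \<open>S\<close> are chosen so that \<open>R * S\<close> is about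
  \<open>n = K * L\<close> and the two archimedean terms balance. Taking \<open>K\<close> about
  \<open>25 / 4 * G * L\<close> with \<open>G = g * tau\<close> makes their common scale
  \<open>q\<close> at most \<open>n / (5 / 2 * L)\<close>, whence the denominator 30 = 12 * 5/2.
  Division of the determinant inequality by \<open>n * K * ell / 2\<close> leaves
  \<open>crit\<close>, whose three terms stem from the binomial coefficients, the spreads and
  \<open>n!\<close>. The lower bound on \<open>N\<close> guarantees \<open>R \<le> N\<close> and the
  size of \<open>x2\<close>.\<close>

lemma interpolation_criterion:
  fixes a b c N k L n0 y1 x1 x2 :: nat
  assumes a: "a > 1" "coprime a b" "coprime a c" and b: "b > 1" and c: "c > 0"
    and dvd: "int a ^ k dvd int b ^ n0 - 1" and n0: "n0 > 0" and k: "k > 0"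
    and e1: "b ^ y1 + c = a ^ x1"
    and e2: "b ^ (y1 + n0 * N) + c = a ^ x2"
    and kx: "k \<le> x1" and L: "L \<ge> 2"
    and ell: "ell = real k * ln a" and tau: "tau = real x1 / real k"
    and N: "25 / 4 * tau * real L ^ 2 + real L \<le> real N"
    and crit: "(2 + ln (2 / 5 * real N / tau + 1)) / ell
       + real L * ((2 + 2 / 5 / tau + 14 / 25 / real L) * (2 + 2 / 5 / tau + 2 / 5 / real L)) / 15
       + ln (25 / 4 * real L ^ 2) / (25 / 8 * real L * ell) < real L - 1"
  shows False
proof -
  have ell0: "ell > 0" using a k by (simp add: ell)
  have tau1: "tau \<ge> 1" using k kx by (simp add: tau)
  \<comment> \<open>\<open>crit\<close> must not involve \<open>b\<close>, so every estimate has to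
    be uniform in \<open>g\<close>, which is only known to be at least 1.\<close>
  define g where "g = real n0 * ln b / ell"
  have g1: "g \<ge> 1"
  proof -
    have "int b ^ n0 - 1 > 0" using b n0 by (simp add: one_less_power)
    then have "int a ^ k \<le> int b ^ n0 - 1" using dvd by (intro zdvd_imp_le)
    then have "int (a ^ k) \<le> int (b ^ n0)" by simp
    then have "a ^ k \<le> b ^ n0" by (simp only: of_nat_le_iff)
    then have "real a ^ k \<le> real b ^ n0" by (metis of_nat_le_iff of_nat_power)
    then have "ln (real a ^ k) \<le> ln (real b ^ n0)" using a b by (intro ln_mono) auto
    then have "ell \<le> real n0 * ln b" using a b by (simp add: ell ln_realpow)
    then show ?thesis using ell0 by (simp add: g_def)
  qed
  have gell: "real n0 * ln b = g * ell" using ell0 by (simp add: g_def)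
  have tell: "real x1 * ln a = tau * ell" using k by (simp add: tau ell)
  define G where "G = g * tau"
  have G1: "G \<ge> 1" using g1 tau1 using mult_mono[of 1 g 1 tau] g1 tau1 by (simp add: G_def)
  have L2: "real L \<ge> 2" using L by simp
  define K where "K = nat \<lceil>25 / 4 * G * real L\<rceil>"
  have Kb: "25 / 4 * G * real L \<le> real K" "real K \<le> 25 / 4 * G * real L + 1"
  proof -
    have "0 \<le> 25 / 4 * G * real L" using G1 by simp
    then have "real K = of_int \<lceil>25 / 4 * G * real L\<rceil>" by (simp add: K_def)
    then show "25 / 4 * G * real L \<le> real K" "real K \<le> 25 / 4 * G * real L + 1" by linarith+
  qed
  have GL: "real L \<le> G * real L" using G1 L2 by simp
  have K12: "real K \<ge> 25 / 4 * real L" using Kb(1) GL by simp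
  have K0: "K > 0" using K12 L2 by (intro Nat.gr0I) simp
  define n where "n = real (K * L)"
  have n: "n = real K * real L" by (simp add: n_def)
  have n0': "n > 0" using K0 L by (simp add: n_def)
  have nG: "n \<ge> 25 / 4 * G * real L ^ 2"
    using mult_right_mono[OF Kb(1), of "real L"] by (simp add: n power2_eq_square)
  \<comment> \<open>\<alpha> and \<beta> solve \<open>\<alpha> * \<beta> = n\<close> and
    \<open>\<alpha> * g = \<beta> * tau\<close>; the common value of the latter is
    \<open>q\<close>.\<close>
  define \<alpha> where "\<alpha> = sqrt (n * tau / g)"
  define \<beta> where "\<beta> = sqrt (n * g / tau)"
  define q where "q = sqrt (n * G)"
  have pos: "\<alpha> > 0" "\<beta> > 0" "q > 0" using n0' g1 tau1 G1 by (simp_all add: \<alpha>_def \<beta>_def q_def)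
  have \<alpha>g: "\<alpha> * g = q"
  proof -
    have "n * G = n * tau / g * g ^ 2" using g1 by (simp add: G_def power2_eq_square)
    then have "q = sqrt (n * tau / g) * sqrt (g ^ 2)" unfolding q_def real_sqrt_mult[symmetric] by simp
    then show ?thesis using g1 by (simp add: \<alpha>_def)
  qed
  have \<beta>t: "\<beta> * tau = q"
  proof -
    have "n * G = n * g / tau * tau ^ 2" using tau1 by (simp add: G_def power2_eq_square)
    then have "q = sqrt (n * g / tau) * sqrt (tau ^ 2)" unfolding q_def real_sqrt_mult[symmetric] by simp
    then show ?thesis using tau1 by (simp add: \<beta>_def)
  qed
  have \<alpha>\<beta>: "\<alpha> * \<beta> = n" using n0' g1 tau1 by (simp add: \<alpha>_def \<beta>_def flip: real_sqrt_mult)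
  have q2: "q ^ 2 = n * G" using n0' G1 by (simp add: q_def)
  have qn: "5 / 2 * real L * q \<le> n"
  proof (rule power2_le_imp_le)
    have "(5 / 2 * real L * q) ^ 2 = 25 / 4 * real L ^ 2 * q ^ 2" by (simp add: power2_eq_square)
    also have "\<dots> = 25 / 4 * G * real L ^ 2 * n" unfolding q2 by simp
    also have "\<dots> \<le> n * n" using nG n0' by (intro mult_right_mono) auto
    finally show "(5 / 2 * real L * q) ^ 2 \<le> n ^ 2" by (simp add: power2_eq_square)
  qed (use n0' in simp)
  have qG: "5 / 2 * real L * G \<le> q"
  proof (rule power2_le_imp_le)
    have "(5 / 2 * real L * G) ^ 2 = 25 / 4 * G * real L ^ 2 * G" by (simp add: power2_eq_square)
    also have "\<dots> \<le> n * G" using nG G1 by (intro mult_right_mono) auto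
    finally show "(5 / 2 * real L * G) ^ 2 \<le> q ^ 2" using q2 by simp
  qed (use pos in simp)
  have Lg: "real L * g \<le> 2 / 5 / tau * q"
    using qG tau1 by (simp add: G_def field_simps)
  have tq: "tau \<le> 2 / 5 / real L * q"
  proof -
    have "tau \<le> G" using g1 tau1 by (simp add: G_def)
    then have "5 / 2 * real L * tau \<le> 5 / 2 * real L * G" by (intro mult_left_mono) auto
    then have "5 / 2 * real L * tau \<le> q" using qG by linarith
    then show ?thesis using L2 by (simp add: field_simps)
  qed
  have L\<beta>: "real L * \<beta> \<le> 2 / 5 / tau * n"
  proof -
    have "5 / 2 * real L * (\<beta> * tau) \<le> n" using qn \<beta>t by simp
    then show ?thesis using tau1 by (simp add: field_simps)
  qed
  have \<alpha>n: "\<alpha> \<le> 2 / 5 / real L * n"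
  proof -
    have "\<alpha> * 1 \<le> \<alpha> * g" using g1 pos by (intro mult_left_mono) auto
    then have "5 / 2 * real L * \<alpha> \<le> 5 / 2 * real L * q" using \<alpha>g by (intro mult_left_mono) auto
    then have "5 / 2 * real L * \<alpha> \<le> n" using qn by linarith
    then show ?thesis using L2 by (simp add: field_simps)
  qed
  have Ln: "real L \<le> 4 / 25 / real L * n"
  proof -
    have "25 / 4 * real L ^ 2 * 1 \<le> 25 / 4 * real L ^ 2 * G" using G1 by (intro mult_left_mono) auto
    then have "25 / 4 * real L ^ 2 \<le> n" using nG by (simp add: mult_ac)
    then show ?thesis using L2 by (simp add: field_simps power2_eq_square)
  qed
  define R where "R = nat \<lceil>\<alpha>\<rceil>"
  define S where "S = nat \<lceil>\<beta>\<rceil>"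
  have Rb: "\<alpha> \<le> real R" "real R \<le> \<alpha> + 1" and Sb: "\<beta> \<le> real S" "real S \<le> \<beta> + 1"
    unfolding R_def S_def using pos by linarith+
  have RS: "(K - 1) * L < R * S"
  proof -
    have "real (K * L) \<le> real (R * S)"
      using \<alpha>\<beta> mult_mono[OF Rb(1) Sb(1)] pos by (simp add: n_def)
    then have "K * L \<le> R * S" by (simp only: of_nat_le_iff)
    moreover have "(K - 1) * L < K * L" using K0 L by simp
    ultimately show ?thesis by (rule less_le_trans[rotated])
  qed
  have nle: "n \<le> 25 / 4 * G * real L ^ 2 + real L"
    using mult_right_mono[OF Kb(2), of "real L"] by (simp add: n power2_eq_square algebra_simps)
  have RN: "R \<le> N"
  proof -
    have "\<alpha> \<le> 3 * tau * real L"
    proof (rule power2_le_imp_le)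
      have "\<alpha> ^ 2 = n * tau / g" using n0' g1 tau1 by (simp add: \<alpha>_def)
      also have "\<dots> \<le> (25 / 4 * G * real L ^ 2 + real L) * tau / g"
        using nle g1 tau1 by (intro divide_right_mono mult_right_mono) auto
      also have "\<dots> = 25 / 4 * tau ^ 2 * real L ^ 2 + real L * tau / g"
        using g1 by (simp add: G_def field_simps power2_eq_square)
      also have "real L * tau / g \<le> real L * tau" using g1 tau1 L2 by (simp add: field_simps)
      also have "real L * tau \<le> (real L * tau) ^ 2"
        using mult_mono[of 1 "real L" 1 tau] L2 tau1 by (intro self_le_power) auto
      finally have "\<alpha> ^ 2 \<le> 29 / 4 * (tau * real L) ^ 2" by (simp add: power_mult_distrib)
      also have "\<dots> \<le> 9 * (tau * real L) ^ 2" by (intro mult_right_mono) auto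
      finally show "\<alpha> ^ 2 \<le> (3 * tau * real L) ^ 2" by (simp add: power_mult_distrib)
    qed (use tau1 in simp)
    moreover have "3 * tau * real L \<le> 3 * tau * real L ^ 2"
      using tau1 L2 by (intro mult_left_mono self_le_power) auto
    moreover have "0 \<le> tau * real L ^ 2" using tau1 by simp
    ultimately have "real R \<le> real N" using Rb N L2 by linarith
    then show ?thesis by simp
  qed
  have x2: "k * (K * L - 1) \<le> x2"
  proof -
    have "b ^ (n0 * N) \<le> b ^ (y1 + n0 * N)" using b by (intro power_increasing) auto
    then have "b ^ (n0 * N) \<le> a ^ x2" using e2 by linarith
    then have "real b ^ (n0 * N) \<le> real a ^ x2" by (metis of_nat_le_iff of_nat_power)
    then have "ln (real b ^ (n0 * N)) \<le> ln (real a ^ x2)" using a b by (intro ln_mono) auto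
    then have "real N * (real n0 * ln b) \<le> real x2 * ln a" using a b by (simp add: ln_realpow mult_ac)
    then have "real N * g * real k * ln a \<le> real x2 * ln a" unfolding gell by (simp add: ell mult_ac)
    then have 1: "real N * g * real k \<le> real x2" using a by simp
    have "real (K * L) \<le> real N * g"
    proof -
      have "real (K * L) \<le> g * (25 / 4 * tau * real L ^ 2) + real L * 1" using nle by (simp add: n_def G_def mult_ac)
      also have "\<dots> \<le> g * (25 / 4 * tau * real L ^ 2) + real L * g" using g1 by (intro add_left_mono mult_left_mono) auto
      also have "\<dots> = g * (25 / 4 * tau * real L ^ 2 + real L)" by (simp add: algebra_simps)
      also have "\<dots> \<le> g * real N" using N g1 by (intro mult_left_mono) auto
      finally show ?thesis by (simp add: mult.commute)
    qed
    then have "real (K * L) * real k \<le> real N * g * real k" by (intro mult_right_mono) auto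
    then have "real (k * (K * L)) \<le> real x2" using 1 by (simp add: mult_ac)
    then have "k * (K * L) \<le> x2" by (simp only: of_nat_le_iff)
    moreover have "k * (K * L - 1) \<le> k * (K * L)" by simp
    ultimately show ?thesis by linarith
  qed
  define Y where "Y = 2 / 5 * real N / tau + 1"
  have Y1: "Y \<ge> 1" using tau1 by (simp add: Y_def)
  define X where "X = real K * Y"
  have X0: "X > 0" using K0 Y1 by (simp add: X_def)
  have X: "real (R + L - 2 + N * (S - 1)) \<le> X"
  proof -
    have S1: "real (S - 1) \<le> \<beta>" using Sb pos by (cases S) auto
    have "real (R + L - 2) \<le> \<alpha> + real L" using Rb pos L by (simp add: of_nat_diff)
    moreover have "real (N * (S - 1)) \<le> real N * \<beta>" using S1 by (simp add: mult_left_mono)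
    moreover have "\<alpha> \<le> 2 / 5 * real K" using \<alpha>n L2 by (simp add: n field_simps)
    moreover have "real L \<le> 4 / 25 * real K" using K12 by simp
    moreover have "real N * \<beta> \<le> real N * (2 / 5 / tau * real K)"
    proof -
      have "real L * \<beta> \<le> real L * (2 / 5 / tau * real K)" using L\<beta> by (simp add: n mult_ac)
      then have "\<beta> \<le> 2 / 5 / tau * real K" using L by (subst (asm) mult_le_cancel_left_pos) auto
      then show ?thesis by (intro mult_left_mono) auto
    qed
    moreover have "X = real N * (2 / 5 / tau * real K) + real K" by (simp add: X_def Y_def algebra_simps)
    ultimately show ?thesis using K0 by simp
  qed
  define T where "T = real (R + L - 1)"
  have T: "T \<le> \<alpha> + real L" "T \<ge> 0" using Rb L by (auto simp: T_def of_nat_diff)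
  \<comment> \<open>Relative errors: 2/5/L from rounding \<open>S\<close> up, 2/5/tau from the
    additional grid columns, and 4/25/L from both at once; 14/25 is 2/5 + 4/25.\<close>
  define P1 where "P1 = 2 + 2 / 5 / tau + 14 / 25 / real L"
  define P2 where "P2 = 2 + 2 / 5 / tau + 2 / 5 / real L"
  have P0: "P1 \<ge> 0" "P2 \<ge> 0" using tau1 L2 by (simp_all add: P1_def P2_def)
  have TS: "n + T * real S \<le> n * P1"
  proof -
    have "T * real S \<le> (\<alpha> + real L) * (\<beta> + 1)" using T Sb pos by (intro mult_mono) auto
    also have "\<dots> = n + \<alpha> + real L * \<beta> + real L" using \<alpha>\<beta> by (simp add: algebra_simps)
    also have "\<dots> \<le> n + 2 / 5 / real L * n + 2 / 5 / tau * n + 4 / 25 / real L * n"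
      using \<alpha>n L\<beta> Ln by simp
    finally show ?thesis by (simp add: P1_def algebra_simps)
  qed
  have Tg: "T * g + real S * tau \<le> q * P2"
  proof -
    have "T * g + real S * tau \<le> (\<alpha> + real L) * g + (\<beta> + 1) * tau"
      using T Sb g1 tau1 by (intro add_mono mult_right_mono) auto
    also have "\<dots> = 2 * q + real L * g + tau" using \<alpha>g \<beta>t by (simp add: algebra_simps)
    also have "\<dots> \<le> 2 * q + 2 / 5 / tau * q + 2 / 5 / real L * q" using Lg tq by simp
    finally show ?thesis by (simp add: P2_def algebra_simps)
  qed
  have main: "real k * (n * (n - real K) / 2) * ln a \<le>
     n * ln n + n * (real K + (real K - 1) / 2 * ln (X / real K))
     + real L * T * (n + T * real S) / 12 * real n0 * ln b
     + real L * real S * (n + real S * T) / 12 * real x1 * ln a"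
    unfolding n_def T_def
    by (rule interpolation_inequality[OF a b c dvd n0 e1 e2 K0 _ RN RS x2 X0 X]) (use L in simp)
  have XK: "X / real K = Y" using K0 by (simp add: X_def)
  have r1: "real L * T * (n + T * real S) / 12 * real n0 * ln b + real L * real S * (n + real S * T) / 12 * real x1 * ln a
     \<le> ell * n ^ 2 * (P1 * P2) / 30"
  proof -
    have "real L * T * (n + T * real S) / 12 * real n0 * ln b + real L * real S * (n + real S * T) / 12 * real x1 * ln a
      = real L / 12 * (n + T * real S) * T * (real n0 * ln b) + real L / 12 * (n + T * real S) * real S * (real x1 * ln a)"
      by (simp add: mult_ac)
    also have "\<dots> = ell * (real L / 12) * ((n + T * real S) * (T * g + real S * tau))"
      unfolding gell tell by (simp add: algebra_simps add_divide_distrib)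
    also have "\<dots> \<le> ell * (real L / 12) * ((n * P1) * (q * P2))"
      using TS Tg ell0 n0' T P0 pos g1 tau1 by (intro mult_left_mono mult_mono) auto
    also have "\<dots> = ell * n * (P1 * P2) / 30 * (5 / 2 * real L * q)" by (simp add: mult_ac)
    also have "\<dots> \<le> ell * n * (P1 * P2) / 30 * n" using qn ell0 n0' P0 by (intro mult_left_mono) auto
    finally show ?thesis by (simp add: power2_eq_square mult_ac)
  qed
  have r2: "n * (real K + (real K - 1) / 2 * ln (X / real K)) \<le> n * real K * (2 + ln Y) / 2"
  proof -
    have "(real K - 1) / 2 * ln Y \<le> real K / 2 * ln Y" using Y1 by (intro mult_right_mono) auto
    then have "n * (real K + (real K - 1) / 2 * ln Y) \<le> n * (real K + real K / 2 * ln Y)"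
      using n0' by (intro mult_left_mono add_left_mono) auto
    then show ?thesis unfolding XK by (simp add: algebra_simps)
  qed
  have r3: "n * ln n \<le> n * real K * (ln (25 / 4 * real L ^ 2) / (25 / 8 * real L)) / 2"
  proof -
    have "25 / 4 * real L ^ 2 * 1 \<le> 25 / 4 * real L ^ 2 * G" using G1 by (intro mult_left_mono) auto
    then have le: "25 / 4 * real L ^ 2 \<le> n" using nG by (simp add: mult_ac)
    have "exp 1 \<le> 25 / 4 * real L ^ 2"
      using exp_le mult_mono[of 2 "real L" 2 "real L"] L2 by (simp add: power2_eq_square)
    then have "ln n / n \<le> ln (25 / 4 * real L ^ 2) / (25 / 4 * real L ^ 2)" using le by (rule ln_div_self_antimono)
    then have "ln n \<le> n * (ln (25 / 4 * real L ^ 2) / (25 / 4 * real L ^ 2))" using n0' by (simp add: field_simps)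
    also have "\<dots> = real K * (ln (25 / 4 * real L ^ 2) / (25 / 8 * real L)) / 2"
      using L2 by (simp add: n field_simps power2_eq_square)
    finally have "n * ln n \<le> n * (real K * (ln (25 / 4 * real L ^ 2) / (25 / 8 * real L)) / 2)"
      using n0' by (intro mult_left_mono) auto
    then show ?thesis by (simp only: mult.assoc times_divide_eq_right)
  qed
  have "real k * (n * (n - real K) / 2) * ln a = n * real K / 2 * (ell * (real L - 1))"
  proof -
    have nK: "n - real K = real K * (real L - 1)" by (simp add: n algebra_simps)
    show ?thesis unfolding nK by (simp add: ell)
  qed
  then have "n * real K / 2 * (ell * (real L - 1)) \<le> n * real K * (ln (25 / 4 * real L ^ 2) / (25 / 8 * real L)) / 2
      + n * real K * (2 + ln Y) / 2 + ell * n ^ 2 * (P1 * P2) / 30"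
    using main r1 r2 r3 by linarith
  also have "\<dots> = n * real K / 2 * (ln (25 / 4 * real L ^ 2) / (25 / 8 * real L) + (2 + ln Y) + ell * (real L * (P1 * P2) / 15))"
    by (simp add: n algebra_simps power2_eq_square)
  finally have "ell * (real L - 1) \<le> ln (25 / 4 * real L ^ 2) / (25 / 8 * real L) + (2 + ln Y) + ell * (real L * (P1 * P2) / 15)"
    using n0' K0 by simp
  moreover have "ell * (real L - 1) > ln (25 / 4 * real L ^ 2) / (25 / 8 * real L) + (2 + ln Y) + ell * (real L * (P1 * P2) / 15)"
  proof -
    have "ell * ((2 + ln Y) / ell) = 2 + ln Y"
      and "ell * (ln (25 / 4 * real L ^ 2) / (25 / 8 * real L * ell)) = ln (25 / 4 * real L ^ 2) / (25 / 8 * real L)"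
      using ell0 by simp_all
    then have "ell * ((2 + ln Y) / ell + real L * (P1 * P2) / 15 + ln (25 / 4 * real L ^ 2) / (25 / 8 * real L * ell))
       = 2 + ln Y + ell * (real L * (P1 * P2) / 15) + ln (25 / 4 * real L ^ 2) / (25 / 8 * real L)"
      unfolding distrib_left by presburger
    then show ?thesis
      using mult_strict_left_mono[OF crit ell0] unfolding Y_def[symmetric] P1_def[symmetric] P2_def[symmetric] by linarith
  qed
  ultimately show False by simp
qed

section \<open>Rational bounds for exponentials and logarithms\<close>

text \<open>Doubling steps for numerical bounds: a quadratic or linear bound at a small argument is
  squared repeatedly, with outward rounding to short fractions each time.\<close>

lemma exp_upper_double: "exp x \<le> r \<Longrightarrow> r * r \<le> r' \<Longrightarrow> y = 2 * x \<Longrightarrow> exp (y::real) \<le> r'"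
  using mult_mono[of "exp x" r "exp x" r] by (simp add: exp_double power2_eq_square)

lemma exp_lower_double: "r \<le> exp x \<Longrightarrow> r' \<le> r * r \<Longrightarrow> 0 \<le> r \<Longrightarrow> y = 2 * x \<Longrightarrow> r' \<le> exp (y::real)"
  using mult_mono[of r "exp x" r "exp x"] by (simp add: exp_double power2_eq_square)

lemma exp_193: "exp (193 / 100 :: real) \<le> 6940159 / 1000000"
proof -
  have "exp (193 / 25600 :: real) \<le> 251899 / 250000"
    by (rule order_trans[OF exp_bound]) (simp_all add: power2_eq_square)
  then have "exp (193 / 12800 :: real) \<le> 4061 / 4000" by (rule exp_upper_double) simp_all
  then have "exp (193 / 6400 :: real) \<le> 1030733 / 1000000" by (rule exp_upper_double) simp_all
  then have "exp (193 / 3200 :: real) \<le> 1062411 / 1000000" by (rule exp_upper_double) simp_all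
  then have "exp (193 / 1600 :: real) \<le> 564359 / 500000" by (rule exp_upper_double) simp_all
  then have "exp (193 / 800 :: real) \<le> 254801 / 200000" by (rule exp_upper_double) simp_all
  then have "exp (193 / 400 :: real) \<le> 1623089 / 1000000" by (rule exp_upper_double) simp_all
  then have "exp (193 / 200 :: real) \<le> 1317209 / 500000" by (rule exp_upper_double) simp_all
  then show ?thesis by (rule exp_upper_double) simp_all
qed

lemma exp_254: "exp (127 / 50 :: real) \<le> 2568369 / 200000"
proof -
  have "exp (127 / 12800 :: real) \<le> 1010021 / 1000000"
    by (rule order_trans[OF exp_bound]) (simp_all add: power2_eq_square)
  then have "exp (127 / 6400 :: real) \<le> 1020143 / 1000000" by (rule exp_upper_double) simp_all
  then have "exp (127 / 3200 :: real) \<le> 260173 / 250000" by (rule exp_upper_double) simp_all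
  then have "exp (127 / 1600 :: real) \<le> 6769 / 6250" by (rule exp_upper_double) simp_all
  then have "exp (127 / 800 :: real) \<le> 73311 / 62500" by (rule exp_upper_double) simp_all
  then have "exp (127 / 400 :: real) \<le> 1375873 / 1000000" by (rule exp_upper_double) simp_all
  then have "exp (127 / 200 :: real) \<le> 1893027 / 1000000" by (rule exp_upper_double) simp_all
  then have "exp (127 / 100 :: real) \<le> 55993 / 15625" by (rule exp_upper_double) simp_all
  then show ?thesis by (rule exp_upper_double) simp_all
qed

lemma exp_085: "exp (17 / 20 :: real) \<le> 1194689 / 500000"
proof -
  have "exp (17 / 320 :: real) \<le> 263987 / 250000"
    by (rule order_trans[OF exp_bound]) (simp_all add: power2_eq_square)
  then have "exp (17 / 160 :: real) \<le> 1115027 / 1000000" by (rule exp_upper_double) simp_all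
  then have "exp (17 / 80 :: real) \<le> 621643 / 500000" by (rule exp_upper_double) simp_all
  then have "exp (17 / 40 :: real) \<le> 1545761 / 1000000" by (rule exp_upper_double) simp_all
  then show ?thesis by (rule exp_upper_double) simp_all
qed

lemma exp_880: "1595026391 / 250000 \<le> exp (44 / 5 :: real)"
proof -
  have "1008593 / 1000000 \<le> exp (11 / 1280 :: real)"
    by (rule order_trans[OF _ exp_ge_add_one_self]) simp
  then have "1017259 / 1000000 \<le> exp (11 / 640 :: real)" by (rule exp_lower_double) simp_all
  then have "206963 / 200000 \<le> exp (11 / 320 :: real)" by (rule exp_lower_double) simp_all
  then have "535421 / 500000 \<le> exp (11 / 160 :: real)" by (rule exp_lower_double) simp_all
  then have "573351 / 500000 \<le> exp (11 / 80 :: real)" by (rule exp_lower_double) simp_all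
  then have "52597 / 40000 \<le> exp (11 / 40 :: real)" by (rule exp_lower_double) simp_all
  then have "1729027 / 1000000 \<le> exp (11 / 20 :: real)" by (rule exp_lower_double) simp_all
  then have "1494767 / 500000 \<le> exp (11 / 10 :: real)" by (rule exp_lower_double) simp_all
  then have "8937313 / 1000000 \<le> exp (11 / 5 :: real)" by (rule exp_lower_double) simp_all
  then have "79875563 / 1000000 \<le> exp (22 / 5 :: real)" by (rule exp_lower_double) simp_all
  then show ?thesis by (rule exp_lower_double) simp_all
qed

lemma exp_775: "2252940939 / 1000000 \<le> exp (31 / 4 :: real)"
proof -
  have "62973 / 62500 \<le> exp (31 / 4096 :: real)"
    by (rule order_trans[OF _ exp_ge_add_one_self]) simp
  then have "1015193 / 1000000 \<le> exp (31 / 2048 :: real)" by (rule exp_lower_double) simp_all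
  then have "128827 / 125000 \<le> exp (31 / 1024 :: real)" by (rule exp_lower_double) simp_all
  then have "1062169 / 1000000 \<le> exp (31 / 512 :: real)" by (rule exp_lower_double) simp_all
  then have "564101 / 500000 \<le> exp (31 / 256 :: real)" by (rule exp_lower_double) simp_all
  then have "1272839 / 1000000 \<le> exp (31 / 128 :: real)" by (rule exp_lower_double) simp_all
  then have "1620119 / 1000000 \<le> exp (31 / 64 :: real)" by (rule exp_lower_double) simp_all
  then have "524957 / 200000 \<le> exp (31 / 32 :: real)" by (rule exp_lower_double) simp_all
  then have "861187 / 125000 \<le> exp (31 / 16 :: real)" by (rule exp_lower_double) simp_all
  then have "9493031 / 200000 \<le> exp (31 / 8 :: real)" by (rule exp_lower_double) simp_all
  then show ?thesis by (rule exp_lower_double) simp_all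
qed

lemma exp_667: "385333673 / 500000 \<le> exp (667 / 100 :: real)"
proof -
  have "1006513 / 1000000 \<le> exp (667 / 102400 :: real)"
    by (rule order_trans[OF _ exp_ge_add_one_self]) simp
  then have "253267 / 250000 \<le> exp (667 / 51200 :: real)" by (rule exp_lower_double) simp_all
  then have "513153 / 500000 \<le> exp (667 / 25600 :: real)" by (rule exp_lower_double) simp_all
  then have "131663 / 125000 \<le> exp (667 / 12800 :: real)" by (rule exp_lower_double) simp_all
  then have "1109449 / 1000000 \<le> exp (667 / 6400 :: real)" by (rule exp_lower_double) simp_all
  then have "1230877 / 1000000 \<le> exp (667 / 3200 :: real)" by (rule exp_lower_double) simp_all
  then have "757529 / 500000 \<le> exp (667 / 1600 :: real)" by (rule exp_lower_double) simp_all
  then have "11477 / 5000 \<le> exp (667 / 800 :: real)" by (rule exp_lower_double) simp_all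
  then have "5268861 / 1000000 \<le> exp (667 / 400 :: real)" by (rule exp_lower_double) simp_all
  then have "433764 / 15625 \<le> exp (667 / 200 :: real)" by (rule exp_lower_double) simp_all
  then show ?thesis by (rule exp_lower_double) simp_all
qed

lemma exp_533: "2035179 / 10000 \<le> exp (533 / 100 :: real)"
proof -
  have "201041 / 200000 \<le> exp (533 / 102400 :: real)"
    by (rule order_trans[OF _ exp_ge_add_one_self]) simp
  then have "1010437 / 1000000 \<le> exp (533 / 51200 :: real)" by (rule exp_lower_double) simp_all
  then have "510491 / 500000 \<le> exp (533 / 25600 :: real)" by (rule exp_lower_double) simp_all
  then have "260601 / 250000 \<le> exp (533 / 12800 :: real)" by (rule exp_lower_double) simp_all
  then have "543303 / 500000 \<le> exp (533 / 6400 :: real)" by (rule exp_lower_double) simp_all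
  then have "147589 / 125000 \<le> exp (533 / 3200 :: real)" by (rule exp_lower_double) simp_all
  then have "8713 / 6250 \<le> exp (533 / 1600 :: real)" by (rule exp_lower_double) simp_all
  then have "1943459 / 1000000 \<le> exp (533 / 800 :: real)" by (rule exp_lower_double) simp_all
  then have "472129 / 125000 \<le> exp (533 / 400 :: real)" by (rule exp_lower_double) simp_all
  then have "1426597 / 100000 \<le> exp (533 / 200 :: real)" by (rule exp_lower_double) simp_all
  then show ?thesis by (rule exp_lower_double) simp_all
qed

lemma ln_7_ge: "193 / 100 \<le> ln (7::real)"
  using exp_193 by (subst ln_ge_iff) auto

lemma ln_13_ge: "254 / 100 \<le> ln (13::real)"
  using exp_254 by (subst ln_ge_iff) auto

lemma exp_164: "1009923 / 200000 \<le> exp (41 / 25 :: real)"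
proof -
  have "1641 / 1600 \<le> exp (41 / 1600 :: real)"
    by (rule order_trans[OF _ exp_ge_add_one_self]) simp
  then have "525953 / 500000 \<le> exp (41 / 800 :: real)" by (rule exp_lower_double) simp_all
  then have "553253 / 500000 \<le> exp (41 / 400 :: real)" by (rule exp_lower_double) simp_all
  then have "244871 / 200000 \<le> exp (41 / 200 :: real)" by (rule exp_lower_double) simp_all
  then have "299809 / 200000 \<le> exp (41 / 100 :: real)" by (rule exp_lower_double) simp_all
  then have "449427 / 200000 \<le> exp (41 / 50 :: real)" by (rule exp_lower_double) simp_all
  then show ?thesis by (rule exp_lower_double) simp_all
qed

lemma ln_5_le: "ln (5::real) \<le> 41 / 25"
proof -
  have "ln (5::real) \<le> ln (exp (41 / 25))" using exp_164 by (intro ln_mono) auto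
  then show ?thesis by simp
qed

text \<open>The left side is 8/5 times ln x / x at \<open>x = 5 / 2 * L\<close>, which decreases in
  \<open>L\<close>.\<close>

lemma small_term_le:
  assumes "L0 \<ge> 2" "L0 \<le> L"
  shows "ln (25 / 4 * L ^ 2) / (25 / 8 * L) \<le> 8 / 5 * (ln (5 / 2 * L0) / (5 / 2 * L0 :: real))"
proof -
  have e: "ln (25 / 4 * L ^ 2) = 2 * ln (5 / 2 * L)"
  proof -
    have "25 / 4 * L ^ 2 = (5 / 2 * L) ^ 2" by (simp add: power2_eq_square)
    then show ?thesis using assms by (simp only:) (subst ln_realpow, auto)
  qed
  have h: "ln (25 / 4 * L ^ 2) / (25 / 8 * L) = 8 / 5 * (ln (5 / 2 * L) / (5 / 2 * L))"
    unfolding e by simp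
  moreover have "ln (5 / 2 * L) / (5 / 2 * L) \<le> ln (5 / 2 * L0) / (5 / 2 * L0)"
    using assms exp_le by (intro ln_div_self_antimono) auto
  ultimately show ?thesis unfolding h by linarith
qed

section \<open>Explicit bounds for N\<close>

text \<open>From \<open>a ^ j \<le> N\<close> the ratio \<open>x1 / k = 1 + j / k\<close> is at most
  \<open>1 + ln N / ell\<close>. So the parameter \<open>tau\<close> of the criterion is controlled
  by \<open>N\<close> itself.\<close>

locale padic_setup =
  fixes a b c N k j n0 y1 x1 x2 :: nat
  assumes a: "a > 1" "coprime a b" "coprime a c" and b: "b > 1" and c: "c > 0"
    and dvd: "int a ^ k dvd int b ^ n0 - 1" and n0: "n0 > 0" and k: "k > 0"
    and e1: "b ^ y1 + c = a ^ x1"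
    and e2: "b ^ (y1 + n0 * N) + c = a ^ x2"
    and x1: "x1 = k + j" and aj: "a ^ j \<le> N"
begin

definition ell where "ell = real k * ln a"

text \<open>Suppose \<open>N \<ge> N0\<close> and write \<open>s\<close> for the excess of
  \<open>ln N\<close> over \<open>t1\<close>. Then \<open>tau \<le> p0 + p1 * s\<close>, and a
  suitable \<open>L \<le> q0 + q1 * s\<close> satisfies \<open>crit\<close>. The lower bound
  demanded of \<open>N\<close> becomes a cubic in \<open>s\<close>; the four conditions
  \<open>num\<close> compare its coefficients with those of a cubic minorant of
  \<open>N0 * exp s\<close>, so all large \<open>N\<close> are covered by finitely many numerical
  inequalities.\<close>

lemma N_less:
  assumes l0: "l0 > 0" "l0 \<le> ell" and N0: "N0 \<ge> 200" "N0 \<le> exp t1" and t1: "t1 \<ge> 0"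
    and pq: "1 + t1 / l0 \<le> p0" "1 / l0 \<le> p1" "((t1 + 42 / 25) / l0 + 117 / 100) / (77 / 125) + 1 \<le> q0"
      "1 / l0 / (77 / 125) \<le> q1"
    and num: "25 / 4 * p0 * q0^2 + q0 \<le> N0" "25 / 4 * (p1 * q0^2 + 2 * p0 * q0 * q1) + q1 \<le> N0"
      "25 / 4 * (2 * p1 * q0 * q1 + p0 * q1^2) \<le> N0 / 2" "25 / 4 * p1 * q1^2 \<le> N0 / 8"
  shows "real N < N0"
proof (rule ccontr)
  assume "\<not> ?thesis"
  then have NN: "N0 \<le> real N" by simp
  define t where "t = ln (real N)"
  have Npos: "real N > 0" using NN N0 by linarith
  have ell0: "ell > 0" using l0 by linarith
  have t0: "t \<ge> 0" using NN N0 by (simp add: t_def)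
  \<comment> \<open>The cubic is the square of \<open>1 + s / 2 + (s / 2) ^ 2 / 2\<close> without
    its last term, hence below \<open>exp s\<close>. The value 0 replaces a negative excess.\<close>
  obtain s where s: "s \<ge> 0" "t \<le> t1 + s" "N0 * (1 + s + s^2 / 2 + s^3 / 8) \<le> real N"
  proof (cases "t \<le> t1")
    case True then show ?thesis using that[of 0] NN by simp
  next
    case False
    define s where "s = t - t1"
    have s: "s \<ge> 0" using False by (simp add: s_def)
    have "1 + s / 2 + (s / 2)^2 / 2 \<le> exp (s / 2)" using s by (intro exp_lower_Taylor_quadratic) simp
    then have "(1 + s / 2 + (s / 2)^2 / 2)^2 \<le> exp (s / 2) ^ 2" using s by (intro power_mono) auto
    also have "exp (s / 2) ^ 2 = exp s" by (simp flip: exp_double)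
    finally have "1 + s + s^2 / 2 + s^3 / 8 + s^4 / 64 \<le> exp s"
      by (simp add: power2_eq_square power3_eq_cube power4_eq_xxxx algebra_simps)
    moreover have "0 \<le> s^4 / 64" by simp
    ultimately have "1 + s + s^2 / 2 + s^3 / 8 \<le> exp s" by linarith
    then have "N0 * (1 + s + s^2 / 2 + s^3 / 8) \<le> exp t1 * exp s"
      using N0 s by (intro mult_mono) auto
    also have "\<dots> = real N" using Npos by (simp add: s_def t_def flip: exp_add)
    finally show ?thesis using that[of s] s by (simp add: s_def)
  qed
  have pq0: "p0 \<ge> 0" "p1 \<ge> 0" "q0 \<ge> 0" "q1 \<ge> 0"
    using pq l0 t1 by (auto intro: order_trans[rotated])
  \<comment> \<open>\<open>v\<close> solves a linearised criterion: 77/125 = 1 - 48/125 is the slope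
    left by the spread term, 117/100 exceeds 1 + 1611/10000, and 42/25 exceeds 115/100 +
    525/1000.\<close>
  define v where "v = ((t + 42 / 25) / ell + 117 / 100) / (77 / 125)"
  define L where "L = nat \<lfloor>v\<rfloor> + 1"
  have v0: "v \<ge> 117 / 100 / (77 / 125)" unfolding v_def using t0 ell0 by (intro divide_right_mono) auto
  then have L2: "L \<ge> 2" by (simp add: L_def le_nat_iff le_floor_iff)
  have "real L = of_int \<lfloor>v\<rfloor> + 1" using v0 by (simp add: L_def)
  then have Lv: "v < real L" "real L \<le> v + 1" by linarith+
  have tl: "t / ell \<le> t / l0" using l0 t0 ell0 by (intro divide_left_mono) auto
  have "v \<le> ((t1 + s + 42 / 25) / l0 + 117 / 100) / (77 / 125)"
  proof -
    have "(t + 42 / 25) / ell \<le> (t1 + s + 42 / 25) / l0" using l0 s t0 ell0 by (intro frac_le) auto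
    then show ?thesis unfolding v_def by (intro divide_right_mono) auto
  qed
  also have "\<dots> = ((t1 + 42 / 25) / l0 + 117 / 100) / (77 / 125) + s * (1 / l0 / (77 / 125))"
    by (simp add: add_divide_distrib)
  also have "\<dots> \<le> (q0 - 1) + s * q1"
  proof (rule add_mono)
    show "((t1 + 42 / 25) / l0 + 117 / 100) / (77 / 125) \<le> q0 - 1" using pq(3) by linarith
    show "s * (1 / l0 / (77 / 125)) \<le> s * q1" by (rule mult_left_mono[OF pq(4) s(1)])
  qed
  finally have Lq: "real L \<le> q0 + q1 * s" using Lv by (simp add: mult.commute)
  define tau where "tau = real x1 / real k"
  have tau1: "tau \<ge> 1" using k by (simp add: tau_def x1)
  have "tau \<le> 1 + t / ell"
  proof -
    have "real a ^ j \<le> real N" using aj by (metis of_nat_le_iff of_nat_power)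
    then have "ln (real a ^ j) \<le> t" using a Npos unfolding t_def by (intro ln_mono) auto
    then have "real j * ln a \<le> t" using a by (simp add: ln_realpow)
    moreover have "real j / real k = real j * ln a / ell" using a by (simp add: ell_def)
    ultimately have "real j / real k \<le> t / ell" using ell0 by (simp add: divide_right_mono)
    then show ?thesis using k by (simp add: tau_def x1 add_divide_distrib)
  qed
  also have "\<dots> \<le> 1 + (t1 + s) / l0"
  proof -
    have "t / l0 \<le> (t1 + s) / l0" using s l0 by (intro divide_right_mono) auto
    then show ?thesis using tl by linarith
  qed
  also have "\<dots> = (1 + t1 / l0) + s * (1 / l0)" by (simp add: add_divide_distrib)
  also have "\<dots> \<le> p0 + s * p1" by (intro add_mono mult_left_mono pq s)
  finally have tp: "tau \<le> p0 + p1 * s" by (simp add: mult.commute)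
  have "25 / 4 * tau * real L ^ 2 + real L \<le> 25 / 4 * (p0 + p1 * s) * (q0 + q1 * s) ^ 2 + (q0 + q1 * s)"
    using tp Lq tau1 pq0 s by (intro add_mono mult_mono power_mono) auto
  also have "\<dots> = (25 / 4 * p0 * q0^2 + q0) + (25 / 4 * (p1 * q0^2 + 2 * p0 * q0 * q1) + q1) * s
      + 25 / 4 * (2 * p1 * q0 * q1 + p0 * q1^2) * s^2 + 25 / 4 * p1 * q1^2 * s^3"
    by (simp add: algebra_simps power2_eq_square power3_eq_cube)
  also have "\<dots> \<le> N0 + N0 * s + N0 / 2 * s^2 + N0 / 8 * s^3"
    using num s by (intro add_mono mult_right_mono) auto
  also have "\<dots> = N0 * (1 + s + s^2 / 2 + s^3 / 8)" by (simp add: algebra_simps)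
  also have "\<dots> \<le> real N" by (rule s)
  finally have NL: "25 / 4 * tau * real L ^ 2 + real L \<le> real N" .
  have Lam: "ln (2 / 5 * real N / tau + 1) \<le> t - 85 / 100"
  proof -
    have "2 / 5 * real N / tau + 1 \<le> 2 / 5 * real N + 1" using tau1 Npos by (simp add: field_simps)
    also have "\<dots> \<le> 81 / 200 * real N" using NN N0 by simp
    finally have "2 / 5 * real N / tau + 1 \<le> 81 / 200 * real N" .
    then have "ln (2 / 5 * real N / tau + 1) \<le> ln (81 / 200 * real N)" using tau1 Npos by (intro ln_mono) (auto intro: add_nonneg_pos)
    also have "\<dots> = ln (81 / 200) + t" unfolding t_def using Npos by (intro ln_mult_pos) auto
    also have "ln (81 / 200 :: real) \<le> - (85 / 100)"
    proof -
      have "exp (17 / 20 :: real) \<le> 200 / 81" using exp_085 by simp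
      then have "17 / 20 \<le> ln (200 / 81 :: real)" by (subst ln_ge_iff) auto
      moreover have "ln (200 / 81 :: real) = - ln (81 / 200)" using ln_inverse[of "81 / 200 :: real"] by simp
      ultimately show ?thesis by simp
    qed
    finally show ?thesis by simp
  qed
  have r1: "(2 + ln (2 / 5 * real N / tau + 1)) / ell \<le> (t + 115 / 100) / ell"
    using Lam ell0 by (intro divide_right_mono) auto
  have r2: "ln (25 / 4 * real L ^ 2) / (25 / 8 * real L * ell) \<le> (525 / 1000) / ell"
  proof -
    have "ln (25 / 4 * real L ^ 2) / (25 / 8 * real L) \<le> 8 / 5 * (ln (5 / 2 * 2) / (5 / 2 * 2))"
      using L2 by (intro small_term_le) auto
    also have "\<dots> \<le> 525 / 1000" using ln_5_le by simp
    finally show ?thesis using ell0 by (simp add: divide_right_mono flip: divide_divide_eq_left)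
  qed
  have r3: "real L * ((2 + 2 / 5 / tau + 14 / 25 / real L) * (2 + 2 / 5 / tau + 2 / 5 / real L)) / 15 \<le> 48 / 125 * real L + 1611 / 10000"
  proof -
    have t5: "2 / 5 / tau \<le> 2 / 5" using tau1 by (simp add: field_simps)
    have "(2 + 2 / 5 / tau + 14 / 25 / real L) * (2 + 2 / 5 / tau + 2 / 5 / real L) \<le> (2 + 2 / 5 + 14 / 25 / real L) * (2 + 2 / 5 + 2 / 5 / real L)"
      using t5 tau1 by (intro mult_mono add_mono) auto
    then have "real L * ((2 + 2 / 5 / tau + 14 / 25 / real L) * (2 + 2 / 5 / tau + 2 / 5 / real L)) \<le> real L * ((2 + 2 / 5 + 14 / 25 / real L) * (2 + 2 / 5 + 2 / 5 / real L))"
      by (intro mult_left_mono) auto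
    also have "\<dots> = 144 / 25 * real L + 288 / 125 + 28 / 125 / real L" using L2 by (simp add: field_simps)
    also have "28 / 125 / real L \<le> 28 / 125 / 2" using L2 by (intro divide_left_mono) auto
    finally show ?thesis by simp
  qed
  have "(t + 115 / 100) / ell + (525 / 1000) / ell \<le> (t + 42 / 25) / ell"
    unfolding add_divide_distrib[symmetric] using ell0 by (intro divide_right_mono) auto
  moreover have "(t + 42 / 25) / ell + 117 / 100 < 77 / 125 * real L"
  proof -
    have "v * (77 / 125) = (t + 42 / 25) / ell + 117 / 100" by (simp add: v_def)
    then show ?thesis using Lv by linarith
  qed
  ultimately have "(2 + ln (2 / 5 * real N / tau + 1)) / ell
       + real L * ((2 + 2 / 5 / tau + 14 / 25 / real L) * (2 + 2 / 5 / tau + 2 / 5 / real L)) / 15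
       + ln (25 / 4 * real L ^ 2) / (25 / 8 * real L * ell) < real L - 1"
    using r1 r2 r3 by linarith
  then show False
    using interpolation_criterion[OF a b c dvd n0 k e1 e2 _ L2 ell_def tau_def NL] x1 by simp
qed

text \<open>The four thresholds for \<open>ell\<close> lie below ln 7, ln 13, ln 49 and ln 8000. The
  bound 2190 is smaller than 13^3 = 2197 and than 7^4 = 2401, which limits \<open>j\<close> in the
  later tables.\<close>

lemma N_less_6000: "193 / 100 \<le> ell \<Longrightarrow> N < 6000"
  using N_less[of "193 / 100" 6000 "88 / 10" "5560 / 1000" "519 / 1000" "11716 / 1000" "842 / 1000"] exp_880
  by (simp add: power2_eq_square)
lemma N_less_2190: "254 / 100 \<le> ell \<Longrightarrow> N < 2190"
  using N_less[of "254 / 100" 2190 "775 / 100" "4052 / 1000" "394 / 1000" "8928 / 1000" "640 / 1000"] exp_775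
  by (simp add: power2_eq_square)
lemma N_less_750: "386 / 100 \<le> ell \<Longrightarrow> N < 750"
  using N_less[of "386 / 100" 750 "667 / 100" "2728 / 1000" "260 / 1000" "6412 / 1000" "421 / 1000"] exp_667
  by (simp add: power2_eq_square)
lemma N_less_200: "85 / 10 \<le> ell \<Longrightarrow> N < 200"
  using N_less[of "85 / 10" 200 "533 / 100" "1628 / 1000" "118 / 1000" "4239 / 1000" "192 / 1000"] exp_533
  by (simp add: power2_eq_square)

text \<open>For \<open>a = 7\<close>, \<open>k = 1\<close> the values \<open>ell = ln 7\<close> and
  \<open>tau = 1 + j\<close> are exact. A factor \<open>7 ^ m\<close> of the argument of the
  logarithm contributes exactly \<open>m\<close> to the criterion, and the remaining factor
  \<open>1 + e\<close> at most \<open>e / ell\<close>.\<close>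

lemma no_N_if_bounds:
  assumes a7: "a = 7" "k = 1" and N: "N < 6000" "25 / 4 * (1 + real j) * real L ^ 2 + real L \<le> real N"
    and L: "L \<ge> 8" and e: "e \<ge> 0" "2 / 5 * 6000 / (1 + real j) + 1 \<le> 7 ^ m * (1 + e)"
    and num: "real m + (2 + e) / (193 / 100)
       + real L * ((2 + 2 / 5 / (1 + real j) + 14 / 25 / real L) * (2 + 2 / 5 / (1 + real j) + 2 / 5 / real L)) / 15
       + 137 / 1000 < real L - 1"
  shows False
proof -
  have ell7: "ell = ln 7" "193 / 100 \<le> ell" using ln_7_ge unfolding ell_def unfolding a7 by simp_all
  have tau: "1 + real j = real x1 / real k" by (simp add: x1 a7)
  define Y where "Y = 2 / 5 * real N / (1 + real j) + 1"
  have Y0: "Y > 0" by (simp add: Y_def add_nonneg_pos)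
  have "2 / 5 * real N / (1 + real j) \<le> 2 / 5 * 6000 / (1 + real j)"
    using N by (intro divide_right_mono) auto
  then have "Y \<le> 7 ^ m * (1 + e)" using e unfolding Y_def by linarith
  then have "ln Y \<le> ln (7 ^ m * (1 + e))" using Y0 by (intro ln_mono) auto
  also have "\<dots> = real m * ell + ln (1 + e)" using e by (simp add: ln_mult ln_realpow ell7)
  also have "ln (1 + e) \<le> e" using e by (intro ln_add_one_self_le_self)
  finally have "2 + ln Y \<le> real m * ell + (2 + e)" by simp
  then have "(2 + ln Y) / ell \<le> (real m * ell + (2 + e)) / ell" using ell7 by (intro divide_right_mono) auto
  also have "\<dots> = real m + (2 + e) / ell" using ell7 by (simp add: add_divide_distrib)
  also have "(2 + e) / ell \<le> (2 + e) / (193 / 100)" using ell7 e by (intro divide_left_mono) auto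
  finally have 1: "(2 + ln Y) / ell \<le> real m + (2 + e) / (193 / 100)" by simp
  have "ln (25 / 4 * real L ^ 2) / (25 / 8 * real L) \<le> 8 / 5 * (ln (5 / 2 * 8) / (5 / 2 * 8))"
    using L by (intro small_term_le) auto
  moreover have "ln (20::real) \<le> 82 / 25"
  proof -
    have "ln (20::real) = ln 4 + ln 5" using ln_mult_pos[of "4::real" 5] by simp
    moreover have "ln (4::real) \<le> ln 5" by simp
    ultimately show ?thesis using ln_5_le by linarith
  qed
  ultimately have h: "ln (25 / 4 * real L ^ 2) / (25 / 8 * real L) \<le> 264 / 1000" by simp
  have "ln (25 / 4 * real L ^ 2) / (25 / 8 * real L) / ell \<le> 264 / 1000 / (193 / 100)"
    by (rule frac_le[OF _ h _ ell7(2)]) simp_all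
  also have "264 / 1000 / (193 / 100) \<le> (137 / 1000 :: real)" by simp
  finally have 2: "ln (25 / 4 * real L ^ 2) / (25 / 8 * real L * ell) \<le> 137 / 1000"
    by (simp only: divide_divide_eq_left)
  have "(2 + ln (2 / 5 * real N / (1 + real j) + 1)) / ell
       + real L * ((2 + 2 / 5 / (1 + real j) + 14 / 25 / real L) * (2 + 2 / 5 / (1 + real j) + 2 / 5 / real L)) / 15
       + ln (25 / 4 * real L ^ 2) / (25 / 8 * real L * ell) < real L - 1"
    using 1 2 num unfolding Y_def[symmetric] by linarith
  then show False
    using interpolation_criterion[OF a b c dvd n0 k e1 e2 _ _ ell_def tau N(2)] x1 L by simp
qed

lemma N_less_2190_base_7:
  assumes a7: "a = 7" "k = 1" shows "N < 2190"
proof (rule ccontr)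
  assume "\<not> N < 2190"
  then have N: "real N \<ge> 2190" by simp
  have "N < 6000" using N_less_6000 ln_7_ge unfolding ell_def unfolding a7 by simp
  have "j < 5"
  proof (rule ccontr)
    assume "\<not> j < 5"
    then have "(7::nat) ^ 5 \<le> 7 ^ j" by (intro power_increasing) auto
    then show False using aj a7 \<open>N < 6000\<close> by simp
  qed
  then consider "j = 0" | "j = 1" | "j = 2" | "j = 3" | "j = 4" by linarith
  then show False
  proof cases
    case 1
    \<comment> \<open>For \<open>N = 6000\<close> the argument of the logarithm is 2401 = 7^4 when
      \<open>j = 0\<close>, and 601 = 343 + 258 and 481 = 343 + 138 when \<open>j\<close> is 3 and
      4. Each \<open>L\<close> is chosen so that the lower bound required of \<open>N\<close> stays
      below 2190.\<close>
    show ?thesis by (rule no_N_if_bounds[OF a7 \<open>N < 6000\<close>, of 11 0 4]) (use N in \<open>simp_all add: 1\<close>)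
  next
    case 2
    show ?thesis by (rule no_N_if_bounds[OF a7 \<open>N < 6000\<close>, of 10 0 4]) (use N in \<open>simp_all add: 2\<close>)
  next
    case 3
    show ?thesis by (rule no_N_if_bounds[OF a7 \<open>N < 6000\<close>, of 10 0 4]) (use N in \<open>simp_all add: 3\<close>)
  next
    case 4
    show ?thesis by (rule no_N_if_bounds[OF a7 \<open>N < 6000\<close>, of 9 "258 / 343" 3]) (use N in \<open>simp_all add: 4\<close>)
  next
    case 5
    show ?thesis by (rule no_N_if_bounds[OF a7 \<open>N < 6000\<close>, of 8 "138 / 343" 3]) (use N in \<open>simp_all add: 5\<close>)
  qed
qed
end

section \<open>Odd powers in a quadratic setting\<close>

text \<open>The ring elements \<open>u \<surd>\<beta> + v \<surd>(-c)\<close>; odd powers of such elements have the same shape.\<close>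

definition el :: "nat \<Rightarrow> nat \<Rightarrow> int \<Rightarrow> int \<Rightarrow> complex" where
  "el \<beta> c u v = Complex (of_int u * sqrt \<beta>) (of_int v * sqrt c)"

lemma el_eq_iff:
  assumes "\<beta> > 0" "c > 0"
  shows "el \<beta> c u v = el \<beta> c u' v' \<longleftrightarrow> u = u' \<and> v = v'"
  using assms by (simp add: el_def)

lemma el_cnj: "cnj (el \<beta> c u v) = el \<beta> c u (- v)" by (simp add: el_def complex_eq_iff)
lemma el_minus: "- el \<beta> c u v = el \<beta> c (- u) (- v)" by (simp add: el_def complex_eq_iff)
lemma el_scale: "of_int k * el \<beta> c u v = el \<beta> c (k * u) (k * v)" by (simp add: el_def complex_eq_iff)

lemma el_mult_cnj: "el \<beta> c u v * el \<beta> c u (- v) = of_int (int \<beta> * u^2 + int c * v^2)"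
proof -
  have "sqrt (real \<beta>) * sqrt (real \<beta>) = real \<beta>" "sqrt (real c) * sqrt (real c) = real c" by simp_all
  then show ?thesis by (simp add: el_def complex_eq_iff power2_eq_square mult_ac)
qed

lemma el_mult_square:
  "el \<beta> c U V * el \<beta> c u v ^ 2 =
     el \<beta> c ((int \<beta> * u^2 - int c * v^2) * U - int c * (2 * u * v) * V)
        ((int \<beta> * u^2 - int c * v^2) * V + int \<beta> * (2 * u * v) * U)"
proof -
  have s: "x * (sqrt (real \<beta>) * (sqrt (real \<beta>) * y)) = real \<beta> * x * y" "x * (sqrt (real c) * (sqrt (real c) * y)) = real c * x * y" for x y
    by (simp_all flip: mult.assoc)
  have s': "x * (sqrt (real \<beta>) * sqrt (real \<beta>)) = real \<beta> * x" "x * (sqrt (real c) * sqrt (real c)) = real c * x" for x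
    by simp_all
  show ?thesis
    unfolding power2_eq_square
    by (simp add: el_def complex_eq_iff algebra_simps) (metis (no_types, opaque_lifting) mult.assoc mult.commute real_sqrt_mult_self abs_of_nat)?
qed

text \<open>The two coordinates of the power with exponent \<open>2 * i + 1\<close>, divided by
  \<open>u\<close> and \<open>v\<close> respectively. They depend only on the two parts
  \<open>\<beta> * u^2\<close> and \<open>c * v^2\<close> of the norm, which are the arguments
  here.\<close>

fun pw :: "int \<Rightarrow> int \<Rightarrow> nat \<Rightarrow> int \<times> int" where
  "pw w c 0 = (1, 1)"
| "pw w c (Suc i) = (let (A, B) = pw w c i in ((w - c) * A - 2 * c * B, (w - c) * B + 2 * w * A))"

lemma el_odd_power:
  "el \<beta> c u v ^ (2 * i + 1) = el \<beta> c (u * fst (pw (int \<beta> * u^2) (int c * v^2) i)) (v * snd (pw (int \<beta> * u^2) (int c * v^2) i))"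
proof (induction i)
  case (Suc i)
  obtain A B where AB: "pw (int \<beta> * u^2) (int c * v^2) i = (A, B)" by fastforce
  have "el \<beta> c u v ^ (2 * Suc i + 1) = el \<beta> c u v ^ (2 * i + 1) * el \<beta> c u v ^ 2"
    by (simp flip: power_add)
  also have "\<dots> = el \<beta> c (u * A) (v * B) * el \<beta> c u v ^ 2" using Suc AB by simp
  finally show ?case unfolding el_mult_square
    by (simp add: AB) (auto intro!: arg_cong2[of _ _ _ _ "el \<beta> c"] simp: algebra_simps power2_eq_square)
qed simp

lemma el_odd_power_ex:
  assumes "odd t"
  obtains U V where "el \<beta> c u v ^ t = el \<beta> c U V" "u dvd U" "v dvd V"
proof -
  obtain i where "t = 2 * i + 1" using assms by (elim oddE)
  then show ?thesis using that el_odd_power[of \<beta> c u v i] by (metis dvd_triv_left)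
qed

text \<open>These are the terms of the binomial expansion of order 0 in \<open>w\<close>.\<close>

lemma pw_cong:
  "\<exists>x y. pw w c i = ((2 * int i + 1) * (- c) ^ i + w * x, (- c) ^ i + w * y)"
proof (induction i)
  case 0 show ?case by (intro exI[of _ 0]) simp
next
  case (Suc i)
  then obtain x y where xy: "pw w c i = ((2 * int i + 1) * (- c) ^ i + w * x, (- c) ^ i + w * y)" by blast
  show ?case
    by (intro exI[of _ "(2 * int i + 1) * (- c) ^ i + w * x - c * x - 2 * c * y"] exI[of _ "(- c) ^ i + w * y - c * y + 2 * ((2 * int i + 1) * (- c) ^ i + w * x)"])
       (simp add: xy algebra_simps)
qed

text \<open>The terms of order at most 1 in \<open>w\<close> for the exponent
  \<open>2 * m + 3\<close>: here \<open>S\<close> is the binomial coefficient C(2m+3,3), given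
  through \<open>3 * S\<close> to avoid a division, and (m+1)(2m+3) is C(2m+3,2). The step from
  \<open>m\<close> to \<open>m + 1\<close> adds (2m+3)^2 to \<open>S\<close>.\<close>

lemma pw_cong_square:
  "\<exists>S x y. 3 * S = (int m + 1) * (2 * int m + 1) * (2 * int m + 3) \<and>
     pw w c (Suc m) = ((2 * int m + 3) * (- c) ^ Suc m + w * S * (- c) ^ m + w^2 * x,
        (- c) ^ Suc m + w * ((int m + 1) * (2 * int m + 3)) * (- c) ^ m + w^2 * y)"
proof (induction m)
  case 0 show ?case by (intro exI[of _ 1] exI[of _ 0]) simp
next
  case (Suc m)
  then obtain S x y where S: "3 * S = (int m + 1) * (2 * int m + 1) * (2 * int m + 3)"
    and p: "pw w c (Suc m) = ((2 * int m + 3) * (- c) ^ Suc m + w * S * (- c) ^ m + w^2 * x,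
        (- c) ^ Suc m + w * ((int m + 1) * (2 * int m + 3)) * (- c) ^ m + w^2 * y)" by blast
  show ?case
    by (intro exI[of _ "S + (2 * int m + 3)^2"] exI[of _ "S * (- c) ^ m + (w - c) * x - 2 * c * y"]
        exI[of _ "(int m + 1) * (2 * int m + 3) * (- c)^m + (w - c) * y + 2 * (S * (- c)^m + w * x)"])
      (use S in \<open>simp add: p del: pw.simps(2) add: pw.simps(2)[of w c "Suc m"] algebra_simps power2_eq_square\<close>)
qed

lemma only_prime_factor_square_free:
  fixes A :: int and p :: nat
  assumes p: "prime p" and A: "A \<noteq> 0" and only: "\<And>l::nat. prime l \<Longrightarrow> int l dvd A \<Longrightarrow> l = p"
    and sq: "\<not> (int p)^2 dvd A"
  shows "\<bar>A\<bar> \<le> int p"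
proof -
  define n where "n = nat \<bar>A\<bar>"
  have n: "n > 0" using A by (simp add: n_def)
  have dn: "l dvd n \<longleftrightarrow> int l dvd A" for l by (simp add: n_def nat_abs_dvd_iff flip: int_dvd_int_iff) 
  have "n dvd p"
  proof (cases "p dvd n")
    case True
    then obtain m where m: "n = p * m" by blast
    have "m = 1"
    proof (rule ccontr)
      assume "m \<noteq> 1"
      then obtain l where l: "prime l" "l dvd m" using prime_factor_nat by blast
      then have "l = p" using only[of l] dn[of l] m by simp
      then have "p^2 dvd n" using l m by (simp add: power2_eq_square mult_dvd_mono)
      then show False using sq dn[of "p^2"] by simp
    qed
    then show ?thesis using m by simp
  next
    case False
    have "n = 1"
    proof (rule ccontr)
      assume "n \<noteq> 1"
      then obtain l where "prime l" "l dvd n" using prime_factor_nat by blast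
      then show False using only[of l] dn[of l] False by auto
    qed
    then show ?thesis by simp
  qed
  then have "n \<le> p" using p by (intro dvd_imp_le) (auto simp: prime_gt_0_nat)
  then show ?thesis by (simp add: n_def)
qed

section \<open>The case c = 1\<close>

text \<open>Treated apart because the descent requires \<open>c > 1\<close>. With
  \<open>C = a ^ x1\<close>, the divisor \<open>C - 1 = b ^ y1\<close> of \<open>a ^ x2 - 1\<close>
  forces \<open>x2 = x1 * q\<close>. Now 3 divides \<open>C - 1\<close>, hence \<open>b\<close>, and
  the geometric sum \<open>b ^ (y2 - y1)\<close> is \<open>q\<close> modulo 3, so 3 divides
  \<open>q\<close>. Then \<open>C^2 + C + 1\<close> divides \<open>b ^ y2\<close>; its primes divide
  \<open>C - 1\<close>, so the only one is 3, and 9 does not divide it. It would be at most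
  3.\<close>

lemma no_solution_c1:
  fixes a b x1 x2 y1 y2 :: nat
  assumes a: "[a = 1] (mod 3)" "a > 1" and e: "a ^ x1 = b ^ y1 + 1" "a ^ x2 = b ^ y2 + 1"
    and x: "0 < x1" "x1 < x2" and y: "0 < y1" "y1 < y2"
  shows False
proof -
  define C where "C = a ^ x1"
  have C1: "C > 1" unfolding C_def by (rule one_less_power[OF a(2) x(1)])
  have C3: "[C = 1] (mod 3)" unfolding C_def using cong_pow[OF a(1), of x1] by simp
  have bC: "int b ^ y1 = int C - 1" using e(1) by (simp add: C_def)
  define q where "q = x2 div x1"
  have "x2 = x1 * q"
  proof -
    define r where "r = x2 mod x1"
    have x2: "x2 = x1 * q + r" by (simp add: q_def r_def)
    have "int b ^ y1 dvd int b ^ y2" using y by (intro le_imp_power_dvd) simp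
    moreover have "int b ^ y2 = int a ^ x2 - 1" using e(2) by (simp flip: of_nat_power)
    ultimately have d: "int C - 1 dvd int a ^ x2 - 1" using bC by simp
    have "int C - 1 dvd int C ^ q - 1" by (metis dvd_triv_left power_diff_1_eq)
    then have h1: "int C - 1 dvd (int C ^ q - 1) * int a ^ r" by simp
    have h2: "int a ^ x2 - 1 = (int C ^ q - 1) * int a ^ r + (int a ^ r - 1)"
    proof -
      have "int C ^ q = int a ^ (x1 * q)" by (simp add: C_def power_mult)
      then show ?thesis by (simp add: x2 power_add algebra_simps)
    qed
    have d2: "int C - 1 dvd int a ^ r - 1" using dvd_diff[OF d h1] unfolding h2 by simp
    have "r < x1" using x by (simp add: r_def)
    then have "int a ^ r < int C" using a by (simp add: C_def power_strict_increasing)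
    moreover have "int a ^ r \<ge> 1" using a by simp
    ultimately have "int a ^ r - 1 = 0" using d2 zdvd_imp_le[of "int C - 1" "int a ^ r - 1"] by linarith
    then have "a ^ r = 1" by (metis diff_eq_diff_eq diff_self of_nat_1 of_nat_eq_iff of_nat_power)
    then have "r = 0" using a one_less_power[of a r] by (cases r) auto
    then show ?thesis using x2 by simp
  qed
  then have q1: "q > 1" using x by (metis less_irrefl less_one linorder_neqE_nat mult_0_right mult_1_right not_less_zero)
  have Cq: "int C ^ q = int b ^ y2 + 1" using e(2) \<open>x2 = x1 * q\<close> by (simp add: C_def flip: power_mult of_nat_power)
  have "3 dvd b ^ y1"
  proof -
    have "[int C - 1 = 1 - 1] (mod 3)" using C3 by (intro cong_diff) (auto simp flip: cong_int_iff)
    then have "3 dvd int b ^ y1" unfolding bC by (simp add: cong_0_iff)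
    then show ?thesis by (metis int_dvd_int_iff of_nat_numeral of_nat_power)
  qed
  then have b3: "3 dvd b" by (rule prime_dvd_power_nat[rotated]) simp
  have geo: "int C ^ q - 1 = (int C - 1) * (\<Sum>i<q. int C ^ i)" by (rule power_diff_1_eq)
  have "int b ^ y1 * int b ^ (y2 - y1) = int b ^ y2" using y by (simp flip: power_add)
  also have "int b ^ y2 = int C ^ q - 1" using Cq by simp
  also have "\<dots> = int b ^ y1 * (\<Sum>i<q. int C ^ i)" unfolding geo bC ..
  finally have ge: "int b ^ y1 * int b ^ (y2 - y1) = int b ^ y1 * (\<Sum>i<q. int C ^ i)" .
  have "int b ^ y1 \<noteq> 0" using bC C1 by linarith
  then have gs: "int b ^ (y2 - y1) = (\<Sum>i<q. int C ^ i)" using ge mult_left_cancel by blast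
  have "[(\<Sum>i<q. int C ^ i) = (\<Sum>i<q. 1 ^ i)] (mod 3)"
    using C3 by (intro cong_sum cong_pow) (auto simp flip: cong_int_iff)
  then have "[int b ^ (y2 - y1) = int q] (mod 3)" unfolding gs by simp
  moreover have "3 dvd int b ^ (y2 - y1)" using b3 y
    by (metis dvd_power_iff dvd_trans dvd_power int_dvd_int_iff of_nat_numeral zero_less_diff)
  ultimately have "3 dvd int q" by (simp add: cong_dvd_iff)
  then obtain m where m: "q = 3 * m" by (metis dvdE int_dvd_int_iff of_nat_numeral)
  have "int C ^ 3 - 1 dvd int C ^ q - 1" unfolding m power_mult by (metis dvd_triv_left power_diff_1_eq)
  moreover have "int C ^ 3 - 1 = (int C - 1) * (int C^2 + int C + 1)" by (simp add: power2_eq_square power3_eq_cube algebra_simps)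
  ultimately have Dd: "int C^2 + int C + 1 dvd int b ^ y2" using Cq by (metis add_diff_cancel_right' dvd_mult_right)
  have only: "l = 3" if l: "prime l" "int l dvd int C^2 + int C + 1" for l :: nat
  proof -
    have "int l dvd int b ^ y2" using l Dd by (rule_tac dvd_trans)
    then have "l dvd b" using l(1) by (metis int_dvd_int_iff of_nat_power prime_dvd_power_nat)
    then have "int l dvd int b ^ y1" using y by (metis dvd_power dvd_trans int_dvd_int_iff)
    then have lC: "int l dvd int C - 1" using bC by simp
    have "int C^2 + int C + 1 = (int C - 1) * (int C + 2) + 3" by (simp add: power2_eq_square algebra_simps)
    then have "int l dvd 3" using l(2) lC by (metis dvd_add_right_iff dvd_mult2)
    then have "l dvd 3" by (metis int_dvd_int_iff of_nat_numeral)
    moreover have "prime (3::nat)" by simp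
    ultimately show ?thesis using l(1) primes_dvd_imp_eq by blast
  qed
  have "\<not> (int 3)^2 dvd int C^2 + int C + 1"
  proof
    assume "(int 3)^2 dvd int C^2 + int C + 1"
    then have 9: "(int C^2 + int C + 1) mod 9 = 0" by (simp add: mod_0_imp_dvd dvd_imp_mod_0)
    have "C mod 3 = 1" using C3 by (simp add: cong_def)
    then have "int C = 3 * int (C div 3) + 1" by presburger
    then obtain t where "int C = 3 * t + 1" by blast
    then have "int C^2 + int C + 1 = 9 * (t^2 + t) + 3" by (simp add: power2_eq_square algebra_simps)
    then show False using 9 by presburger
  qed
  then have "\<bar>int C^2 + int C + 1\<bar> \<le> int 3"
    using only C1 by (intro only_prime_factor_square_free) (auto simp: power2_eq_square)
  moreover have "int C^2 \<ge> 4" using C1 power_mono[of 2 "int C" 2] by simp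
  ultimately show False by simp
qed

section \<open>Descent to the element of least norm\<close>

text \<open>\<open>z\<close> is the least exponent of a norm among elements satisfying
  \<open>rad\<close>. This condition passes to the quotients that occur in the descent.\<close>

locale norm_form =
  fixes a b c \<beta> z :: nat and u v :: int
  assumes a: "prime a" "a > 2" "\<not> a dvd \<beta>" "\<not> a dvd c" "coprime a b"
    and b: "b > 1" and c: "c > 1" and \<beta>: "\<beta> > 0"
    and z: "z > 0" and base: "int \<beta> * u^2 + int c * v^2 = int a ^ z"
    and rad: "\<And>p. prime p \<Longrightarrow> p dvd b \<Longrightarrow> int p dvd int \<beta> * u"
    and min: "\<And>n u v. n > 0 \<Longrightarrow> int \<beta> * u^2 + int c * v^2 = int a ^ n \<Longrightarrow>
       (\<And>p. prime p \<Longrightarrow> p dvd b \<Longrightarrow> int p dvd int \<beta> * u) \<Longrightarrow> z \<le> n"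
begin

lemma pa: "prime (int a)" using a(1) by simp

lemma a_dvd_iff: "int a dvd int \<beta> * x \<longleftrightarrow> int a dvd x" "int a dvd int c * x \<longleftrightarrow> int a dvd x"
  using a by (auto simp: prime_dvd_mult_iff[OF pa])

lemma p_ne_a: "prime p \<Longrightarrow> p dvd b \<Longrightarrow> \<not> int p dvd int a"
  using a by (metis coprime_common_divisor int_dvd_int_iff not_prime_unit)

text \<open>\<open>c > 1\<close> forces \<open>V = 0\<close>, so \<open>\<beta> * U\<close> divides
  1; but some prime divides \<open>b\<close>, hence \<open>\<beta> * U\<close>.\<close>

lemma norm_one_False:
  assumes "int \<beta> * U^2 + int c * V^2 = 1" "\<And>p. prime p \<Longrightarrow> p dvd b \<Longrightarrow> int p dvd int \<beta> * U"
  shows False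
proof -
  have "V = 0"
  proof (rule ccontr)
    assume "V \<noteq> 0"
    then have "V^2 \<ge> 1" by (simp add: int_one_le_iff_zero_less)
    then have "int c * V^2 \<ge> int c * 1" by (intro mult_left_mono) auto
    moreover have "int \<beta> * U^2 \<ge> 0" by simp
    ultimately show False using assms(1) c by linarith
  qed
  then have "int \<beta> * U * U = 1" using assms(1) by (simp add: power2_eq_square)
  moreover obtain p where "prime p" "p dvd b" using b prime_factor_nat[of b] by auto
  ultimately have "int p dvd 1" using assms(2) by (metis dvd_mult2)
  then show False using \<open>prime p\<close> by auto
qed

lemma dvd_square_norm:
  assumes "int \<beta> * U^2 + int c * V^2 = int a ^ n" "int a ^ e dvd U" "2 * e \<le> n"
  shows "int a ^ e dvd V"
proof -
  have "int a ^ (2 * e) dvd int a ^ n" using assms by (intro le_imp_power_dvd)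
  moreover have "int a ^ (2 * e) dvd U^2" using assms(2) by (metis dvd_power_same mult.commute power_mult)
  ultimately have "int a ^ (2 * e) dvd int a ^ n - int \<beta> * U^2" by (intro dvd_diff dvd_mult)
  moreover have "int c * V^2 = int a ^ n - int \<beta> * U^2" using assms(1) by linarith
  ultimately have "int a ^ (2 * e) dvd int c * V^2" by simp
  moreover have "coprime (int a ^ (2 * e)) (int c)" using a pa
    by (intro coprime_power_left_iff[THEN iffD2]) (auto intro: prime_imp_coprime)
  ultimately have "(int a ^ e)^2 dvd V^2" by (simp add: coprime_dvd_mult_right_iff mult.commute flip: power_mult)
  then show ?thesis by simp
qed

text \<open>A common factor \<open>a\<close> could be divided out, which lowers the exponent below
  \<open>z\<close> or yields norm 1.\<close>

lemma base_primitive: "\<not> int a dvd u" "\<not> int a dvd v"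
proof -
  show u: "\<not> int a dvd u"
  proof
    assume d: "int a dvd u"
    then have "int a dvd int c * v^2"
      using z base by (metis dvd_add_right_iff dvd_mult dvd_power dvd_power_same power2_eq_square dvd_mult2)
    then have "int a dvd v" using a_dvd_iff pa by (simp add: prime_dvd_power_iff)
    then obtain u' v' where uv: "u = int a * u'" "v = int a * v'" using d by (elim dvdE)
    have e: "int a ^ 2 * (int \<beta> * u'^2 + int c * v'^2) = int a ^ z" using base by (simp add: uv power2_eq_square algebra_simps)
    have z2: "z \<ge> 2"
    proof (rule ccontr)
      assume "\<not> z \<ge> 2"
      then have "z = 1" using z by simp
      then have "int a * (int \<beta> * u'^2 + int c * v'^2) = 1" using e a by (simp add: power2_eq_square)
      then show False using a by (simp add: zmult_eq_1_iff)
    qed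
    have "int a ^ 2 * (int \<beta> * u'^2 + int c * v'^2) = int a ^ 2 * int a ^ (z - 2)" 
      unfolding e using z2 by (metis le_add_diff_inverse power_add)
    then have e': "int \<beta> * u'^2 + int c * v'^2 = int a ^ (z - 2)" using a by simp
    have r: "int p dvd int \<beta> * u'" if "prime p" "p dvd b" for p
      using rad[OF that] p_ne_a[OF that] that(1) by (auto simp: uv prime_dvd_mult_iff)
    show False
    proof (cases "z = 2")
      case True then show False using norm_one_False[OF _ r] e' by simp
    next
      case False then show False using min[OF _ e' r] z2 by simp
    qed
  qed
  show "\<not> int a dvd v"
  proof
    assume d: "int a dvd v"
    then have "int a dvd int \<beta> * u^2"
      using z base by (metis dvd_add_left_iff dvd_mult dvd_power dvd_power_same power2_eq_square dvd_mult2)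
    then show False using a_dvd_iff pa u by (simp add: prime_dvd_power_iff)
  qed
qed

text \<open>Divide the element by the base element, or by its conjugate, and multiply the quotient
  by the conjugate of that divisor. The result has the same shape and is divisible by
  \<open>a ^ z\<close>. So the element is the square of the divisor times an element of norm
  \<open>a ^ (n - 2 * z)\<close>, to which induction applies. If the signs did not match, a factor
  \<open>a ^ z\<close> would split off, against \<open>\<not> int a dvd U\<close>.\<close>

lemma odd_power_structure:
  assumes "int \<beta> * U^2 + int c * V^2 = int a ^ n" "\<And>p. prime p \<Longrightarrow> p dvd b \<Longrightarrow> int p dvd int \<beta> * U"
    "\<not> int a dvd U"
  shows "\<exists>t \<sigma> \<tau>. odd t \<and> n = t * z \<and> \<sigma> \<in> {1,-1} \<and> \<tau> \<in> {1,-1} \<and> el \<beta> c U V = el \<beta> c (\<sigma> * u) (\<tau> * v) ^ t"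
  using assms
proof (induction n arbitrary: U V rule: less_induct)
  case (less n)
  note N = less.prems(1) and rU = less.prems(2) and aU = less.prems(3)
  have n0: "n > 0" using norm_one_False[OF _ rU] N by (cases n) auto
  have zn: "z \<le> n" using min[OF n0 N rU] by simp
  have prod: "int \<beta> * ((U * v)^2 - (u * V)^2) = int a ^ n * v^2 - int a ^ z * V^2"
    unfolding N[symmetric] base[symmetric] by (simp add: power2_eq_square algebra_simps)
  have copb: "coprime (int a ^ e) (int \<beta>)" for e
    using a pa by (intro coprime_power_left_iff[THEN iffD2]) (auto intro: prime_imp_coprime)
  have "int a ^ z dvd int a ^ n * v^2 - int a ^ z * V^2"
    using zn by (intro dvd_diff dvd_mult2 le_imp_power_dvd) auto
  then have "int a ^ z dvd (U * v)^2 - (u * V)^2" unfolding prod[symmetric] using copb by (simp add: coprime_dvd_mult_right_iff)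
  then have pr: "int a ^ z dvd (U * v - u * V) * (U * v + u * V)" by (simp add: power2_eq_square algebra_simps)
  have nb: "\<not> (int a dvd U * v - u * V \<and> int a dvd U * v + u * V)"
  proof
    assume "int a dvd U * v - u * V \<and> int a dvd U * v + u * V"
    then have "int a dvd (U * v - u * V) + (U * v + u * V)" using dvd_add by blast
    then have "int a dvd 2 * (U * v)" by simp
    moreover have "\<not> int a dvd 2" using a(2) zdvd_imp_le[of "int a" 2] by auto
    ultimately show False using aU base_primitive pa by (simp add: prime_dvd_mult_iff)
  qed
  have cop: "coprime (int a ^ z) x" if "\<not> int a dvd x" for x
    using that pa by (intro coprime_power_left_iff[THEN iffD2]) (auto intro: prime_imp_coprime)
  \<comment> \<open>The sum of the two factors is \<open>2 * U * v\<close>, which is prime to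
    \<open>a\<close>; hence the whole power \<open>a ^ z\<close> divides one of them, and this
    selects the conjugate to divide by.\<close>
  obtain \<tau>0 :: int where t0: "\<tau>0 \<in> {1,-1}" and dv: "int a ^ z dvd U * (\<tau>0 * v) - u * V"
  proof (cases "int a dvd U * v + u * V")
    case True
    then have "\<not> int a dvd U * v - u * V" using nb by blast
    then have "int a ^ z dvd U * v + u * V" using pr cop by (simp add: coprime_dvd_mult_right_iff)
    then have "int a ^ z dvd - (U * v + u * V)" by (simp only: dvd_minus_iff)
    then show ?thesis using that[of "-1"] by simp
  next
    case False
    then have "int a ^ z dvd U * v - u * V" using pr cop by (simp add: coprime_dvd_mult_left_iff)
    then show ?thesis using that[of 1] by simp
  qed
  define w where "w = \<tau>0 * v"
  have w2: "w^2 = v^2" using t0 by (auto simp: w_def)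
  have basew: "int \<beta> * u^2 + int c * w^2 = int a ^ z" using base w2 by simp
  obtain Y where Y: "V * u - U * w = int a ^ z * Y"
  proof -
    have "int a ^ z dvd - (U * w - u * V)" using dv unfolding w_def by (simp only: dvd_minus_iff)
    then have "int a ^ z dvd V * u - U * w" by (simp add: algebra_simps)
    then show ?thesis using that by (elim dvdE)
  qed
  have id: "(int \<beta> * U * u + int c * V * w)^2 + int \<beta> * int c * (V * u - U * w)^2 = int a ^ n * int a ^ z"
    unfolding N[symmetric] basew[symmetric] by (simp add: power2_eq_square algebra_simps)
  have "(int a ^ z)^2 dvd (int \<beta> * U * u + int c * V * w)^2"
  proof -
    have "(int a ^ z)^2 dvd int a ^ n * int a ^ z" using zn
      by (simp add: le_imp_power_dvd flip: power_add power_mult)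
    moreover have "(int a ^ z)^2 dvd int \<beta> * int c * (V * u - U * w)^2" unfolding Y power_mult_distrib by simp
    ultimately show ?thesis using id by (metis dvd_add_left_iff)
  qed
  then have "int a ^ z dvd int \<beta> * U * u + int c * V * w" by simp
  \<comment> \<open>The quotient of the two elements is X + Y sqrt(-\<beta> c).\<close>
  then obtain X where X: "int \<beta> * U * u + int c * V * w = int a ^ z * X" by (elim dvdE)
  have az: "a \<noteq> 0" using a by simp
  have XY: "X^2 + int \<beta> * int c * Y^2 = int a ^ (n - z)"
  proof -
    have "(int a ^ z)^2 * (X^2 + int \<beta> * int c * Y^2) = (int a ^ z)^2 * int a ^ (n - z)"
    proof -
      have an: "int a ^ n = int a ^ z * int a ^ (n - z)" using zn by (metis le_add_diff_inverse power_add)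
      have "(int a ^ z)^2 * (X^2 + int \<beta> * int c * Y^2) = (int a ^ z * X)^2 + int \<beta> * int c * (int a ^ z * Y)^2"
        by (simp add: power_mult_distrib distrib_left)
      also have "\<dots> = int a ^ n * int a ^ z" using id unfolding X Y .
      finally show ?thesis unfolding an by (simp add: power2_eq_square)
    qed
    then show ?thesis using az by simp
  qed
  have UX: "U = X * u - int c * Y * w"
  proof -
    have "u * (int \<beta> * U * u + int c * V * w) - int c * w * (V * u - U * w) = (int \<beta> * u^2 + int c * w^2) * U"
      by (simp add: power2_eq_square algebra_simps)
    then have "int a ^ z * U = int a ^ z * (X * u - int c * Y * w)"
      unfolding X Y basew by (simp add: algebra_simps)
    then show ?thesis using az by simp
  qed
  have VX: "V = X * w + int \<beta> * Y * u"
  proof -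
    have "w * (int \<beta> * U * u + int c * V * w) + int \<beta> * u * (V * u - U * w) = (int \<beta> * u^2 + int c * w^2) * V"
      by (simp add: power2_eq_square algebra_simps)
    then have "int a ^ z * V = int a ^ z * (X * w + int \<beta> * Y * u)"
      unfolding X Y basew by (simp add: algebra_simps)
    then show ?thesis using az by simp
  qed
  show ?case
  proof (cases "n = z")
    case True
    have "Y = 0"
    proof (rule ccontr)
      assume "Y \<noteq> 0"
      then have "Y^2 \<ge> 1" by (simp add: int_one_le_iff_zero_less)
      moreover have "int \<beta> * int c \<ge> 2" using c \<beta> mult_mono[of 1 "int \<beta>" 2 "int c"] by simp
      ultimately have "int \<beta> * int c * Y^2 \<ge> 2 * 1" by (intro mult_mono) auto
      moreover have "X^2 + int \<beta> * int c * Y^2 = 1" using XY True by simp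
      ultimately show False using zero_le_power2[of X] by linarith
    qed
    then have "X^2 = 1" using XY True by simp
    then have "X \<in> {1,-1}" by (simp add: power2_eq_1_iff)
    moreover have "U = X * u" "V = X * \<tau>0 * v" using UX VX \<open>Y = 0\<close> by (simp_all add: w_def)
    ultimately show ?thesis using True t0 by (intro exI[of _ 1] exI[of _ X] exI[of _ "X * \<tau>0"]) auto
  next
    case False
    then have zn': "z < n" using zn by simp
    \<comment> \<open>(U1, V1) are the coordinates of the quotient times the conjugate divisor;
      \<open>a ^ e\<close> is the power of \<open>a\<close> that is certain to split off.\<close>
    define e where "e = min z (n - z)"
    define U1 where "U1 = X * u + int c * Y * w"
    define V1 where "V1 = int \<beta> * Y * u - X * w"
    have N1: "int \<beta> * U1^2 + int c * V1^2 = int a ^ n"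
    proof -
      have "int \<beta> * U1^2 + int c * V1^2 = (X^2 + int \<beta> * int c * Y^2) * (int \<beta> * u^2 + int c * w^2)"
        by (simp add: U1_def V1_def power2_eq_square algebra_simps)
      then show ?thesis unfolding XY basew using zn by (simp flip: power_add)
    qed
    have "int a ^ e dvd int \<beta> * (U * U1)"
    proof -
      have "int \<beta> * (U * U1) = X^2 * (int \<beta> * u^2 + int c * w^2) - int c * w^2 * (X^2 + int \<beta> * int c * Y^2)"
        unfolding UX U1_def by (simp add: power2_eq_square algebra_simps)
      also have "int a ^ e dvd \<dots>" unfolding XY basew
        by (intro dvd_diff dvd_mult le_imp_power_dvd) (auto simp: e_def)
      finally show ?thesis .
    qed
    moreover have "coprime (int a ^ e) U" using aU pa by (intro coprime_power_left_iff[THEN iffD2]) (auto intro: prime_imp_coprime)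
    ultimately have dU1: "int a ^ e dvd U1" using copb by (simp add: coprime_dvd_mult_right_iff)
    have e2: "2 * e \<le> n" by (simp add: e_def)
    then have "int a ^ e dvd V1" using dvd_square_norm[OF N1 dU1] by simp
    then obtain U' V' where U': "U1 = int a ^ e * U'" and V': "V1 = int a ^ e * V'" using dU1 by (elim dvdE)
    have N': "int \<beta> * U'^2 + int c * V'^2 = int a ^ (n - 2 * e)"
    proof -
      have "(int a ^ e)^2 * (int \<beta> * U'^2 + int c * V'^2) = (int a ^ e)^2 * int a ^ (n - 2 * e)"
      proof -
        have "int a ^ n = int a ^ (2 * e) * int a ^ (n - 2 * e)" using e2 by (metis le_add_diff_inverse power_add)
        then have an: "(int a ^ e)^2 * int a ^ (n - 2 * e) = int a ^ n" by (simp add: mult.commute flip: power_mult)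
        have "(int a ^ e)^2 * (int \<beta> * U'^2 + int c * V'^2) = int \<beta> * (int a ^ e * U')^2 + int c * (int a ^ e * V')^2"
          by (simp add: power_mult_distrib distrib_left)
        then show ?thesis using N1 unfolding U' V' an by simp
      qed
      then show ?thesis using az by simp
    qed
    have r': "int p dvd int \<beta> * U'" if p: "prime p" "p dvd b" for p
    proof (cases "int p dvd int \<beta>")
      case False
      have pp: "prime (int p)" using p by simp
      have "int p dvd u" "int p dvd U" using rad[OF p] rU[OF p] False pp by (auto simp: prime_dvd_mult_iff)
      then have "int p dvd 2 * X * u - U" by simp
      also have "2 * X * u - U = U1" by (simp add: UX U1_def)
      finally have "int p dvd int a ^ e * U'" by (simp add: U')
      moreover have "\<not> int p dvd int a ^ e" using p_ne_a[OF p] pp prime_dvd_power by blast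
      ultimately have "int p dvd U'" using prime_dvd_mult_iff[OF pp] by blast
      then show ?thesis by simp
    qed simp
    \<comment> \<open>Otherwise the reduced element would have norm exponent
      \<open>2 * z - n\<close>, which is smaller than \<open>z\<close>: either against minimality,
      or norm 1.\<close>
    have n2: "n > 2 * z"
    proof (rule ccontr)
      assume "\<not> n > 2 * z"
      then have e: "e = n - z" by (simp add: e_def)
      show False
      proof (cases "n - 2 * e = 0")
        case True then show False using norm_one_False[OF _ r'] N' by simp
      next
        case False then show False using min[OF _ N' r'] e zn' by simp
      qed
    qed
    then have ez: "e = z" by (simp add: e_def)
    have comp: "el \<beta> c U V = el \<beta> c U' V' * el \<beta> c u w ^ 2"
    proof -
      have "(int \<beta> * u^2 - int c * w^2) * U1 - int c * (2 * u * w) * V1 = (int \<beta> * u^2 + int c * w^2) * U"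
        unfolding UX U1_def V1_def by (simp add: power2_eq_square algebra_simps)
      then have "int a ^ z * U = int a ^ z * ((int \<beta> * u^2 - int c * w^2) * U' - int c * (2 * u * w) * V')"
        unfolding basew U' V' ez by (simp add: algebra_simps)
      then have 1: "U = (int \<beta> * u^2 - int c * w^2) * U' - int c * (2 * u * w) * V'" using az by simp
      have "(int \<beta> * u^2 - int c * w^2) * V1 + int \<beta> * (2 * u * w) * U1 = (int \<beta> * u^2 + int c * w^2) * V"
        unfolding VX U1_def V1_def by (simp add: power2_eq_square algebra_simps)
      then have "int a ^ z * V = int a ^ z * ((int \<beta> * u^2 - int c * w^2) * V' + int \<beta> * (2 * u * w) * U')"
        unfolding basew U' V' ez by (simp add: algebra_simps)
      then have 2: "V = (int \<beta> * u^2 - int c * w^2) * V' + int \<beta> * (2 * u * w) * U'" using az by simp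
      show ?thesis unfolding el_mult_square using 1 2 by simp
    qed
    have aU': "\<not> int a dvd U'"
    proof
      assume d: "int a dvd U'"
      then have "int a dvd int \<beta> * U'^2" by (simp add: power2_eq_square)
      moreover have "int a dvd int a ^ (n - 2 * e)" using n2 ez by (simp add: dvd_power)
      moreover have "int c * V'^2 = int a ^ (n - 2 * e) - int \<beta> * U'^2" using N' by linarith
      ultimately have "int a dvd int c * V'^2" by simp
      then have "int a dvd V'" using a_dvd_iff pa by (simp add: prime_dvd_power_iff)
      moreover have "U = (int \<beta> * u^2 - int c * w^2) * U' - int c * (2 * u * w) * V'"
        using comp unfolding el_mult_square using el_eq_iff[of \<beta> c] \<beta> c by simp
      ultimately show False using d aU by (metis dvd_diff dvd_mult)
    qed
    obtain t \<sigma> \<tau> where t: "odd t" "n - 2 * z = t * z" "\<sigma> \<in> {1,-1}" "\<tau> \<in> {1,-1}"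
      and elU': "el \<beta> c U' V' = el \<beta> c (\<sigma> * u) (\<tau> * v) ^ t"
      using less.IH[of "n - 2 * e" U' V', OF _ N' r' aU'] n2 z ez by auto
    define \<delta> where "\<delta> = el \<beta> c (\<sigma> * u) (\<sigma> * w)"
    have d2: "el \<beta> c u w ^ 2 = \<delta> ^ 2" using t(3) el_minus[of \<beta> c u w] by (auto simp: \<delta>_def) (metis power2_minus)
    show ?thesis
    proof (cases "\<tau> * v = \<sigma> * w")
      case True
      then have "el \<beta> c U V = el \<beta> c (\<sigma> * u) (\<tau> * v) ^ (t + 2)"
        using comp elU' d2 by (simp add: \<delta>_def power_add power2_eq_square)
      moreover have "n = (t + 2) * z" using t(2) n2 by (simp add: algebra_simps)
      ultimately show ?thesis using t by (intro exI[of _ "t + 2"] exI[of _ \<sigma>] exI[of _ \<tau>]) auto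
    next
      case False
      then have tw: "\<tau> * v = - (\<sigma> * w)" using t(3,4) t0 by (auto simp: w_def)
      have dd: "el \<beta> c (\<sigma> * u) (\<tau> * v) * \<delta> = of_int (int a ^ z)"
      proof -
        have "\<delta> * el \<beta> c (\<sigma> * u) (- (\<sigma> * w)) = of_int (int \<beta> * (\<sigma> * u)^2 + int c * (\<sigma> * w)^2)"
          unfolding \<delta>_def by (rule el_mult_cnj)
        also have "int \<beta> * (\<sigma> * u)^2 + int c * (\<sigma> * w)^2 = int a ^ z" using basew t(3) by auto
        finally show ?thesis unfolding tw by (simp only: mult.commute)
      qed
      have "\<exists>x y. el \<beta> c U V = of_int (int a ^ z) * el \<beta> c x y"
      proof (cases "t = 1")
        case True
        have "el \<beta> c U V = el \<beta> c (\<sigma> * u) (\<tau> * v) * \<delta> * \<delta>" using comp elU' d2 True by (simp add: power2_eq_square)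
        then show ?thesis unfolding dd unfolding \<delta>_def by blast
      next
        case False
        then obtain s where s: "t = s + 2" "odd s" using t(1) by (metis add_2_eq_Suc' even_Suc_Suc_iff odd_pos One_nat_def Suc_pred not0_implies_Suc even_zero)
        obtain x y where xy: "el \<beta> c (\<sigma> * u) (\<tau> * v) ^ s = el \<beta> c x y" using el_odd_power_ex[OF s(2)] by metis
        have "el \<beta> c U V = (el \<beta> c (\<sigma> * u) (\<tau> * v) * \<delta>) * (el \<beta> c (\<sigma> * u) (\<tau> * v) * \<delta>) * el \<beta> c x y"
          using comp elU' d2 by (simp add: s power_add xy[symmetric] power2_eq_square mult_ac)
        then have "el \<beta> c U V = of_int (int a ^ z) * el \<beta> c (int a ^ z * x) (int a ^ z * y)" unfolding dd el_scale[symmetric] by simp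
        then show ?thesis by blast
      qed
      then obtain x y where "el \<beta> c U V = el \<beta> c (int a ^ z * x) (int a ^ z * y)" unfolding el_scale by blast
      then have "U = int a ^ z * x" using el_eq_iff[of \<beta> c] \<beta> c by simp
      then have "int a dvd U" using z by (simp add: dvd_mult2)
      then show ?thesis using aU by simp
    qed
  qed
qed
end

section \<open>Solutions of equal parity\<close>

lemma el_power_norm:
  assumes "el \<beta> c u v ^ s = el \<beta> c U V"
  shows "(int \<beta> * u^2 + int c * v^2) ^ s = int \<beta> * U^2 + int c * V^2"
proof -
  have "(of_int (int \<beta> * u^2 + int c * v^2) :: complex) ^ s = of_int (int \<beta> * U^2 + int c * V^2)"
    unfolding el_mult_cnj[symmetric] el_cnj[symmetric] power_mult_distrib complex_cnj_power[symmetric] assms ..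
  then show ?thesis by (metis of_int_eq_iff of_int_power)
qed

lemma pw_norm: "w * fst (pw w c i) ^ 2 + c * snd (pw w c i) ^ 2 = (w + c) ^ (2 * i + 1)"
proof (induction i)
  case (Suc i)
  obtain A B where AB: "pw w c i = (A, B)" by fastforce
  have "(w + c) ^ (2 * Suc i + 1) = (w + c)^2 * (w + c) ^ (2 * i + 1)" by (simp add: power2_eq_square)
  also have "\<dots> = (w + c)^2 * (w * A^2 + c * B^2)" using Suc AB by simp
  finally show ?case by (simp add: AB power2_eq_square algebra_simps)
qed simp

lemma square_less_power_7: "p \<ge> 3 \<Longrightarrow> p^2 < (7::nat) ^ (p - 1)"
proof (induction p rule: dec_induct)
  case (step n)
  have "3 * n \<le> n * n" using step by simp
  moreover have "(Suc n)^2 = n * n + 2 * n + 1" by (simp add: power2_eq_square)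
  ultimately have "(Suc n)^2 \<le> 7 * n^2" using step(1) unfolding power2_eq_square by linarith
  also have "\<dots> < 7 * 7 ^ (n - 1)" using step by simp
  also have "\<dots> = 7 ^ (Suc n - 1)" using step by (cases n) auto
  finally show ?case .
qed simp

text \<open>The first coordinate is \<open>U = u * A\<close>. A prime of \<open>A\<close> divides
  \<open>U\<close>, hence \<open>b\<close>, hence \<open>w\<close>; as \<open>A\<close> is
  \<open>p * (- c) ^ i\<close> modulo \<open>w\<close>, that prime is \<open>p\<close>. For
  \<open>p \<noteq> 3\<close> the next term of the expansion excludes \<open>p ^ 2\<close>, so
  \<open>\<bar>A\<bar> \<le> p\<close>. But \<open>w * A^2 + c = (w + c) ^ p\<close> with
  \<open>w + c \<ge> 7\<close> makes \<open>A\<close> larger than that.\<close>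

lemma prime_odd_power_small:
  fixes a b c \<beta> p :: nat and u v U s :: int
  assumes bc: "coprime b c" and c: "c > 0" and ge: "int \<beta> * u^2 + int c \<ge> 7"
    and rad: "\<And>l. prime l \<Longrightarrow> l dvd b \<Longrightarrow> int l dvd int \<beta> * u"
    and p: "prime p" "odd p" and el: "el \<beta> c U s = el \<beta> c u v ^ p" and \<beta>: "\<beta> > 0"
    and v: "v \<in> {1, -1}" and s: "s \<in> {1, -1}"
    and U: "\<And>l. prime l \<Longrightarrow> int l dvd U \<Longrightarrow> l dvd b"
  defines "w \<equiv> int \<beta> * u^2"
  shows "p = 3 \<and> U = u * (w - 3 * int c) \<and> 3 * w - int c \<in> {1, -1} \<and> \<bar>w - 3 * int c\<bar> > 3 \<and>
     (\<forall>l. prime l \<longrightarrow> int l dvd w - 3 * int c \<longrightarrow> l = 3)"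
proof -
  obtain i where i: "p = 2 * i + 1" using p by (elim oddE)
  have "i > 0" using i p by (cases i) auto
  then obtain m where m: "i = Suc m" using gr0_implies_Suc by blast
  have v2: "v^2 = 1" and s2: "s^2 = 1" using v s by auto
  obtain A B where AB: "pw w (int c) i = (A, B)" by fastforce
  have "el \<beta> c U s = el \<beta> c (u * A) (v * B)"
    using el el_odd_power[of \<beta> c u v i] AB by (simp add: i v2 w_def)
  then have UA: "U = u * A" and sB: "s = v * B" using el_eq_iff \<beta> c by blast+
  have B: "B \<in> {1,-1}" using sB v s by auto
  then have B2: "B^2 = 1" by auto
  have norm: "w * A^2 + int c = (w + int c) ^ p" using pw_norm[of w "int c" i] by (simp add: AB B2 i)
  have w0: "w \<ge> 0" by (simp add: w_def)
  have wc: "w + int c \<ge> 7" using ge by (simp add: w_def)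
  have p3: "p \<ge> 3" using i m by simp
  have small: False if "\<bar>A\<bar> \<le> int p"
  proof -
    have A2: "A^2 \<le> (int p)^2" using that by (simp add: abs_le_square_iff[symmetric])
    have "(w + int c) * (w + int c) ^ (p - 1) = w * A^2 + int c" unfolding norm using p3 by (cases p) auto
    also have "\<dots> \<le> w * (int p)^2 + int c * (int p)^2"
      using A2 w0 p3 mult_left_mono[of 1 "(int p)^2" "int c"] by (intro add_mono mult_left_mono) (auto simp: self_le_power)
    also have "\<dots> = (w + int c) * (int p)^2" by (simp add: algebra_simps)
    finally have "(w + int c) ^ (p - 1) \<le> (int p)^2" using wc by simp
    moreover have "(7::int) ^ (p - 1) \<le> (w + int c) ^ (p - 1)" using wc by (intro power_mono) auto
    moreover have "(int p)^2 < 7 ^ (p - 1)" using square_less_power_7[OF p3] by (metis of_nat_less_iff of_nat_numeral of_nat_power)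
    ultimately show False by linarith
  qed
  have A0: "A \<noteq> 0" using small by auto
  have lw: "int l dvd w" "l dvd b" if l: "prime l" "int l dvd A" for l
  proof -
    have "int l dvd U" using UA l by simp
    then show "l dvd b" by (rule U[OF l(1)])
    then have "int l dvd int \<beta> * u" using rad l by blast
    then have "int l dvd (int \<beta> * u) * u" by simp
    then show "int l dvd w" by (simp add: w_def power2_eq_square mult.assoc)
  qed
  have lc: "\<not> int l dvd (- int c) ^ n" if l: "prime l" "l dvd b" for l n
  proof
    assume "int l dvd (- int c) ^ n"
    moreover have "prime (int l)" using l(1) by simp
    ultimately have "int l dvd - int c" using prime_dvd_power by blast
    then have "l dvd c" by (simp only: dvd_minus_iff int_dvd_int_iff)
    then show False using l bc by (metis coprime_common_divisor not_prime_unit)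
  qed
  have only: "l = p" if l: "prime l" "int l dvd A" for l
  proof -
    obtain x y where "pw w (int c) i = ((2 * int i + 1) * (- int c) ^ i + w * x, (- int c) ^ i + w * y)" using pw_cong by blast
    then have "A = int p * (- int c) ^ i + w * x" using AB i by simp
    then have "int l dvd int p * (- int c) ^ i" using l lw[OF l] by (metis dvd_add_left_iff dvd_mult2)
    then have "int l dvd int p" using lc[OF l(1) lw(2)[OF l]] l(1) by (simp add: prime_dvd_mult_iff)
    then show ?thesis using l(1) p(1) primes_dvd_imp_eq by auto
  qed
  have "p = 3"
  proof (rule ccontr)
    assume pn3: "p \<noteq> 3"
    have "\<not> (int p)^2 dvd A"
    proof
      assume sq: "(int p)^2 dvd A"
      then have pA: "int p dvd A" by (metis dvd_mult_left power2_eq_square)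
      obtain S x y where S: "3 * S = (int m + 1) * (2 * int m + 1) * (2 * int m + 3)"
        and pp: "pw w (int c) (Suc m) = ((2 * int m + 3) * (- int c) ^ Suc m + w * S * (- int c) ^ m + w^2 * x,
          (- int c) ^ Suc m + w * ((int m + 1) * (2 * int m + 3)) * (- int c) ^ m + w^2 * y)"
        using pw_cong_square by blast
      have ip: "int p = 2 * int m + 3" using i m by simp
      have A: "A = int p * (- int c) ^ Suc m + w * S * (- int c) ^ m + w^2 * x" using pp AB m ip by simp
      \<comment> \<open>\<open>S\<close> is the binomial coefficient C(p,3), divisible by
        \<open>p\<close> unless \<open>p = 3\<close>; this is why the cube escapes the
        argument.\<close>
      have "int p dvd 3 * S" unfolding S ip by simp
      moreover have "\<not> int p dvd 3"
      proof
        assume "int p dvd 3"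
        then have "p dvd 3" by (metis int_dvd_int_iff of_nat_numeral)
        then show False using pn3 p(1) primes_dvd_imp_eq[of p 3] by simp
      qed
      ultimately have "int p dvd S" using p(1) by (simp add: prime_dvd_mult_iff)
      then have 1: "(int p)^2 dvd w * S * (- int c) ^ m" using lw(1)[OF p(1) pA] by (simp add: power2_eq_square mult_dvd_mono)
      have "(int p)^2 dvd w^2 * x" using lw(1)[OF p(1) pA] by simp
      moreover have "int p * (- int c) ^ Suc m = A - w * S * (- int c) ^ m - w^2 * x" using A by linarith
      ultimately have "(int p)^2 dvd int p * (- int c) ^ Suc m" using sq 1 by (metis dvd_diff)
      then have "int p dvd (- int c) ^ Suc m" using p3 by (simp add: power2_eq_square)
      then show False using lc[OF p(1) lw(2)[OF p(1) pA]] by blast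
    qed
    then show False using only_prime_factor_square_free[OF p(1) A0 only] small by blast
  qed
  then have "i = 1" using i by simp
  then have AB': "A = w - 3 * int c" "B = 3 * w - int c" using AB by (auto simp: algebra_simps)
  show ?thesis using \<open>p = 3\<close> UA B small only unfolding AB' by force
qed

text \<open>Put \<open>c = 3 * w - d\<close> with d = 1 or -1. The only prime of
  \<open>8 * w - 3 * d\<close> is 3, so it is a power \<open>3 ^ e\<close>; residues modulo 8 give
  \<open>d = -1\<close>. Then 3 divides \<open>w\<close> exactly once, so \<beta> is
  \<open>b = 3 * b0\<close>, and comparison of the powers of 3 gives \<open>e = m\<close>. What
  remains is 8 b0^(2m+1) + 1 = 3^(m-1), possible only for \<open>b0 = 1\<close>,
  \<open>m = 3\<close>.\<close>

lemma cube_case: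
  fixes b c \<beta> m :: nat and u U w :: int
  assumes w: "w = int \<beta> * u^2" and \<beta>: "\<beta> = 1 \<or> \<beta> = b" and ge: "w + int c \<ge> 7" and b: "b > 1"
    and U: "U = u * (w - 3 * int c)" "\<bar>U\<bar> = int b ^ m"
    and B: "3 * w - int c \<in> {1, -1}" and A3: "\<bar>w - 3 * int c\<bar> > 3"
    and only: "\<And>l. prime l \<Longrightarrow> int l dvd w - 3 * int c \<Longrightarrow> l = 3"
  shows "\<beta> = b \<and> b = 3 \<and> c = 10 \<and> m = 3 \<and> w = 3"
proof -
  obtain d :: int where d: "d \<in> {1,-1}" "int c = 3 * w - d" using B by (metis diff_diff_eq2 add_diff_cancel_left' diff_add_cancel)
  have w2: "w \<ge> 2" using ge d by auto
  have Ad: "\<bar>w - 3 * int c\<bar> = 8 * w - 3 * d" using d w2 by auto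
  define n where "n = nat (8 * w - 3 * d)"
  have n: "int n = 8 * w - 3 * d" using w2 d by (auto simp: n_def)
  then have n3: "n > 3" using A3 Ad by simp
  have onln: "l = 3" if "prime l" "l dvd n" for l
    using only[of l] that n Ad by (metis dvd_abs_iff int_dvd_int_iff)
  obtain e where e: "n = 3 ^ e"
  proof -
    obtain m where km: "n = 3 ^ multiplicity 3 n * m" "\<not> 3 dvd m"
      by (rule multiplicity_decompose'[of n 3]) (use n3 in auto)
    have "m = 1"
    proof (rule ccontr)
      assume "m \<noteq> 1"
      then obtain l where "prime l" "l dvd m" using prime_factor_nat by blast
      then show False using onln[of l] km by (metis dvd_mult)
    qed
    then show ?thesis using that km(1) by simp
  qed
  have e2: "e \<ge> 2"
  proof (rule ccontr)
    assume "\<not> e \<ge> 2"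
    then have "e = 0 \<or> e = 1" by auto
    then show False using n3 e by auto
  qed
  define f where "f = e - 2"
  have ef: "e = f + 2" using e2 by (simp add: f_def)
  have eq: "8 * w - 3 * d = 9 * 3 ^ f" using n e ef by (simp add: power_add)
  then have "3 dvd 8 * w" by presburger
  then have "3 dvd w" by presburger
  then obtain w1 where w1: "w = 3 * w1" by blast
  have eq1: "8 * w1 - d = 3 * 3 ^ f" using eq w1 by simp
  \<comment> \<open>With \<open>d = 1\<close> the number \<open>3 * 3 ^ f + 1\<close> would be
    divisible by 8, but it is 4 or 2 modulo 8.\<close>
  have m8: "(3::int) ^ f mod 8 \<in> {1, 3}"
  proof (induction f)
    case (Suc f)
    have "(3::int) ^ Suc f mod 8 = 3 * (3 ^ f mod 8) mod 8" by (simp add: mod_mult_right_eq)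
    then show ?case using Suc by auto
  qed simp
  have dm: "d = -1"
  proof (rule ccontr)
    assume "d \<noteq> -1"
    then have "8 * w1 = 3 * 3 ^ f + 1" using d eq1 by auto
    then show False using m8 by auto presburger+
  qed
  have w13: "\<not> 3 dvd w1"
  proof
    assume "3 dvd w1"
    then have "3 dvd 8 * w1 - 3 * 3 ^ f" by simp
    moreover have "8 * w1 - 3 * 3 ^ f = -1" using eq1 dm by simp
    ultimately show False by simp
  qed
  have p3: "prime (3::int)" by simp
  have nu: "\<not> 3 dvd u"
  proof
    assume "3 dvd u"
    then obtain u' where "u = 3 * u'" by blast
    then have "w1 = 3 * (int \<beta> * u'^2)" using w w1 by (simp add: power2_eq_square)
    then show False using w13 by simp
  qed
  have "3 dvd int \<beta> * u^2" by (metis dvd_triv_left w w1)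
  then have b3: "3 dvd int \<beta>" using nu p3 by (simp add: prime_dvd_mult_iff prime_dvd_power_iff)
  then have \<beta>b: "\<beta> = b" using \<beta> by auto
  then obtain b0 where b0: "b = 3 * b0" using b3 by (metis dvdE int_dvd_int_iff of_nat_numeral)
  have w1b: "w1 = int b0 * u^2" using w w1 \<beta>b b0 by simp
  have b03: "\<not> 3 dvd b0"
  proof
    assume "3 dvd b0"
    then have "3 dvd int b0" by (metis int_dvd_int_iff of_nat_numeral)
    then show False using w13 w1b by simp
  qed
  have "\<bar>u\<bar> * int n = int b ^ m" using U Ad n by (simp add: abs_mult)
  then have "int (nat \<bar>u\<bar> * 3 ^ e) = int (3 ^ m * b0 ^ m)" by (simp add: e b0 power_mult_distrib)
  then have ub: "nat \<bar>u\<bar> * 3 ^ e = 3 ^ m * b0 ^ m" by (simp only: of_nat_eq_iff)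
  have nu': "\<not> 3 dvd nat \<bar>u\<bar>" using nu by (simp add: nat_abs_dvd_iff flip: int_dvd_int_iff)
  have nb': "\<not> 3 dvd b0 ^ m" using b03 prime_dvd_power[of "3::nat"] by auto
  have "e = m"
  proof (rule ccontr)
    assume "e \<noteq> m"
    then consider "e < m" | "m < e" by linarith
    then show False
    proof cases
      case 1
      then have "(3::nat) ^ m = 3 ^ e * 3 ^ (m - e)" by (simp flip: power_add)
      then have "nat \<bar>u\<bar> = 3 ^ (m - e) * b0 ^ m" using ub by simp
      then show False using nu' 1 by (metis dvd_mult2 dvd_power zero_less_diff)
    next
      case 2
      then have "(3::nat) ^ e = 3 ^ m * 3 ^ (e - m)" by (simp flip: power_add)
      then have "nat \<bar>u\<bar> * 3 ^ (e - m) = b0 ^ m" using ub by simp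
      then show False using nb' 2 by (metis dvd_mult dvd_power zero_less_diff)
    qed
  qed
  then have "nat \<bar>u\<bar> = b0 ^ m" using ub by simp
  then have au: "\<bar>u\<bar> = int b0 ^ m" by (metis abs_ge_zero int_nat_eq of_nat_power)
  have "w1 = int b0 * (int b0 ^ m)^2" using w1b au by (metis power2_abs)
  then have eqb: "8 * (int b0 * (int b0 ^ m)^2) + 1 = 3 * 3 ^ f" using eq1 dm by simp
  have "b0 = 1"
  proof (rule ccontr)
    assume "b0 \<noteq> 1"
    then have b02: "int b0 \<ge> 2" using b b0 by (cases "b0 = 0") auto
    have "(3::int) ^ m \<le> 4 ^ m" by (intro power_mono) auto
    also have "\<dots> = (2 ^ m)^2" by (simp add: power2_eq_square flip: power_mult_distrib)
    also have "\<dots> \<le> (int b0 ^ m)^2" using b02 by (intro power_mono) auto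
    also have "\<dots> \<le> int b0 * (int b0 ^ m)^2" using mult_right_mono[of 1 "int b0" "(int b0 ^ m)^2"] b02 by simp
    finally have "(3::int) ^ m \<le> int b0 * (int b0 ^ m)^2" .
    moreover have "(0::int) < 3 ^ m" by simp
    ultimately have "(3::int) ^ m < 8 * (int b0 * (int b0 ^ m)^2) + 1" by linarith
    moreover have "(3::int) ^ m = 9 * 3 ^ f" unfolding \<open>e = m\<close>[symmetric] ef by (simp add: power_add)
    moreover have "(0::int) < 3 ^ f" by simp
    ultimately show False using eqb by linarith
  qed
  then have "3 ^ Suc f = (3::int) ^ 2" using eqb by simp
  then have "Suc f = 2" by (rule power_inject_exp[THEN iffD1, rotated]) simp
  then have "f = 1" by simp
  then have "m = 3" using \<open>e = m\<close> ef by simp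
  have "b = 3" using b0 \<open>b0 = 1\<close> by simp
  have "w1 = 1" using \<open>w1 = int b0 * (int b0 ^ m)^2\<close> \<open>b0 = 1\<close> by simp
  then show ?thesis using \<beta>b \<open>b = 3\<close> \<open>m = 3\<close> w1 d dm by auto
qed

lemma same_parity:
  fixes a b c x1 x2 y1 y2 :: nat
  assumes a: "prime a" "a \<ge> 7" "[a = 1] (mod 3)" and b: "b > 1" and c: "c > 0"
    and cop: "coprime a b" "coprime a c" "coprime b c"
    and e1: "b ^ y1 + c = a ^ x1" and e2: "b ^ y2 + c = a ^ x2"
    and x: "0 < x1" "x1 < x2" and y: "0 < y1" "y1 < y2" and par: "even (y1 + y2)"
  shows "a = 13 \<and> b = 3 \<and> c = 10 \<and> x1 = 1 \<and> y1 = 1 \<and> x2 = 3 \<and> y2 = 7"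
proof (cases "c = 1")
  case True
  then show ?thesis using no_solution_c1[of a x1 b y1 x2 y2, OF a(3) _ _ _ x y] e1 e2 a(2) by simp
next
  case False
  then have c1: "c > 1" and c0: "c > 0" using c by simp_all
  have a7: "int a \<ge> 7" using a by simp
  \<comment> \<open>\<beta> absorbs the common parity: for both exponents, \<open>b ^ y\<close> is
    \<beta> times the square of \<open>b ^ (y div 2)\<close>.\<close>
  define \<beta> where "\<beta> = (if even y2 then 1 else b)"
  define P where "P n u v \<longleftrightarrow> n > 0 \<and> int \<beta> * u^2 + int c * v^2 = int a ^ n \<and>
    (\<forall>p. prime p \<longrightarrow> p dvd b \<longrightarrow> int p dvd int \<beta> * u)" for n u v
  have \<beta>0: "\<beta> > 0" using b by (simp add: \<beta>_def)
  have sq: "\<beta> * (b ^ (y div 2))^2 = b ^ y" if "even y = even y2" for y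
  proof (cases "even y")
    case True
    then show ?thesis using that by (simp add: \<beta>_def flip: power_mult)
  next
    case False
    then have "b ^ y = b ^ (2 * (y div 2) + 1)" by simp
    also have "\<dots> = b * (b ^ (y div 2))^2" by (simp add: power_add power_even_eq)
    finally show ?thesis using that False by (simp add: \<beta>_def)
  qed
  have P: "P x' (int b ^ (y' div 2)) 1" if "even y' = even y2" "b ^ y' + c = a ^ x'" "x' > 0" "y' > 0" for x' y'
  proof -
    have "int (\<beta> * (b ^ (y' div 2))^2 + c) = int a ^ x'" using sq[OF that(1)] that(2) by (metis of_nat_power)
    then have 1: "int \<beta> * (int b ^ (y' div 2))^2 + int c * 1^2 = int a ^ x'" by simp
    have "int p dvd int \<beta> * int b ^ (y' div 2)" if "p dvd b" for p
    proof (cases "even y2")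
      case True
      then have "y' div 2 > 0" using \<open>even y' = even y2\<close> \<open>y' > 0\<close> by presburger
      then have "int p dvd int b ^ (y' div 2)" using that by (metis dvd_power dvd_trans int_dvd_int_iff)
      then show ?thesis by simp
    next
      case False
      then show ?thesis using that by (simp add: \<beta>_def)
    qed
    then show ?thesis using 1 \<open>x' > 0\<close> by (simp add: P_def)
  qed
  have ev: "even y1 = even y2" using par by simp
  have P1: "P x1 (int b ^ (y1 div 2)) 1" using P[OF ev e1] x y by simp
  have P2: "P x2 (int b ^ (y2 div 2)) 1" using P[OF _ e2] x y by simp
  define z where "z = (LEAST n. \<exists>u v. P n u v)"
  have "\<exists>u v. P z u v" unfolding z_def by (rule LeastI_ex) (use P1 in blast)
  then obtain u v where uv: "P z u v" by blast
  have zmin: "z \<le> n" if "P n u v" for n u v unfolding z_def by (rule Least_le) (use that in blast)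
  have na: "\<not> a dvd b" "\<not> a dvd c" using a(1) cop by (metis coprime_common_divisor dvd_refl not_prime_unit)+
  have na1: "\<not> a dvd 1" using a(2) by auto
  interpret norm_form a b c \<beta> z u v
    using a cop b c1 \<beta>0 uv zmin na na1 by unfold_locales (auto simp: P_def \<beta>_def)
  have nab: "\<not> int a dvd int b ^ n" for n
    using pa na(1) prime_dvd_power[of "int a" "int b"] by auto
  obtain t1 where t1: "odd t1" "x1 = t1 * z"
    using odd_power_structure[of "int b ^ (y1 div 2)" 1 x1] P1 nab unfolding P_def by blast
  obtain t2 \<sigma> \<tau> where t2: "odd t2" "x2 = t2 * z" and st: "\<sigma> \<in> {1,-1}" "\<tau> \<in> {1,-1}"
    and el: "el \<beta> c (int b ^ (y2 div 2)) 1 = el \<beta> c (\<sigma> * u) (\<tau> * v) ^ t2"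
    using odd_power_structure[of "int b ^ (y2 div 2)" 1 x2] P2 nab unfolding P_def by blast
  have "t1 < t2" using x t1 t2 by simp
  moreover have "t1 > 0" using t1(1) by (rule odd_pos)
  ultimately have "t2 \<noteq> 1" by simp
  \<comment> \<open>Splitting off one prime \<open>p\<close> of \<open>t2\<close> suffices: the
    coordinate \<open>v1\<close> of the power with exponent \<open>s\<close> divides the second
    coordinate 1 of its \<open>p\<close>-th power, so it is a unit.\<close>
  then obtain p where p: "prime p" "p dvd t2" using prime_factor_nat by blast
  then obtain s where s: "t2 = p * s" by blast
  have odd: "odd p" "odd s" using t2(1) s by auto
  obtain u1 v1 where u1: "el \<beta> c (\<sigma> * u) (\<tau> * v) ^ s = el \<beta> c u1 v1" "\<sigma> * u dvd u1"
    using el_odd_power_ex[OF odd(2)] by metis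
  have elp: "el \<beta> c (int b ^ (y2 div 2)) 1 = el \<beta> c u1 v1 ^ p"
    unfolding el u1(1)[symmetric] s by (simp add: mult.commute flip: power_mult)
  obtain U1 V1 where "el \<beta> c u1 v1 ^ p = el \<beta> c U1 V1" "v1 dvd V1"
    using el_odd_power_ex[OF odd(1)] by metis
  then have "v1 dvd 1" using elp el_eq_iff[OF \<beta>0 c0] by metis
  then have v1: "v1 \<in> {1, -1}" by (metis insertCI zdvd1_eq abs_eq_iff abs_one)
  then have v12: "v1^2 = 1" by auto
  have st2: "(\<sigma> * u)^2 = u^2" "(\<tau> * v)^2 = v^2" using st by auto
  have norm: "int a ^ (z * s) = int \<beta> * u1^2 + int c"
    using el_power_norm[OF u1(1)] base v12 st2 by (simp add: power_mult)
  have zs: "z * s > 0" using z odd(2) by (simp add: odd_pos)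
  have "int a ^ 1 \<le> int a ^ (z * s)" by (rule power_increasing) (use zs a in auto)
  then have ge: "int \<beta> * u1^2 + int c \<ge> 7" using norm a7 by simp
  have radu: "int l dvd int \<beta> * u1" if "prime l" "l dvd b" for l
  proof -
    have "u dvd u1" using u1(2) by (rule dvd_mult_right)
    then show ?thesis using rad[OF that] by (meson dvd_trans mult_dvd_mono dvd_refl)
  qed
  have Ub: "l dvd b" if "prime l" "int l dvd int b ^ (y2 div 2)" for l
    using that by (metis int_dvd_int_iff of_nat_power prime_dvd_power)
  note A = prime_odd_power_small[OF cop(3) c0 ge radu p(1) odd(1) elp \<beta>0 v1 _ Ub, simplified]
  define w where "w = int \<beta> * u1^2"
  have A: "p = 3" "int b ^ (y2 div 2) = u1 * (w - 3 * int c)" "3 * w - int c \<in> {1,-1}" "\<bar>w - 3 * int c\<bar> > 3"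
     "\<And>l. prime l \<Longrightarrow> int l dvd w - 3 * int c \<Longrightarrow> l = 3"
    using A unfolding w_def by auto
  have ab: "\<bar>int b ^ (y2 div 2)\<bar> = int b ^ (y2 div 2)" by simp
  have cc: "\<beta> = b \<and> b = 3 \<and> c = 10 \<and> y2 div 2 = 3 \<and> w = 3"
    by (rule cube_case[OF w_def _ _ b A(2) ab A(3,4,5)]) (use ge in \<open>auto simp: \<beta>_def w_def\<close>)
  then have "odd y2" using \<beta>_def by (auto split: if_splits)
  then have y2: "y2 = 7" using cc by presburger
  have "int a ^ (z * s) = w + int c" using norm w_def by simp
  then have "int (a ^ (z * s)) = int 13" using cc by simp
  then have azs: "a ^ (z * s) = 13" by (simp only: of_nat_eq_iff)
  then have "a dvd 13" using zs by (metis dvd_power)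
  then have a13: "a = 13" using primes_dvd_imp_eq[of a 13] a(1) by simp
  then have "13 ^ (z * s) = (13::nat) ^ 1" using azs by simp
  then have "z * s = 1" by (metis power_inject_exp one_less_numeral_iff semiring_norm(77))
  then have "z = 1" "s = 1" by auto
  then have x2: "x2 = 3" using t2 s A(1) by simp
  have "t1 = 1" using \<open>t1 < t2\<close> t1(1) t2(2) x2 \<open>z = 1\<close> by (cases "t1 = 2") (auto simp: less_Suc_eq numeral_3_eq_3)
  then have x1: "x1 = 1" using t1 \<open>z = 1\<close> by simp
  have "(3::nat) ^ y1 = 3 ^ 1" using e1 cc a13 x1 by simp
  then have "y1 = 1" by (metis power_inject_exp one_less_numeral_iff semiring_norm(77))
  then show ?thesis using a13 cc x1 x2 y2 by simp
qed

section \<open>Truncated binomial expansions modulo powers of a\<close>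

lemma power_gt_add: "v \<ge> 1 \<Longrightarrow> (a::nat) \<ge> 2 \<Longrightarrow> v + a \<le> a ^ v + 1"
proof (induction v rule: dec_induct)
  case (step v)
  have "2 * a ^ v \<le> a ^ Suc v" using step by simp
  moreover have "a ^ v \<ge> 2" using step self_le_power[of a v] by simp
  ultimately show ?case using step by linarith
qed simp

text \<open>Let \<open>v\<close> be the exponent of \<open>a\<close> in an index
  \<open>i > m\<close>. Then C(N,i) loses at most \<open>v\<close> of the \<open>j\<close> factors
  \<open>a\<close> of \<open>N\<close>, while \<open>z ^ i\<close> supplies \<open>k * i\<close> of
  them. Because \<open>m + 2 \<le> a\<close>, one has \<open>v + m + 1 \<le> i\<close>, so the loss
  is covered.\<close>

lemma binomial_congruence:
  fixes a j k m N :: nat and z :: int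
  assumes a: "prime a" and z: "int a ^ k dvd z" and N: "a ^ j dvd N" and m: "m + 2 \<le> a" and k: "k \<ge> 1"
  shows "int a ^ ((m + 1) * k + j) dvd (1 + z) ^ N - (\<Sum>i\<le>m. int (N choose i) * z ^ i)"
proof -
  have tm: "int a ^ ((m + 1) * k + j) dvd int (N choose i) * z ^ i" if i: "i > m" for i
  proof -
    obtain i' where i': "i = a ^ multiplicity a i * i'" "\<not> a dvd i'"
      by (rule multiplicity_decompose'[of i a]) (use i a in auto)
    define v where "v = multiplicity a i"
    have iv: "i = a ^ v * i'" using i' by (simp add: v_def)
    obtain i0 where i0: "i = Suc i0" using i by (cases i) auto
    have "(N choose i) * a ^ v * i' = N * ((N - 1) choose i0)"
    proof -
      have "(N choose i) * i = N * ((N - 1) choose i0)"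
        using binomial_absorption[of i0 N] i0 by (simp only: mult.commute)
      then show ?thesis using iv by (metis mult.assoc)
    qed
    then have "a ^ j dvd ((N choose i) * a ^ v) * i'" using N by simp
    moreover have "coprime (a ^ j) i'" using i'(2) a by (simp add: prime_imp_coprime)
    ultimately have d: "a ^ j dvd (N choose i) * a ^ v" by (simp add: coprime_dvd_mult_left_iff)
    have "v + (m + 1) \<le> i"  if "v \<ge> 1"
    proof -
      have "i' > 0" using iv i by (cases i') auto
      then have "a ^ v \<le> i" using iv by simp
      moreover have "v + a \<le> a ^ v + 1" using power_gt_add[of v a] a prime_ge_2_nat that by blast
      ultimately show ?thesis using m by linarith
    qed
    then have "v + (m + 1) \<le> i" using i by (cases "v = 0") auto
    then have "(v + (m + 1)) * k \<le> i * k" by (rule mult_right_mono) simp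
    moreover have "v * 1 \<le> v * k" using k by (intro mult_left_mono) auto
    moreover have "(v + (m + 1)) * k = v * k + (m + 1) * k" by (rule distrib_right)
    ultimately have le: "v + (m + 1) * k \<le> k * i" using mult.commute[of i k] by linarith
    obtain w where w: "z = int a ^ k * w" using z by blast
    have "z ^ i = int a ^ (k * i) * w ^ i" by (simp add: w power_mult_distrib power_mult)
    also have "k * i = v + ((m + 1) * k + (k * i - v - (m + 1) * k))" using le by simp
    finally have "int (N choose i) * z ^ i =
       int ((N choose i) * a ^ v) * int a ^ ((m + 1) * k) * (int a ^ (k * i - v - (m + 1) * k) * w ^ i)"
      by (simp add: power_add)
    moreover obtain e where "int ((N choose i) * a ^ v) = int (a ^ j) * e"
      using d by (metis dvdE int_dvd_int_iff)
    ultimately have "int (N choose i) * z ^ i = (int a ^ ((m + 1) * k) * int a ^ j) * (e * (int a ^ (k * i - v - (m + 1) * k) * w ^ i))"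
      by (simp only: of_nat_power mult_ac)
    then show ?thesis unfolding power_add[of _ "(m + 1) * k" j] by (rule dvdI)
  qed
  have "(1 + z) ^ N = (\<Sum>i\<le>N. int (N choose i) * z ^ i)"
    using binomial_ring[of z 1 N] by (simp add: add.commute)
  also have "\<dots> = (\<Sum>i\<le>max N m. int (N choose i) * z ^ i)"
    by (rule sum.mono_neutral_left) auto
  also have "{..max N m} = {..m} \<union> {m<..max N m}" by auto
  also have "(\<Sum>i\<in>\<dots>. int (N choose i) * z ^ i) = (\<Sum>i\<le>m. int (N choose i) * z ^ i) + (\<Sum>i\<in>{m<..max N m}. int (N choose i) * z ^ i)"
    by (rule sum.union_disjoint) auto
  finally have "(1 + z) ^ N - (\<Sum>i\<le>m. int (N choose i) * z ^ i) = (\<Sum>i\<in>{m<..max N m}. int (N choose i) * z ^ i)" by simp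
  then show ?thesis by (simp only:) (intro dvd_sum tm, simp)
qed

lemma choose_Suc_int: "int (Suc i) * int (N choose Suc i) = (int N - int i) * int (N choose i)"
proof (cases "i \<le> N")
  case True
  have "Suc i * (N choose Suc i) = (N - i) * (N choose i)"
    by (metis binomial_absorb_comp binomial_absorption)
  then have "int (Suc i * (N choose Suc i)) = int ((N - i) * (N choose i))" by (simp only:)
  then show ?thesis using True by (simp only: of_nat_mult of_nat_diff)
qed (simp add: binomial_eq_0)

text \<open>Factorials are cleared to stay in the integers. The nested form exhibits the factor
  \<open>M * z\<close>, which contains the power of \<open>a\<close> that is cancelled later, and is
  quick to evaluate.\<close>

lemma binomial_sums:
  fixes z :: int and N :: nat
  defines "M \<equiv> int N"
  shows "(\<Sum>i\<le>1. int (N choose i) * z ^ i) = 1 + M * z"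
    and "2 * (\<Sum>i\<le>2. int (N choose i) * z ^ i) = 2 + M * z * (2 + (M - 1) * z)"
    and "120 * (\<Sum>i\<le>5. int (N choose i) * z ^ i) = 120 + M * z * (120 + (M - 1) * z * (60 + (M - 2) * z * (20 + (M - 3) * z * (5 + (M - 4) * z))))"
proof -
  have c1: "int (N choose 1) = M" by (simp add: M_def)
  have c2: "2 * int (N choose 2) = (M - 1) * M"
    using choose_Suc_int[of 1 N] c1 by (simp add: M_def numeral_2_eq_2)
  have c3: "3 * int (N choose 3) = (M - 2) * int (N choose 2)"
    using choose_Suc_int[of 2 N] by (simp add: M_def eval_nat_numeral)
  have c4: "4 * int (N choose 4) = (M - 3) * int (N choose 3)"
    using choose_Suc_int[of 3 N] by (simp add: M_def eval_nat_numeral)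
  have c5: "5 * int (N choose 5) = (M - 4) * int (N choose 4)"
    using choose_Suc_int[of 4 N] by (simp add: M_def eval_nat_numeral)
  have s: "(\<Sum>i\<le>5. int (N choose i) * z ^ i) = 1 + M * z + int (N choose 2) * z^2 + int (N choose 3) * z^3 + int (N choose 4) * z^4 + int (N choose 5) * z^5"
    using c1 by (simp add: eval_nat_numeral algebra_simps)
  have s2: "(\<Sum>i\<le>2. int (N choose i) * z ^ i) = 1 + M * z + int (N choose 2) * z^2"
    using c1 by (simp add: eval_nat_numeral algebra_simps)
  show "(\<Sum>i\<le>1. int (N choose i) * z ^ i) = 1 + M * z" using c1 by simp
  have "2 * (1 + M * z + int (N choose 2) * z^2) = 2 + 2 * M * z + (2 * int (N choose 2)) * z^2" by (simp add: algebra_simps)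
  then show "2 * (\<Sum>i\<le>2. int (N choose i) * z ^ i) = 2 + M * z * (2 + (M - 1) * z)"
    unfolding s2 c2 by (simp add: algebra_simps power2_eq_square)
  have d3: "6 * int (N choose 3) = (M - 2) * ((M - 1) * M)" using c3 c2[symmetric] by simp
  have d4: "24 * int (N choose 4) = (M - 3) * ((M - 2) * ((M - 1) * M))" using c4 d3[symmetric] by simp
  have d5: "120 * int (N choose 5) = (M - 4) * ((M - 3) * ((M - 2) * ((M - 1) * M)))" using c5 d4[symmetric] by simp
  have "120 * (\<Sum>i\<le>5. int (N choose i) * z ^ i) = 120 + 120 * M * z + 60 * (2 * int (N choose 2)) * z^2
     + 20 * (6 * int (N choose 3)) * z^3 + 5 * (24 * int (N choose 4)) * z^4 + (120 * int (N choose 5)) * z^5"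
    unfolding s by (simp add: algebra_simps)
  also have "\<dots> = 120 + M * z * (120 + (M - 1) * z * (60 + (M - 2) * z * (20 + (M - 3) * z * (5 + (M - 4) * z))))"
    unfolding c2 d3 d4 d5 by (simp add: eval_nat_numeral) (simp add: algebra_simps)
  finally show "120 * (\<Sum>i\<le>5. int (N choose i) * z ^ i) = 120 + M * z * (120 + (M - 1) * z * (60 + (M - 2) * z * (20 + (M - 3) * z * (5 + (M - 4) * z))))" .
qed

section \<open>Congruences for solutions of opposite parity\<close>

text \<open>\<open>k\<close> and \<open>j\<close> are the exact exponents of \<open>a\<close> in
  \<open>b ^ n0 - 1\<close> and in \<open>N\<close>. The exponent \<open>k + j\<close> in
  \<open>e1\<close> comes from lifting the exponent, and \<open>Y'\<close> is odd because the
  parities differ.\<close>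

locale descent =
  fixes a b c n0 k j N Y' x2 y1 :: nat and n :: int
  assumes a: "prime a" "a \<ge> 7" "a mod 3 = 1" and b: "b > 1" and c: "c > 0"
    and cop: "coprime a b" "coprime a c"
    and k: "k \<ge> 1" and n: "int b ^ n0 = 1 + int a ^ k * n" "\<not> int a dvd n" and n0: "n0 = 1 \<or> n0 = 3"
    and Y': "N = a ^ j * Y'" "odd Y'" "\<not> a dvd Y'" and y1: "y1 \<ge> 1"
    and e1: "b ^ y1 + c = a ^ (k + j)" and e2: "b ^ (y1 + n0 * N) + c = a ^ x2"
begin

abbreviation "A \<equiv> int a ^ k"
abbreviation "B \<equiv> int a ^ j"

lemma A_ge: "A \<ge> 7"
proof -
  have "a ^ 1 \<le> a ^ k" by (rule power_increasing) (use k a in auto)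
  then have "7 \<le> a ^ k" using a(2) unfolding power_one_right by (rule order.trans[rotated])
  then have "int 7 \<le> int (a ^ k)" by (rule of_nat_mono)
  then show ?thesis by (simp only: of_nat_power of_nat_numeral)
qed

lemma B_ge: "B \<ge> 1" using a by simp

lemma b1: "int b \<ge> 2" using b by simp

lemma n_pos: "n > 0"
proof -
  have "1 < int b ^ n0" using b n0 by auto
  then have "0 < A * n" using n by simp
  then show ?thesis using A_ge by (simp add: zero_less_mult_iff)
qed

lemma Y'_pos: "Y' \<ge> 1" using Y'(2) by (simp add: Suc_le_eq odd_pos)

lemma N_pos: "N \<ge> 1" using Y' Y'_pos a by simp

lemma N_int: "int N = B * int Y'" using Y' by simp

lemma power_b_less: "int b ^ y1 < A * B"
proof -
  have "b ^ y1 < a ^ (k + j)" using e1 c by linarith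
  then have "int (b ^ y1) < int (a ^ (k + j))" by (rule of_nat_less_iff[THEN iffD2])
  then show ?thesis by (simp only: of_nat_power of_nat_mult power_add)
qed

lemma b_less: "int b < A * B"
proof -
  have "int b ^ 1 \<le> int b ^ y1" by (rule power_increasing) (use y1 b in auto)
  then show ?thesis using power_b_less by (simp only: power_one_right)
qed

lemma power_x2: "int b ^ (y1 + n0 * N) < int a ^ x2"
proof -
  have "b ^ (y1 + n0 * N) < a ^ x2" using e2 c by linarith
  then have "int (b ^ (y1 + n0 * N)) < int (a ^ x2)" by (rule of_nat_less_iff[THEN iffD2])
  then show ?thesis by (simp only: of_nat_power)
qed

lemma x2_gt: "k * N < x2"
proof -
  have "A < int b ^ n0" using n(1) n_pos A_ge mult_left_mono[of 1 n A] by simp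
  then have "A ^ N \<le> (int b ^ n0) ^ N" by (intro power_mono) auto
  also have "\<dots> \<le> int b ^ (y1 + n0 * N)" using b by (simp add: power_add power_mult)
  also have "\<dots> < int a ^ x2" by (rule power_x2)
  finally have "int a ^ (k * N) < int a ^ x2" by (simp add: power_mult)
  then show ?thesis using a by (simp add: power_strict_increasing_iff)
qed

text \<open>The difference of the two equations is
  \<open>b ^ y1 * (b ^ (n0 * N) - 1) = a ^ x2 - a ^ (k + j)\<close>. Insert the binomial expansion
  truncated at \<open>m\<close> and cancel \<open>A * B\<close>. \<open>F\<close> is the common
  denominator of the truncated sum; \<open>x2\<close> must be large enough for \<open>a ^ x2\<close>
  to drop out.\<close>

lemma relation_gen:
  assumes x2: "x2 \<ge> (m + 1) * k + j" and m: "m \<le> 5" and s: "F * (\<Sum>i\<le>m. int (N choose i) * (A * n) ^ i) = F + int N * (A * n) * G"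
  shows "A ^ m dvd F + int b ^ y1 * int Y' * n * G"
proof -
  let ?S = "\<Sum>i\<le>m. int (N choose i) * (A * n) ^ i"
  let ?M = "int a ^ ((m + 1) * k + j)"
  have d: "?M dvd (1 + A * n) ^ N - ?S"
    by (rule binomial_congruence) (use a m k Y' in auto)
  have g: "(1 + A * n) ^ N = int b ^ (n0 * N)" by (simp add: n(1)[symmetric] power_mult)
  have eq: "int b ^ y1 * (int b ^ (n0 * N) - 1) = int a ^ x2 - int a ^ (k + j)"
  proof -
    have "int (b ^ y1 + c) = int (a ^ (k + j))" "int (b ^ (y1 + n0 * N) + c) = int (a ^ x2)" using e1 e2 by simp_all
    then show ?thesis by (simp add: power_add algebra_simps)
  qed
  have "F * int a ^ (k + j) + int b ^ y1 * (int N * (A * n) * G)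
     = F * int a ^ (k + j) + int b ^ y1 * (F * (?S - 1))" using s by (simp add: algebra_simps)
  also have "\<dots> = F * int a ^ x2 - F * int b ^ y1 * ((1 + A * n) ^ N - ?S)"
  proof -
    have "F * (int b ^ y1 * (int b ^ (n0 * N) - 1)) = F * (int a ^ x2 - int a ^ (k + j))" using eq by simp
    then show ?thesis unfolding g by (simp add: algebra_simps)
  qed
  finally have "?M dvd F * int a ^ (k + j) + int b ^ y1 * (int N * (A * n) * G)"
    using d x2 by (simp add: le_imp_power_dvd dvd_diff)
  moreover have "F * int a ^ (k + j) + int b ^ y1 * (int N * (A * n) * G) = (A * B) * (F + int b ^ y1 * int Y' * n * G)"
    by (simp add: N_int power_add algebra_simps)
  moreover have "?M = (A * B) * A ^ m" by (simp add: power_add power_mult mult_ac flip: power_mult)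
  ultimately show ?thesis using a by simp
qed

text \<open>Supplies the condition on \<open>x2\<close> in \<open>relation_gen\<close> from
  \<open>k * N < x2\<close> and \<open>a ^ j \<le> N\<close>.\<close>

lemma x2_ge: assumes "N \<ge> i" "a ^ j \<ge> j + i" shows "x2 \<ge> i * k + j"
proof (cases "j = 0")
  case True
  have "i * k \<le> N * k" using assms by simp
  then show ?thesis using x2_gt True mult.commute[of k N] by linarith
next
  case False
  have "a ^ j \<le> N" using Y' Y'_pos by simp
  then have "(j + i) * k \<le> N * k" using assms by (intro mult_right_mono) auto
  moreover have "j * 1 \<le> j * k" using k by (intro mult_left_mono) auto
  moreover have "(j + i) * k = j * k + i * k" by (rule distrib_right)
  ultimately show ?thesis using x2_gt mult.commute[of k N] by linarith
qed

lemma j_le: "j \<ge> 1 \<Longrightarrow> j + 6 \<le> a ^ j"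
  using power_gt_add[of j a] a by linarith

lemma relation_5:
  assumes "N \<ge> 7"
  defines "z \<equiv> A * n" and "M \<equiv> int N"
  shows "A ^ 5 dvd 120 + int b ^ y1 * int Y' * n * (120 + (M - 1) * z * (60 + (M - 2) * z * (20 + (M - 3) * z * (5 + (M - 4) * z))))"
proof (rule relation_gen)
  have "6 * k + j \<le> x2"
  proof (cases "j = 0")
    case True
    have "6 * k \<le> N * k" using assms by simp
    then show ?thesis using x2_gt True mult.commute[of k N] by linarith
  next
    case False
    then show ?thesis using x2_ge[of 6] j_le assms by simp
  qed
  then show "(5 + 1) * k + j \<le> x2" by simp
  show "120 * (\<Sum>i\<le>5. int (N choose i) * (A * n) ^ i) =
    120 + int N * (A * n) * (120 + (M - 1) * z * (60 + (M - 2) * z * (20 + (M - 3) * z * (5 + (M - 4) * z))))"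
    unfolding z_def M_def by (rule binomial_sums(3))
qed simp

lemma n0_1_j: assumes "n0 = 1" shows "j \<ge> 1" "n < B"
proof -
  have "int b = 1 + A * n" using n(1) assms by simp
  then have "A * n < A * B" using b_less by simp
  then show nB: "n < B" using mult_less_cancel_left_pos[of A n B] A_ge by linarith
  show "j \<ge> 1" using nB n_pos by (cases "j = 0") auto
qed

lemma n0_3_factor: assumes "n0 = 3" "\<not> a dvd b - 1"
  obtains m where "A * m = int b ^ 2 + int b + 1" "m > 0" "n = (int b - 1) * m"
proof -
  have f: "(int b - 1) * (int b ^ 2 + int b + 1) = A * n"
  proof -
    have "(int b - 1) * (int b ^ 2 + int b + 1) = int b ^ 3 - 1"
      by (simp add: power2_eq_square power3_eq_cube algebra_simps)
    then show ?thesis using n(1) assms by simp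
  qed
  have "\<not> int a dvd int b - 1"
    using assms(2) b by (metis int_dvd_int_iff of_nat_1 of_nat_diff less_imp_le)
  then have "coprime A (int b - 1)" using a(1) by (simp add: prime_imp_coprime)
  then have "A dvd int b ^ 2 + int b + 1" using f by (metis coprime_dvd_mult_right_iff dvd_triv_left)
  then obtain m where m: "int b ^ 2 + int b + 1 = A * m" by blast
  have "A * m > 0" using m[symmetric] b by (simp add: add_pos_pos)
  then have "m > 0" using A_ge by (simp add: zero_less_mult_iff)
  moreover have "n = (int b - 1) * m"
  proof -
    have "A * n = A * ((int b - 1) * m)" unfolding f[symmetric] m by (rule mult.left_commute)
    moreover have "A \<noteq> 0" using A_ge by linarith
    ultimately show ?thesis unfolding mult_cancel_left by blast
  qed
  ultimately show ?thesis using that m by metis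
qed

text \<open>The bound \<open>k * N < x2\<close> is too weak only for \<open>j = 0\<close>,
  \<open>N = 1\<close>. There \<open>A \<le> b^2 + b + 1 \<le> 2 * b^2\<close>, so
  \<open>A ^ 2\<close> is at most \<open>4 * b ^ 4\<close>, which is below
  \<open>4 * a ^ x2\<close>, and 4 is less than \<open>a\<close>.\<close>

lemma x2_ge_2k: assumes nd: "n0 = 3 \<Longrightarrow> \<not> a dvd b - 1" shows "x2 \<ge> 2 * k + j"
proof (cases "j = 0")
  case False
  have "a ^ j \<le> N" using Y' Y'_pos by simp
  then show ?thesis using x2_ge[of 2] j_le False by linarith
next
  case j: True
  show ?thesis
  proof (cases "N \<ge> 2")
    case True
    then have "2 * k \<le> N * k" by simp
    then show ?thesis using x2_gt j mult.commute[of k N] by linarith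
  next
    case False
    then have N: "N = 1" using N_pos by simp
    have n03: "n0 = 3" using n0_1_j(1) j n0 by auto
    obtain m where m: "A * m = int b ^ 2 + int b + 1" "m > 0" using n0_3_factor[OF n03 nd[OF n03]] by metis
    have "A \<le> A * m" using mult_left_mono[of 1 m A] m(2) A_ge by linarith
    then have "A \<le> int b ^ 2 + int b + 1" using m by simp
    also have "\<dots> \<le> 2 * int b ^ 2"
    proof -
      have "2 * int b \<le> int b * int b" using b1 by (intro mult_right_mono) auto
      then show ?thesis unfolding power2_eq_square using b1 by linarith
    qed
    finally have "A ^ 2 \<le> (2 * int b ^ 2) ^ 2" using A_ge by (intro power_mono) auto
    also have "\<dots> = 4 * int b ^ 4" by (simp add: power_mult_distrib flip: power_mult)
    also have "\<dots> \<le> 4 * int b ^ (y1 + n0 * N)" using y1 b N n03 by (simp add: power_increasing)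
    also have "\<dots> < 4 * int a ^ x2" using power_x2 by simp
    also have "\<dots> \<le> int a * int a ^ x2" using a by simp
    finally have "int a ^ (2 * k) < int a ^ (x2 + 1)" by (simp add: power_mult mult.commute[of 2])
    then have "2 * k < x2 + 1" using a by (simp add: power_strict_increasing_iff del: power_Suc)
    then show ?thesis using j by simp
  qed
qed

lemma relation_1:
  assumes "n0 = 3 \<Longrightarrow> \<not> a dvd b - 1"
  shows "A dvd 1 + int b ^ y1 * int Y' * n"
  using relation_gen[of 1 1 1] x2_ge_2k[OF assms] binomial_sums(1)[of N "A * n"] by simp

lemma not_3_dvd: "\<not> 3 dvd A"
proof
  assume "3 dvd A"
  then have "int 3 dvd int (a ^ k)" by simp
  then have "3 dvd a ^ k" by (simp only: int_dvd_int_iff)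
  then have "3 dvd a" using prime_dvd_power[of "3::nat"] by auto
  then show False using a(3) by presburger
qed

lemma cancel_3:
  assumes "A dvd 3 * D" shows "A dvd D"
proof -
  have "\<not> a dvd 3"
  proof
    assume "a dvd 3"
    then have "a \<le> 3" by (rule dvd_imp_le) simp
    then show False using a(2) by simp
  qed
  then have "\<not> int a dvd 3" by (metis int_dvd_int_iff of_nat_numeral)
  then have "coprime A 3" using a(1) by (simp add: prime_imp_coprime)
  then show ?thesis using assms by (simp add: coprime_dvd_mult_right_iff)
qed

text \<open>Here \<open>b\<close> is 1 modulo \<open>A\<close>, so the first-order relation reads
  \<open>A dvd 1 + Y' * n\<close>; and \<open>n < B\<close> keeps this number at most
  \<open>N\<close>. So \<open>n0 = 1\<close> cannot occur when \<open>A\<close> is large.\<close>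

lemma n0_1_small: assumes "n0 = 1" shows "A \<le> int N"
proof -
  have b': "int b = 1 + A * n" using n(1) assms by simp
  have "A dvd int b - 1" using b' by simp
  moreover have "int b - 1 dvd int b ^ y1 - 1" using power_diff_1_eq[of "int b" y1] by simp
  ultimately have "A dvd int b ^ y1 - 1" by (rule dvd_trans)
  then have "A dvd (int b ^ y1 - 1) * (int Y' * n)" by simp
  moreover have "A dvd 1 + int b ^ y1 * int Y' * n" using relation_1 assms by simp
  ultimately have "A dvd (1 + int b ^ y1 * int Y' * n) - (int b ^ y1 - 1) * (int Y' * n)" by (rule dvd_diff[rotated])
  moreover have "(1 + int b ^ y1 * int Y' * n) - (int b ^ y1 - 1) * (int Y' * n) = 1 + int Y' * n" by (simp add: algebra_simps)
  ultimately have "A dvd 1 + int Y' * n" by simp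
  moreover have "0 \<le> int Y' * n" using n_pos by simp
  ultimately have "A \<le> 1 + int Y' * n" by (intro zdvd_imp_le) auto
  also have "\<dots> \<le> 1 + int Y' * (B - 1)" using n0_1_j(2)[OF assms] by (intro add_left_mono mult_left_mono) auto
  also have "\<dots> = 1 + int N - int Y'" unfolding N_int by (simp add: algebra_simps)
  also have "\<dots> \<le> int N" using Y'_pos by simp
  finally show ?thesis .
qed

end

text \<open>Modulo \<open>A\<close> the number \<open>w = 2 * b + 1\<close> is a square root of -3.
  After multiplication by 3 the relation modulo \<open>A ^ 2\<close> has an overt factor
  \<open>A\<close>; cancelling it leaves a congruence modulo \<open>A\<close> that becomes linear in
  \<open>b\<close> once multiplied by \<open>w\<close> and reduced by \<open>s\<close>. A second
  multiplication by \<open>w\<close> turns \<open>w\<close> into -3 and accounts for the factor 3 in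
  the conclusion.\<close>

lemma second_order_identity:
  fixes A m s b n N Y :: int
  assumes m: "A * m = b ^ 2 + b + 1" and s: "3 * Y * m + 2 * b + 1 = A * s" and n: "n = (b - 1) * m"
    and d: "A ^ 2 dvd 2 + b * Y * n * (2 + (N - 1) * (A * n))" and A: "A > 0"
  shows "A dvd 3 * ((3 * N + 1) * b - (3 * N + 3) - 6 * Y * s)"
proof -
  obtain e where e: "2 + b * Y * n * (2 + (N - 1) * (A * n)) = A ^ 2 * e" using d by blast
  define w where "w = 2 * b + 1"
  define Q where "Q = s * m * A - (s + m) * w + 4 * m"
  define X where "X = 2 + (N - 1) * (A * n)"
  define D where "D = (3 * N + 1) * b - (3 * N + 3) - 6 * Y * s"
  have ww: "w * w = 4 * (A * m) - 3" unfolding m w_def by (simp add: algebra_simps power2_eq_square)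
  have Ym: "3 * Y * m = A * s - w" using s by (simp add: w_def)
  have bn: "b * n = m * (A * m - w)" unfolding m n w_def by (simp add: algebra_simps power2_eq_square)
  have Q: "(A * s - w) * (A * m - w) = A * Q - 3"
  proof -
    have "(A * s - w) * (A * m - w) = A * (s * m * A - (s + m) * w) + w * w" by (simp add: algebra_simps)
    then show ?thesis unfolding ww Q_def by (simp add: algebra_simps)
  qed
  have "3 * (A ^ 2 * e) = 6 + 3 * Y * (b * n) * X" unfolding e[symmetric] X_def by (simp add: algebra_simps)
  also have "\<dots> = 6 + (3 * Y * m) * (A * m - w) * X" unfolding bn by (simp add: algebra_simps)
  also have "\<dots> = 6 + (A * Q - 3) * X" unfolding Ym Q ..
  also have "\<dots> = A * (2 * Q + (A * Q - 3) * (N - 1) * n)" unfolding X_def by (simp add: algebra_simps)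
  finally have "A * (3 * A * e) = A * (2 * Q + (A * Q - 3) * (N - 1) * n)" by (simp add: power2_eq_square algebra_simps)
  then have E: "3 * A * e = 2 * Q + (A * Q - 3) * (N - 1) * n" using A by simp
  have "w * D = w * (- 6 * Y * s) + w * (2 * w - 8 + 3 * (N - 1) * (b - 1))"
    unfolding D_def by (simp add: w_def algebra_simps)
  also have "\<dots> = 3 * Y * (2 * Q + (A * Q - 3) * (N - 1) * n) - A * (3 * Y * (2 * s * m + Q * (N - 1) * n) + s * (8 - 2 * w - 3 * (N - 1) * (b - 1)))
      + (A * s - w - 3 * Y * m) * (8 - 2 * w - 3 * (N - 1) * (b - 1))"
    unfolding Q_def n by (simp add: algebra_simps)
  finally have "A dvd w * D" unfolding Ym E[symmetric] by simp
  then have "A dvd w * (w * D)" by simp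
  also have "w * (w * D) = (w * w) * D" by simp
  finally have "A dvd (4 * (A * m) - 3) * D" unfolding ww .
  then have "A dvd A * (4 * m * D) - (4 * (A * m) - 3) * D" by (intro dvd_diff) simp_all
  then show ?thesis unfolding D_def[symmetric] by (simp add: algebra_simps)
qed

section \<open>The case n0 = 3: y1 = 1 and a bound for A\<close>

locale descent_3 = descent +
  fixes m :: int
  assumes n03: "n0 = 3" and bna: "\<not> a dvd b - 1" and mA: "int a ^ k * m = int b ^ 2 + int b + 1"
    and m_pos: "m > 0" and nm: "n = (int b - 1) * m"
begin

lemma rel: "A dvd 1 + int b ^ y1 * int Y' * ((int b - 1) * m)"
  using relation_1 bna unfolding nm by simp

text \<open>Modulo \<open>b^2 + b + 1 = A * m\<close> the factors \<open>b - 1\<close>,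
  \<open>b + 2\<close> and \<open>2 * b + 1\<close> turn \<open>b ^ y1 * (b - 1)\<close> into the
  constants -3, -3 and 3 for \<open>y1\<close> equal to 2, 3 and 1. So the first-order relation
  becomes linear in \<open>b\<close> and \<open>m\<close>.\<close>

lemma y1_2: assumes "y1 = 2" shows "A dvd int b - 1 - 3 * int Y' * m"
proof -
  have "A dvd (int b - 1) * (1 + int b ^ y1 * int Y' * ((int b - 1) * m)) - A * m * (int b ^ 2 - 3 * int b + 3) * (int Y' * m)"
    using rel by (intro dvd_diff) (auto intro: dvd_mult dvd_mult2)
  moreover have "(int b - 1) * (1 + int b ^ y1 * int Y' * ((int b - 1) * m)) - A * m * (int b ^ 2 - 3 * int b + 3) * (int Y' * m) = int b - 1 - 3 * int Y' * m"
    unfolding mA assms by (simp add: algebra_simps power2_eq_square)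
  ultimately show ?thesis by simp
qed

lemma y1_3: assumes "y1 = 3" shows "A dvd int b + 2 - 3 * int Y' * m"
proof -
  have "A dvd (int b + 2) * (1 + int b ^ y1 * int Y' * ((int b - 1) * m)) - A * m * (int b ^ 3 - 3 * (int b - 1)) * (int Y' * m)"
    using rel by (intro dvd_diff) (auto intro: dvd_mult dvd_mult2)
  moreover have "(int b + 2) * (1 + int b ^ y1 * int Y' * ((int b - 1) * m)) - A * m * (int b ^ 3 - 3 * (int b - 1)) * (int Y' * m) = int b + 2 - 3 * int Y' * m"
    unfolding mA assms by (simp add: algebra_simps power2_eq_square power3_eq_cube)
  ultimately show ?thesis by simp
qed

lemma y1_1: assumes "y1 = 1" shows "A dvd 3 * int Y' * m + 2 * int b + 1"
proof -
  have "A dvd (2 * int b + 1) * (1 + int b ^ y1 * int Y' * ((int b - 1) * m)) - A * m * (2 * int b - 3) * (int Y' * m)"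
    using rel by (intro dvd_diff) (auto intro: dvd_mult dvd_mult2)
  moreover have "(2 * int b + 1) * (1 + int b ^ y1 * int Y' * ((int b - 1) * m)) - A * m * (2 * int b - 3) * (int Y' * m) = 3 * int Y' * m + 2 * int b + 1"
    unfolding mA assms by (simp add: algebra_simps power2_eq_square)
  ultimately show ?thesis by simp
qed

lemma zero_of_small: "(x::int) dvd y \<Longrightarrow> \<bar>y\<bar> < x \<Longrightarrow> y = 0"
  using zdvd_imp_le[of x "\<bar>y\<bar>"] by auto

lemma A_le_mA: "A \<le> int b ^ 2 + int b + 1"
  using mult_left_mono[of 1 m A] m_pos A_ge mA by linarith

text \<open>If \<open>y1 \<ge> 3\<close>, then \<open>b ^ 3 < A * B\<close> and
  \<open>A \<le> b^2 + b + 1\<close> force \<open>b \<le> B + 1\<close>, while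
  \<open>A \<ge> 8000\<close> forces \<open>b \<ge> 89\<close>; such \<open>b\<close> fit neither
  the congruence for \<open>y1 = 3\<close> nor the size for \<open>y1 \<ge> 4\<close>. If
  \<open>y1 = 2\<close>, the number in the congruence is smaller than \<open>A\<close>, so it is
  zero. Then \<open>b = 3 * Y' * m + 1\<close>, and \<open>m\<close> divides 3.\<close>

lemma y1_eq_1:
  assumes A8: "A \<ge> 8000" and N: "N < 200"
  shows "y1 = 1"
proof (rule ccontr)
  assume "y1 \<noteq> 1"
  then have "y1 = 2 \<or> y1 \<ge> 3" using y1 by linarith
  then show False
  proof
    assume y3: "y1 \<ge> 3"
    have BN: "B \<le> int N" unfolding N_int using mult_left_mono[of 1 "int Y'" B] Y'_pos B_ge by linarith
    have "int b ^ 3 \<le> int b ^ y1" using y3 b by (intro power_increasing) auto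
    then have "int b ^ 3 < A * B" using power_b_less by linarith
    also have "\<dots> \<le> (int b ^ 2 + int b + 1) * B" using A_le_mA B_ge by (intro mult_right_mono) auto
    finally have lt: "int b ^ 3 < (int b ^ 2 + int b + 1) * B" .
    have bB: "int b \<le> B + 1"
    proof (rule ccontr)
      assume "\<not> int b \<le> B + 1"
      then have "(int b ^ 2 + int b + 1) * B \<le> (int b ^ 2 + int b + 1) * (int b - 2)" by (intro mult_left_mono) auto
      also have "\<dots> = int b ^ 3 - int b ^ 2 - int b - 2" by (simp add: algebra_simps power2_eq_square power3_eq_cube)
      also have "\<dots> < int b ^ 3" by (smt (verit) zero_le_power2 of_nat_0_le_iff)
      finally show False using lt by simp
    qed
    then have b200: "int b \<le> 200" using BN N by linarith
    then have bb: "int b ^ 2 \<le> 200 * 200" unfolding power2_eq_square by (intro mult_mono) auto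
    have b89: "int b \<ge> 89"
    proof (rule ccontr)
      assume "\<not> int b \<ge> 89"
      then have "int b ^ 2 \<le> 88 * 88" unfolding power2_eq_square by (intro mult_mono) auto
      then show False using \<open>\<not> int b \<ge> 89\<close> A_le_mA A8 by linarith
    qed
    have Y1: "int Y' = 1"
    proof (rule ccontr)
      assume "int Y' \<noteq> 1"
      then have "Y' \<ge> 3" using Y'(2) by presburger
      then have "B * 3 \<le> B * int Y'" using B_ge by (intro mult_left_mono) auto
      then show False using bB b89 N N_int by linarith
    qed
    show False
    proof (cases "y1 = 3")
      case True
      have "8000 * m \<le> A * m" using A8 m_pos by (intro mult_right_mono) auto
      then have m5: "m \<le> 5" using mA bb b200 by linarith
      have "int b + 2 - 3 * int Y' * m = 0"
        by (rule zero_of_small[OF y1_3[OF True]]) (use m5 m_pos b89 b200 A8 Y1 in simp)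
      then show False using m5 b89 Y1 by simp
    next
      case False
      then have "int b ^ 4 \<le> int b ^ y1" using y3 b by (intro power_increasing) auto
      then have "int b ^ 4 < A * B" using power_b_less by linarith
      also have "\<dots> \<le> 40201 * 200"
      proof (rule mult_mono)
        show "A \<le> 40201" using A_le_mA bb b200 by linarith
        show "B \<le> 200" using BN N by linarith
      qed (use B_ge in simp_all)
      finally have "int b ^ 4 < 40201 * 200" .
      moreover have "89 ^ 4 \<le> int b ^ 4" using b89 by (intro power_mono) auto
      ultimately show False by simp
    qed
  next
    assume y2: "y1 = 2"
    have b2: "int b ^ 2 < A * B" using power_b_less y2 by simp
    have BN: "B \<le> int N" unfolding N_int using mult_left_mono[of 1 "int Y'" B] Y'_pos B_ge by linarith
    have bA: "int b < A"
    proof (rule ccontr)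
      assume "\<not> int b < A"
      then have "A * A \<le> int b ^ 2" unfolding power2_eq_square using A_ge by (intro mult_mono) auto
      then have "A * A < A * B" using b2 by linarith
      then have "A < B" using A_ge mult_less_cancel_left_pos[of A A B] by linarith
      then show False using BN N A8 by linarith
    qed
    have mB: "m \<le> B"
    proof (rule ccontr)
      assume "\<not> m \<le> B"
      then have "A * (B + 1) \<le> A * m" using A_ge by (intro mult_left_mono) auto
      then have "A * B + A \<le> int b ^ 2 + int b + 1" using mA by (simp add: algebra_simps)
      then show False using b2 bA by linarith
    qed
    have "int Y' * m \<le> int Y' * B" using mB by (intro mult_left_mono) auto
    then have Ym: "int Y' * m < 200" using N N_int by (simp add: mult.commute)
    have Ym0: "0 \<le> int Y' * m" using m_pos by simp
    have "\<bar>int b - 1 - 3 * int Y' * m\<bar> < A" using Ym Ym0 bA b1 A8 unfolding mult.assoc abs_less_iff by linarith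
    then have "int b - 1 - 3 * int Y' * m = 0" by (rule zero_of_small[OF y1_2[OF y2]])
    then have bm: "int b = 3 * int Y' * m + 1" by simp
    have "m * (A - 9 * int Y' ^ 2 * m - 9 * int Y') = 3"
    proof -
      have "A * m = 9 * int Y' ^ 2 * m ^ 2 + 9 * int Y' * m + 3" unfolding mA bm by (simp add: algebra_simps power2_eq_square)
      then show ?thesis by (simp add: algebra_simps power2_eq_square)
    qed
    note m3 = this
    then have "m dvd 3" by (metis dvd_triv_left)
    then have "m \<le> 3" by (rule zdvd_imp_le) simp
    then consider "m = 1" | "m = 2" | "m = 3" using m_pos by linarith
    then show False
    proof cases
      case 1
      then have "A = 3 * (3 * int Y' ^ 2 + 3 * int Y' + 1)" using m3 by simp
      then show False using not_3_dvd by simp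
    next
      case 2
      then show False using m3 by presburger
    next
      case 3
      then have A: "A = 27 * int Y' ^ 2 + 9 * int Y' + 1" using m3 by simp
      have "int Y' \<ge> 18"
      proof (rule ccontr)
        assume Y: "\<not> int Y' \<ge> 18"
        then have "int Y' ^ 2 \<le> 17 * 17" unfolding power2_eq_square by (intro mult_mono) auto
        then show False using A A8 Y by linarith
      qed
      then have "B * 18 \<le> B * int Y'" using B_ge by (intro mult_left_mono) auto
      then have B11: "B \<le> 11" using N N_int by linarith
      have "j \<noteq> 0"
      proof
        assume "j = 0"
        then have "B = 1" by simp
        then show False using mB 3 by linarith
      qed
      then have "int a ^ 1 \<le> B" using a by (intro power_increasing) auto
      then have "int a \<le> 11" using B11 unfolding power_one_right by linarith
      then have "a \<le> 11" by simp
      then have a7: "a = 7"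
      proof -
        have "a = 7 \<or> a = 10" using \<open>a \<le> 11\<close> a(2,3) by presburger
        moreover have "\<not> prime (10::nat)" by (simp add: prime_nat_iff) (rule exI[of _ 2], simp)
        ultimately show ?thesis using a(1) by auto
      qed
      then have "7 \<le> B" using \<open>int a ^ 1 \<le> B\<close> by simp
      then have "7 * int Y' \<le> B * int Y'" by (intro mult_right_mono) auto
      then have Y28: "int Y' \<le> 28" using N N_int by linarith
      then have "int Y' ^ 2 \<le> 28 * 28" unfolding power2_eq_square by (intro mult_mono) auto
      then have A2: "A \<le> 21421" using A Y28 by linarith
      have A7: "A = 7 ^ k" using a7 by simp
      have "k = 5"
      proof (rule ccontr)
        assume "k \<noteq> 5"
        then consider "k \<le> 4" | "k \<ge> 6" by linarith
        then show False
        proof cases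
          case 1
          then have "(7::int) ^ k \<le> 7 ^ 4" by (intro power_increasing) auto
          then show False using A7 A8 by simp
        next
          case 2
          then have "(7::int) ^ 6 \<le> 7 ^ k" by (intro power_increasing) auto
          then show False using A7 A2 by simp
        qed
      qed
      then have "A = 16807" using A7 by simp
      \<comment> \<open>16807 - 1 is not divisible by 9, whereas \<open>27 * Y'^2 + 9 * Y'\<close>
        is.\<close>
      then show False using A by presburger
    qed
  qed
qed

text \<open>Again only \<open>j = 0\<close>, \<open>N = 1\<close> needs care: the congruence for
  \<open>y1 = 1\<close> gives \<open>A \<le> 6 * b\<close>, and
  \<open>A ^ 3 \<le> 216 * b ^ 3 \<le> b ^ 4\<close>, which is below \<open>a ^ x2\<close>.\<close>

lemma x2_ge_3k: assumes A8: "A \<ge> 8000" and y1: "y1 = 1" shows "x2 \<ge> 3 * k + j"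
proof (cases "j = 0")
  case False
  have "a ^ j \<le> N" using Y' Y'_pos by simp
  then show ?thesis using x2_ge[of 3] j_le False by linarith
next
  case j: True
  show ?thesis
  proof (cases "N = 1")
    case False
    moreover have "odd N" using j Y' by simp
    ultimately have "N \<ge> 3" using N_pos by presburger
    then have "3 * k \<le> N * k" by simp
    then show ?thesis using x2_gt j mult.commute[of k N] by linarith
  next
    case True
    have bA: "int b < A" using b_less j by simp
    have mb: "m \<le> int b"
    proof (rule ccontr)
      assume "\<not> m \<le> int b"
      then have "int b + 1 \<le> m" "int b + 1 \<le> A" using bA by linarith+
      note bm = this
      have "(int b + 1) * (int b + 1) \<le> A * m" by (rule mult_mono) (use bm A_ge in linarith)+
      then show False using mA b1 by (simp add: algebra_simps power2_eq_square)
    qed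
    have Y1: "int Y' = 1" using True j Y' by simp
    have "A \<le> 3 * int Y' * m + 2 * int b + 1" by (rule zdvd_imp_le[OF y1_1[OF y1]]) (use m_pos Y1 in simp)
    then have "A \<le> 3 * m + 2 * int b + 1" unfolding Y1 by simp
    then have b6: "A \<le> 6 * int b" and b216: "int b \<ge> 216" using mb b1 A8 by linarith+
    have "A ^ 3 \<le> (6 * int b) ^ 3" using b6 A_ge by (intro power_mono) auto
    also have "\<dots> = 216 * int b ^ 3" by (simp add: power_mult_distrib)
    also have "\<dots> \<le> int b * int b ^ 3" using b216 by (intro mult_right_mono) auto
    also have "\<dots> = int b ^ (y1 + n0 * N)" using y1 n03 True by (simp add: eval_nat_numeral)
    also have "\<dots> < int a ^ x2" by (rule power_x2)
    finally have "int a ^ (3 * k) < int a ^ x2" by (simp add: power_mult mult.commute[of 3])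
    then show ?thesis using a j by (simp add: power_strict_increasing_iff)
  qed
qed

text \<open>With \<open>Y = 3 * N\<close> the second-order relation says that
  \<open>(Y + 1) * b\<close> is \<open>t\<close> modulo \<open>A\<close>. Eliminating
  \<open>b\<close> with \<open>b^2 + b + 1\<close> leaves the positive multiple
  \<open>t^2 + (Y + 1) * t + (Y + 1)^2\<close> of \<open>A\<close>. Since \<open>s\<close> is at
  most \<open>3 * N * B + 2 * B\<close>, \<open>t\<close> is bounded in terms of \<open>N\<close>
  alone.\<close>

lemma A_le:
  assumes A8: "A \<ge> 8000" and N: "N < 200" and y1: "y1 = 1"
  shows "A \<le> 512806639228"
proof -
  define Y where "Y = 3 * int N"
  obtain s where s: "3 * int Y' * m + 2 * int b + 1 = A * s" using y1_1[OF y1] by blast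
  have "A * s > 0" unfolding s[symmetric] using m_pos by (simp add: add_nonneg_pos)
  then have s0: "s > 0" using A_ge by (simp add: zero_less_mult_iff)
  have "A ^ 2 dvd 2 + int b ^ y1 * int Y' * n * (2 + (int N - 1) * (A * n))"
    by (rule relation_gen) (use x2_ge_3k[OF A8 y1] binomial_sums(2)[of N "A * n"] in simp_all)
  then have rel2: "A ^ 2 dvd 2 + int b * int Y' * n * (2 + (int N - 1) * (A * n))" using y1 by simp
  have "A dvd 3 * ((3 * int N + 1) * int b - (3 * int N + 3) - 6 * int Y' * s)"
    by (rule second_order_identity[OF mA s nm rel2]) (use A_ge in linarith)
  then have D: "A dvd (Y + 1) * int b - (Y + 3) - 6 * int Y' * s" unfolding Y_def by (rule cancel_3)
  define t where "t = Y + 3 + 6 * int Y' * s"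
  have "A dvd (Y + 1) ^ 2 * (A * m) - ((Y + 1) * int b - (Y + 3) - 6 * int Y' * s) * ((Y + 1) * int b + t + (Y + 1))"
    using D by (intro dvd_diff) (auto intro: dvd_mult dvd_mult2)
  also have "\<dots> = t ^ 2 + (Y + 1) * t + (Y + 1) ^ 2" unfolding mA t_def by (simp add: algebra_simps power2_eq_square)
  finally have dvd: "A dvd t ^ 2 + (Y + 1) * t + (Y + 1) ^ 2" .
  have Y: "0 \<le> Y" "Y \<le> 597" using N by (auto simp: Y_def)
  have t0: "t > 0" unfolding t_def using Y s0 by (simp add: add_pos_nonneg)
  have N2: "int N * int N \<le> 199 * 199" using N by (intro mult_mono) auto
  have "m \<le> A * B * B"
  proof -
    have "A * m \<le> (int b + 1) * (int b + 1)" unfolding mA by (simp add: algebra_simps power2_eq_square)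
    also have "\<dots> \<le> (A * B) * (A * B)" using b_less by (intro mult_mono) linarith+
    finally have "A * m \<le> A * (A * B * B)" by (simp only: mult_ac)
    then show ?thesis using mult_le_cancel_left_pos[of A m "A * B * B"] A_ge by linarith
  qed
  then have "3 * int Y' * m \<le> 3 * int Y' * (A * B * B)" by (intro mult_left_mono) auto
  moreover have "2 * int b + 1 \<le> A * (2 * B)" using b_less by linarith
  ultimately have "A * s \<le> 3 * int Y' * (A * B * B) + A * (2 * B)" using s by linarith
  also have "\<dots> = A * (3 * int N * B + 2 * B)" unfolding N_int by (simp add: algebra_simps)
  finally have "s \<le> 3 * int N * B + 2 * B" using mult_le_cancel_left_pos[of A s "3 * int N * B + 2 * B"] A_ge by linarith
  then have "6 * int Y' * s \<le> 6 * int Y' * (3 * int N * B + 2 * B)" by (intro mult_left_mono) auto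
  also have "\<dots> = 18 * (int N * int N) + 12 * int N" unfolding N_int by (simp add: algebra_simps)
  also have "\<dots> \<le> 18 * (199 * 199) + 12 * 199" using N2 N by linarith
  \<comment> \<open>715806 = 18 * 199^2 + 12 * 199 + 600, the last summand bounding
    \<open>Y + 3\<close>.\<close>
  finally have t: "t \<le> 715806" using Y unfolding t_def by linarith
  have "A \<le> t ^ 2 + (Y + 1) * t + (Y + 1) ^ 2"
    using dvd Y t0 by (intro zdvd_imp_le) (auto intro!: add_pos_nonneg)
  also have "\<dots> \<le> 715806 * 715806 + 598 * 715806 + 598 * 598"
    unfolding power2_eq_square using Y t t0 by (intro add_mono mult_mono) auto
  finally show ?thesis by simp
qed

end

section \<open>Executable checks of the congruences\<close>

definition relation_5_fails :: "int \<Rightarrow> int \<Rightarrow> int \<Rightarrow> int \<Rightarrow> int \<Rightarrow> bool" where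
  "relation_5_fails A P n M z \<longleftrightarrow>
    (120 + P * n * (120 + (M - 1) * z * (60 + (M - 2) * z * (20 + (M - 3) * z * (5 + (M - 4) * z))))) mod A ^ 5 \<noteq> 0"

text \<open>The test modulo \<open>A ^ 2\<close> on reduced arguments is tried before the one with
  large numbers modulo \<open>A ^ 5\<close>. For \<open>M < 7\<close> no failure is reported, since
  the relation modulo \<open>A ^ 5\<close> is established only for \<open>N \<ge> 7\<close>.\<close>

definition relation_2_5_fails :: "int \<Rightarrow> int \<Rightarrow> int \<Rightarrow> int \<Rightarrow> bool" where
  "relation_2_5_fails A P n M \<longleftrightarrow>
    (if M < 7 then False else
     if (2 + (P mod (A * A)) * (n mod (A * A)) * (2 + (M - 1) * (A * (n mod A)))) mod (A * A) \<noteq> 0 then True else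
     relation_5_fails A P n M (A * n))"

definition relation_fails :: "int \<Rightarrow> int \<Rightarrow> int \<Rightarrow> int \<Rightarrow> int \<Rightarrow> bool" where
  "relation_fails A B p n Y \<longleftrightarrow> relation_2_5_fails A (p * Y) n (B * Y)"

text \<open>The functions evaluated by rewriting are first-order: the simplifier would normalise the body of
  an abstraction again in every iteration.\<close>

function odd_check :: "int \<Rightarrow> int \<Rightarrow> nat \<Rightarrow> int \<Rightarrow> int \<Rightarrow> int \<Rightarrow> int \<Rightarrow> int \<Rightarrow> int \<Rightarrow> bool" where
  "odd_check A B f b p x d Y H = (if H < Y then True else
    if (if x = 0 then relation_fails A B p ((b ^ f - 1) div A) Y else True)
    then odd_check A B f b p ((x + d) mod A) d (Y + 2) H else False)"
  by auto
termination by (relation "measure (\<lambda>(A, B, f, b, p, x, d, Y, H). nat (H + 1 - Y))") auto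

definition odd_start :: "int \<Rightarrow> int \<Rightarrow> nat \<Rightarrow> int \<Rightarrow> int \<Rightarrow> int \<Rightarrow> int \<Rightarrow> bool" where
  "odd_start A B f b p q H = odd_check A B f b p ((1 + q) mod A) (2 * q mod A) 1 H"

text \<open>The first argument is fuel, started at 20: powers of \<open>b \<ge> 2\<close> below
  \<open>L \<le> 1000000\<close> have exponent less than 20. \<nu> is the residue of
  \<open>(b ^ f - 1) div A\<close>.\<close>

fun power_check :: "nat \<Rightarrow> int \<Rightarrow> int \<Rightarrow> nat \<Rightarrow> int \<Rightarrow> int \<Rightarrow> int \<Rightarrow> int \<Rightarrow> int \<Rightarrow> bool" where
  "power_check 0 A B f b p \<nu> H L = True"
| "power_check (Suc t) A B f b p \<nu> H L = (if p < L then
    (if odd_start A B f b p (p * \<nu> mod A) H then power_check t A B f b (p * b) \<nu> H L else False) else True)"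

text \<open>Runs through one residue class modulo \<open>A\<close>. When \<open>b\<close> grows by
  \<open>A\<close>, the quotient \<open>(b ^ f - 1) div A\<close> changes modulo \<open>A\<close> by
  the constant \<open>g\<close>, so its residue is updated by an addition.\<close>

function base_check :: "int \<Rightarrow> int \<Rightarrow> nat \<Rightarrow> int \<Rightarrow> int \<Rightarrow> int \<Rightarrow> int \<Rightarrow> int \<Rightarrow> bool" where
  "base_check A B f b \<nu> g H L = (if A \<le> 0 then True else if L \<le> b then True else
    if power_check 20 A B f b b \<nu> H L then base_check A B f (b + A) ((\<nu> + g) mod A) g H L else False)"
  by auto
termination by (relation "measure (\<lambda>(A, B, f, b, \<nu>, g, H, L). nat (L - b))") auto

declare odd_check.simps [simp del] base_check.simps [simp del]

definition small_check :: "int \<Rightarrow> int \<Rightarrow> int \<Rightarrow> nat \<Rightarrow> int \<Rightarrow> bool" where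
  "small_check M A B f \<rho> =
    base_check A B f \<rho> ((\<rho> ^ f - 1) div A mod A) (int f * \<rho> ^ (f - 1) mod A) (M div B) (A * B)"

definition small_cases :: "int \<Rightarrow> int \<Rightarrow> nat \<Rightarrow> nat \<Rightarrow> int \<Rightarrow> bool" where
  "small_cases M a k j \<rho> \<longleftrightarrow> (\<rho> * \<rho> + \<rho> + 1) mod a ^ k = 0 \<and> 0 \<le> \<rho> \<and> \<rho> < a ^ k \<and> a ^ k * a ^ j \<le> 1000000 \<and>
     small_check M (a ^ k) (a ^ j) 1 1 \<and> small_check M (a ^ k) (a ^ j) 3 \<rho> \<and> small_check M (a ^ k) (a ^ j) 3 (a ^ k - 1 - \<rho>)"

text \<open>For \<open>y1 = 1\<close> there is no loop over \<open>b\<close>: with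
  \<open>b = \<rho> + \<sigma> * A\<close> and \<open>\<rho> ^ 3\<close> equal to 1 modulo
  \<open>A\<close>, the first-order relation says that \<open>3 * Y * \<sigma>\<close> has residue
  \<open>v\<close>, which determines \<sigma> for each odd \<open>Y\<close>.\<close>

definition large_check :: "int \<Rightarrow> int \<Rightarrow> int \<Rightarrow> bool" where
  "large_check A B \<rho> = (let c = \<rho> * ((\<rho> ^ 3 - 1) div A) mod A in
    list_all (\<lambda>i. let Y = 2 * i + 1; v = (- 1 - c * Y) mod A in
      if v < 3 * Y * B then
        (if v mod (3 * Y) = 0 then
          (let b = \<rho> + v div (3 * Y) * A in relation_fails A B b ((b ^ 3 - 1) div A) Y) else True)
      else True) [0..200 div (2 * B)])"

definition large_cases :: "int \<Rightarrow> nat \<Rightarrow> nat list \<Rightarrow> int \<Rightarrow> bool" where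
  "large_cases a k js \<rho> \<longleftrightarrow> (\<rho> * \<rho> + \<rho> + 1) mod a ^ k = 0 \<and> 0 \<le> \<rho> \<and> \<rho> < a ^ k \<and>
     list_all (\<lambda>j. large_check (a ^ k) (a ^ j) \<rho> \<and> large_check (a ^ k) (a ^ j) (a ^ k - 1 - \<rho>)) js"

section \<open>Soundness of the checks\<close>

text \<open>\<open>X\<close> stands for \<open>1 + b ^ y * Y * n\<close> before reduction modulo
  \<open>A\<close>; passing to the next odd \<open>Y\<close> adds \<open>d\<close>, which is twice
  \<open>b ^ y * n\<close>.\<close>

lemma odd_check_D:
  assumes "odd_check A B f b p (X mod A) d Y H" "Y + 2 * int i \<le> H" "A dvd X + d * int i"
  shows "relation_fails A B p ((b ^ f - 1) div A) (Y + 2 * int i)"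
  using assms
proof (induction i arbitrary: X Y)
  case 0
  have "X mod A = 0" using 0 by simp
  then show ?case using 0 by (simp add: odd_check.simps[of A B f b p 0] split: if_splits)
next
  case (Suc i)
  have "odd_check A B f b p ((X + d) mod A) d (Y + 2) H"
    using Suc.prems(1,2) by (subst (asm) odd_check.simps) (simp add: mod_add_left_eq split: if_splits)
  then show ?case using Suc.IH[of "X + d" "Y + 2"] Suc.prems by (simp add: algebra_simps)
qed

lemma power_check_D:
  assumes "power_check t A B f b (b ^ i) \<nu> H L" "b ^ y < L" "i \<le> y" "y < i + t" "b \<ge> 1"
  shows "odd_start A B f b (b ^ y) (b ^ y * \<nu> mod A) H"
  using assms
proof (induction t arbitrary: i)
  case (Suc t)
  have "b ^ i \<le> b ^ y" using Suc.prems by (intro power_increasing) auto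
  then have *: "odd_start A B f b (b ^ i) (b ^ i * \<nu> mod A) H" "power_check t A B f b (b ^ Suc i) \<nu> H L"
    using Suc.prems by (auto simp: mult.commute split: if_splits)
  show ?case
  proof (cases "i = y")
    case False
    then show ?thesis using Suc.IH[OF *(2)] Suc.prems by simp
  qed (use * in simp)
qed simp

lemma base_check_D:
  assumes "base_check A B f b (\<nu> mod A) g H L" "b + int s * A < L" "A > 0"
  shows "power_check 20 A B f (b + int s * A) (b + int s * A) ((\<nu> + g * int s) mod A) H L"
  using assms
proof (induction s arbitrary: b \<nu>)
  case 0
  then show ?case by (simp add: base_check.simps[of A] split: if_splits)
next
  case (Suc s)
  have "0 \<le> int (Suc s) * A" using Suc.prems by simp
  then have "b < L" using Suc.prems(2) by linarith
  then have "base_check A B f (b + A) ((\<nu> + g) mod A) g H L"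
    using Suc.prems(1,3) by (subst (asm) base_check.simps) (simp add: mod_add_left_eq split: if_splits)
  then show ?case using Suc.IH[of "b + A" "\<nu> + g"] Suc.prems by (simp add: algebra_simps)
qed

lemma relation_fails_D:
  assumes F: "relation_fails A B p n Y"
  shows "7 \<le> B * Y" "A ^ 2 dvd 2 + p * Y * n * (2 + (B * Y - 1) * (A * n)) \<Longrightarrow>
    \<not> A ^ 5 dvd 120 + p * Y * n * (120 + (B * Y - 1) * (A * n) * (60 + (B * Y - 2) * (A * n) * (20 + (B * Y - 3) * (A * n) * (5 + (B * Y - 4) * (A * n)))))"
proof -
  note F = F[unfolded relation_fails_def relation_2_5_fails_def]
  show h0: "7 \<le> B * Y" using F by (auto split: if_splits)
  assume d: "A ^ 2 dvd 2 + p * Y * n * (2 + (B * Y - 1) * (A * n))"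
  have "A * n - A * (n mod A) = A * A * (n div A)"
    by (simp only: minus_mod_eq_mult_div mult.assoc flip: right_diff_distrib)
  then have An: "[A * (n mod A) = A * n] (mod A * A)" by (simp add: cong_iff_dvd_diff dvd_diff_commute)
  have m: "[x mod (A * A) = x] (mod A * A)" for x by (simp add: cong_def)
  have "[2 + (p * Y mod (A * A)) * (n mod (A * A)) * (2 + (B * Y - 1) * (A * (n mod A))) = 2 + p * Y * n * (2 + (B * Y - 1) * (A * n))] (mod A * A)"
    by (intro cong_add cong_mult cong_refl An m)
  then have "(2 + (p * Y mod (A * A)) * (n mod (A * A)) * (2 + (B * Y - 1) * (A * (n mod A)))) mod (A * A) =
      (2 + p * Y * n * (2 + (B * Y - 1) * (A * n))) mod (A * A)" by (simp only: cong_def)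
  also have "\<dots> = 0" using d by (simp only: dvd_eq_mod_eq_0 power2_eq_square)
  finally have hX: "\<not> (2 + (p * Y mod (A * A)) * (n mod (A * A)) * (2 + (B * Y - 1) * (A * (n mod A)))) mod (A * A) \<noteq> 0" by (simp only: not_not)
  have h0': "\<not> B * Y < 7" using h0 by simp
  show "\<not> A ^ 5 dvd 120 + p * Y * n * (120 + (B * Y - 1) * (A * n) * (60 + (B * Y - 2) * (A * n) * (20 + (B * Y - 3) * (A * n) * (5 + (B * Y - 4) * (A * n)))))"
    using F[unfolded if_not_P[OF h0'] if_not_P[OF hX] relation_5_fails_def] unfolding dvd_eq_mod_eq_0 .
qed

lemma odd_index:
  assumes "(B::int) \<ge> 1" "B * (2 * i + 1) < M" "0 \<le> i" shows "i \<in> set [0..M div (2 * B)]"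
proof -
  have "(2 * B) * i \<le> M" using assms by (simp add: algebra_simps)
  then have "(2 * B) * i div (2 * B) \<le> M div (2 * B)" using assms by (intro zdiv_mono1) auto
  then show ?thesis using assms by simp
qed

lemma small_check_D:
  assumes chk: "small_check M A B f \<rho>" and b: "b = \<rho> + \<sigma> * A" "0 \<le> \<sigma>" "\<sigma> < B" "b \<ge> 2"
    and n: "n mod A = ((\<rho> ^ f - 1) div A + int f * \<rho> ^ (f - 1) * \<sigma>) mod A" "(b ^ f - 1) div A = n"
    and L: "A * B \<le> 1000000" and y: "b ^ y < A * B" "y \<ge> 1" and B: "B \<ge> 1"
    and Y: "Y = 2 * i + 1" "0 \<le> i" "B * Y < M" and rel: "A dvd 1 + b ^ y * Y * n"
  shows "relation_fails A B (b ^ y) n Y"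
proof -
  define s where "s = nat \<sigma>"
  have s: "\<sigma> = int s" using b by (simp add: s_def)
  have A0: "A > 0"
  proof (rule ccontr)
    assume "\<not> A > 0"
    then have "A * B \<le> 0" using B by (simp add: mult_nonpos_nonneg)
    moreover have "b ^ y > 0" using b by simp
    ultimately show False using y by linarith
  qed
  have "b ^ 1 \<le> b ^ y" using b y by (intro power_increasing) auto
  then have bL: "\<rho> + int s * A < A * B" using y b(1) unfolding power_one_right s by linarith
  have y20: "y < 20"
  proof (rule ccontr)
    assume "\<not> y < 20"
    then have "(2::int) ^ 20 \<le> 2 ^ y" by (intro power_increasing) auto
    also have "\<dots> \<le> b ^ y" using b by (intro power_mono) auto
    finally show False using y L by simp
  qed
  have nu: "((\<rho> ^ f - 1) div A + int f * \<rho> ^ (f - 1) mod A * int s) mod A = n mod A"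
    unfolding n(1) s by (rule mod_add_cong[OF refl mod_mult_left_eq])
  have "power_check 20 A B f b b (n mod A) (M div B) (A * B)"
    using base_check_D[OF chk[unfolded small_check_def] bL A0] unfolding nu unfolding s[symmetric] b(1)[symmetric] .
  from power_check_D[where i = 1 and t = 20, unfolded power_one_right, OF this y]
  have "odd_start A B f b (b ^ y) (b ^ y * (n mod A) mod A) (M div B)" using y20 b by simp
  note C = this[unfolded odd_start_def]
  define q where "q = b ^ y * n mod A"
  have qm: "b ^ y * (n mod A) mod A = q" unfolding q_def by (rule mod_mult_right_eq)
  have Yi: "Y = 1 + 2 * int (nat i)" using Y by simp
  have YH: "Y \<le> M div B"
  proof -
    have "B * Y div B \<le> M div B" using Y B by (intro zdiv_mono1) auto
    then show ?thesis using B by simp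
  qed
  have "[1 + q + 2 * q mod A * int (nat i) = 1 + b ^ y * n + 2 * (b ^ y * n) * int (nat i)] (mod A)"
    unfolding q_def by (intro cong_add cong_mult cong_refl) (simp_all add: cong_def mod_simps)
  moreover have "1 + b ^ y * n + 2 * (b ^ y * n) * int (nat i) = 1 + b ^ y * Y * n" unfolding Yi by (simp add: algebra_simps)
  ultimately have "A dvd 1 + q + 2 * q mod A * int (nat i)" using rel by (metis cong_dvd_iff)
  from odd_check_D[OF C[unfolded qm] _ this] YH
  show ?thesis unfolding n(2) Yi by simp
qed

lemma large_check_D:
  assumes chk: "large_check A B \<rho>" and b: "b = \<rho> + \<sigma> * A" "0 \<le> \<sigma>" "\<sigma> < B"
    and n: "[n = (\<rho> ^ 3 - 1) div A + 3 * \<rho> ^ 2 * \<sigma>] (mod A)" "(b ^ 3 - 1) div A = n" "[b ^ 3 = 1] (mod A)"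
    and A: "A \<ge> 8000" and B: "B \<ge> 1"
    and Y: "Y = 2 * i + 1" "0 \<le> i" "B * Y < 200" and rel: "A dvd 1 + b * Y * n"
  shows "relation_fails A B b n Y"
proof -
  define c where "c = \<rho> * ((\<rho> ^ 3 - 1) div A) mod A"
  define v where "v = (- 1 - c * Y) mod A"
  have "i \<in> set [0..200 div (2 * B)]" using B Y(2,3) unfolding Y(1) by (intro odd_index)
  note D = chk[unfolded large_check_def Let_def list_all_iff, THEN bspec, OF this, folded c_def Y(1), folded v_def]
  have C: "relation_fails A B (\<rho> + v div (3 * Y) * A) (((\<rho> + v div (3 * Y) * A) ^ 3 - 1) div A) Y"
    if v: "v < 3 * Y * B" "v mod (3 * Y) = 0"
    using D unfolding if_P[OF v(1)] if_P[OF v(2)] .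
  have Y1: "Y \<ge> 1" using Y by simp
  have Ys: "0 \<le> Y * \<sigma>" "Y * \<sigma> < Y * B" using b Y1 by simp_all
  have bc: "[b = \<rho>] (mod A)" unfolding b(1) by (simp add: cong_def)
  have r3: "[\<rho> ^ 3 = 1] (mod A)" using cong_trans[OF cong_sym[OF cong_pow[OF bc]] n(3)] .
  have "[1 + b * Y * n = 1 + \<rho> * Y * ((\<rho> ^ 3 - 1) div A + 3 * \<rho> ^ 2 * \<sigma>)] (mod A)"
    by (intro cong_add cong_mult cong_refl bc n(1))
  also have "1 + \<rho> * Y * ((\<rho> ^ 3 - 1) div A + 3 * \<rho> ^ 2 * \<sigma>) =
      1 + (\<rho> * ((\<rho> ^ 3 - 1) div A)) * Y + 3 * Y * \<sigma> * \<rho> ^ 3"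
    by (simp add: algebra_simps power2_eq_square power3_eq_cube)
  also have "[\<dots> = 1 + c * Y + 3 * Y * \<sigma> * 1] (mod A)"
    unfolding c_def by (intro cong_add cong_mult cong_refl r3) (simp add: cong_def)
  finally have "A dvd 1 + c * Y + 3 * Y * \<sigma> * 1" using rel by (metis cong_dvd_iff)
  then have "A dvd 3 * Y * \<sigma> - (- 1 - c * Y)" by (simp add: algebra_simps)
  then have "(3 * Y * \<sigma>) mod A = v" unfolding v_def by (simp add: mod_eq_dvd_iff)
  \<comment> \<open>There is no wraparound: \<open>3 * Y * \<sigma>\<close> is less than
    \<open>3 * Y * B\<close>, thus below 600 and below \<open>A\<close>.\<close>
  moreover have "(3 * Y * \<sigma>) mod A = 3 * Y * \<sigma>"
    using Ys Y(3) A mult.commute[of B Y] mult.assoc[of 3 Y \<sigma>] by (intro mod_pos_pos_trivial) linarith+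
  ultimately have v: "v = 3 * Y * \<sigma>" by simp
  have "v < 3 * Y * B" using Ys(2) unfolding v by simp
  moreover have "v mod (3 * Y) = 0" "v div (3 * Y) = \<sigma>" using Y1 unfolding v by simp_all
  ultimately show ?thesis using C n(2) by (simp only: b(1))
qed

context descent
begin

lemma not_relation_fails: "\<not> relation_fails A B (int b ^ y1) n (int Y')"
proof
  assume F: "relation_fails A B (int b ^ y1) n (int Y')"
  have "7 \<le> int N" using relation_fails_D(1)[OF F] N_int by simp
  then have N7: "N \<ge> 7" by simp
  have x3: "x2 \<ge> 3 * k + j"
  proof (cases "j = 0")
    case True
    have "3 * k \<le> N * k" using N7 by simp
    then show ?thesis using x2_gt True mult.commute[of k N] by linarith
  qed (use x2_ge[of 3] j_le N7 in simp)
  have "A ^ 2 dvd 2 + int b ^ y1 * int Y' * n * (2 + (int N - 1) * (A * n))"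
    by (rule relation_gen) (use x3 binomial_sums(2)[of N "A * n"] in simp_all)
  then show False using relation_fails_D(2)[OF F] relation_5[OF N7] unfolding N_int by blast
qed

text \<open>The first-order expansion of \<open>(\<rho> + \<sigma> * A) ^ n0\<close>; terms of order
  two in \<open>A\<close> disappear after division by \<open>A\<close>.\<close>

lemma quotient_mod:
  assumes "int b = \<rho> + \<sigma> * A"
  shows "n mod A = ((\<rho> ^ n0 - 1) div A + int n0 * \<rho> ^ (n0 - 1) * \<sigma>) mod A"
proof -
  have "\<rho> - int b dvd \<rho> ^ n0 - int b ^ n0" by (simp add: power_diff_sumr2)
  moreover have "\<rho> - int b = A * (- \<sigma>)" using assms by simp
  ultimately have "A dvd \<rho> ^ n0 - int b ^ n0" by (metis dvd_mult_left)
  then have "A dvd (\<rho> ^ n0 - int b ^ n0) + A * n" by simp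
  then have "A dvd \<rho> ^ n0 - 1" using n(1) by simp
  then obtain c0 where c0: "\<rho> ^ n0 - 1 = A * c0" by blast
  have A0: "A \<noteq> 0" using A_ge by linarith
  have c0': "(\<rho> ^ n0 - 1) div A = c0" unfolding c0 using A0 by (rule nonzero_mult_div_cancel_left)
  have "\<exists>e. A * n = A * (c0 + int n0 * \<rho> ^ (n0 - 1) * \<sigma> + A * e)"
  proof -
    have An: "A * n = (\<rho> + \<sigma> * A) ^ n0 - 1" using n(1) assms by simp
    from n0 show ?thesis
    proof
      assume "n0 = 1"
      then have "A * n = A * (c0 + int n0 * \<rho> ^ (n0 - 1) * \<sigma> + A * 0)" unfolding An using c0 by (simp add: algebra_simps)
      then show ?thesis by blast
    next
      assume 3: "n0 = 3"
      have c03: "\<rho> * (\<rho> * \<rho>) = 1 + A * c0" using c0 3 by (simp add: power3_eq_cube)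
      have "(\<rho> + \<sigma> * A) ^ n0 - 1 = \<rho> * (\<rho> * \<rho>) + A * (3 * \<rho> ^ 2 * \<sigma> + A * (3 * \<rho> * \<sigma>^2 + \<sigma>^3 * A)) - 1"
        unfolding 3 by (simp add: algebra_simps power2_eq_square power3_eq_cube)
      then have "A * n = A * (c0 + int n0 * \<rho> ^ (n0 - 1) * \<sigma> + A * (3 * \<rho> * \<sigma>^2 + \<sigma>^3 * A))"
        unfolding An c03 3 by (simp add: algebra_simps)
      then show ?thesis by blast
    qed
  qed
  then have "\<exists>e. n = c0 + int n0 * \<rho> ^ (n0 - 1) * \<sigma> + A * e" using A0 by (simp only: mult_cancel_left) blast
  then show ?thesis unfolding c0' by auto
qed

lemma n_eq: "(int b ^ n0 - 1) div A = n"
proof -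
  have "A \<noteq> 0" using A_ge by linarith
  then show ?thesis unfolding n(1) add_diff_cancel_left' by (rule nonzero_mult_div_cancel_left)
qed

lemma Y'_odd: obtains i where "int Y' = 2 * i + 1" "0 \<le> i"
proof -
  have "int Y' = 2 * int (Y' div 2) + 1" using Y'(2) by presburger
  then show ?thesis using that by simp
qed

lemma sigma_ex:
  assumes "A dvd int b - \<rho>" "0 \<le> \<rho>" "\<rho> < A"
  obtains \<sigma> where "int b = \<rho> + \<sigma> * A" "0 \<le> \<sigma>" "\<sigma> < B"
proof -
  obtain \<sigma> where s: "int b - \<rho> = A * \<sigma>" using assms(1) by blast
  have 0: "0 \<le> \<sigma>"
  proof (rule ccontr)
    assume "\<not> 0 \<le> \<sigma>"
    then have "A * \<sigma> \<le> A * (- 1)" using A_ge by (intro mult_left_mono) auto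
    then show False using s assms b1 by linarith
  qed
  have "A * \<sigma> < A * B" using s b_less assms(2) by linarith
  then have "\<sigma> < B" using mult_less_cancel_left_pos[of A \<sigma> B] A_ge by linarith
  then show ?thesis using that[of \<sigma>] s 0 by (simp add: algebra_simps)
qed

lemma small_check_False:
  assumes chk: "small_check M A B n0 \<rho>" and b': "int b = \<rho> + \<sigma> * A" "0 \<le> \<sigma>" "\<sigma> < B"
    and L: "A * B \<le> 1000000" and M: "int N < M" and nd: "n0 = 3 \<Longrightarrow> \<not> a dvd b - 1"
  shows False
proof -
  obtain i where i: "int Y' = 2 * i + 1" "0 \<le> i" by (rule Y'_odd)
  have "B * int Y' < M" using M N_int by simp
  from small_check_D[OF chk b' b1 quotient_mod[OF b'(1)] n_eq L power_b_less y1 B_ge i this relation_1[OF nd]]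
  show False using not_relation_fails by blast
qed

end

context descent_3
begin

text \<open>\<open>b\<close> is a root of X^2 + X + 1 modulo \<open>A\<close>. The two roots \<rho>
  and -1 - \<rho> differ modulo \<open>a\<close>, since the discriminant -3 is prime to
  \<open>a\<close>; hence the whole of \<open>A\<close> divides one of the two linear
  factors.\<close>

lemma root_cases:
  assumes \<rho>: "(\<rho> * \<rho> + \<rho> + 1) mod A = 0" "0 \<le> \<rho>" "\<rho> < A"
  obtains \<sigma> where "int b = \<rho> + \<sigma> * A" "0 \<le> \<sigma>" "\<sigma> < B"
  | \<sigma> where "int b = (A - 1 - \<rho>) + \<sigma> * A" "0 \<le> \<sigma>" "\<sigma> < B"
proof -
  have dr: "A dvd \<rho> * \<rho> + \<rho> + 1" using \<rho>(1) by (rule mod_0_imp_dvd)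
  have "A dvd A * m - (\<rho> * \<rho> + \<rho> + 1)" using dr by (intro dvd_diff) auto
  also have "A * m - (\<rho> * \<rho> + \<rho> + 1) = (int b - \<rho>) * (int b + \<rho> + 1)" unfolding mA by (simp add: algebra_simps power2_eq_square)
  finally have prod: "A dvd (int b - \<rho>) * (int b + \<rho> + 1)" .
  have pa: "prime (int a)" using a by simp
  have "\<not> (int a dvd int b - \<rho> \<and> int a dvd int b + \<rho> + 1)"
  proof
    assume "int a dvd int b - \<rho> \<and> int a dvd int b + \<rho> + 1"
    then have "int a dvd ((int b + \<rho> + 1) - (int b - \<rho>)) * (2 * \<rho> + 1)" by (simp only: dvd_diff dvd_mult2)
    moreover have "int a ^ 1 dvd A" using k by (rule le_imp_power_dvd)
    then have "int a dvd \<rho> * \<rho> + \<rho> + 1" using dr unfolding power_one_right by (rule dvd_trans)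
    then have "int a dvd 4 * (\<rho> * \<rho> + \<rho> + 1)" by (rule dvd_mult)
    ultimately have "int a dvd 4 * (\<rho> * \<rho> + \<rho> + 1) - ((int b + \<rho> + 1) - (int b - \<rho>)) * (2 * \<rho> + 1)" by (intro dvd_diff)
    also have "\<dots> = 3" by (simp add: algebra_simps)
    finally have "int a \<le> 3" by (rule zdvd_imp_le) simp
    then show False using a by simp
  qed
  then have "A dvd int b - \<rho> \<or> A dvd int b + \<rho> + 1"
  proof (cases "int a dvd int b - \<rho>")
    case False
    then have "coprime A (int b - \<rho>)" using pa by (simp add: prime_imp_coprime)
    then show ?thesis using prod by (simp add: coprime_dvd_mult_right_iff)
  next
    case True
    then have "coprime A (int b + \<rho> + 1)" using pa \<open>\<not> (_ \<and> _)\<close> by (simp add: prime_imp_coprime)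
    then show ?thesis using prod by (simp add: coprime_dvd_mult_left_iff)
  qed
  then show ?thesis
  proof
    assume "A dvd int b - \<rho>"
    then show ?thesis using sigma_ex[OF _ \<rho>(2,3)] that(1) by metis
  next
    assume "A dvd int b + \<rho> + 1"
    then have "A dvd (int b + \<rho> + 1) - A" by simp
    then have "A dvd int b - (A - 1 - \<rho>)" by (simp add: algebra_simps)
    moreover have "0 \<le> A - 1 - \<rho>" "A - 1 - \<rho> < A" using \<rho> by linarith+
    ultimately show ?thesis using sigma_ex[of "A - 1 - \<rho>"] that(2) by metis
  qed
qed

lemma large_check_False:
  assumes chk: "large_check A B \<rho>" and b': "int b = \<rho> + \<sigma> * A" "0 \<le> \<sigma>" "\<sigma> < B"
    and A8: "A \<ge> 8000" and N: "N < 200" and y1: "y1 = 1"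
  shows False
proof -
  obtain i where i: "int Y' = 2 * i + 1" "0 \<le> i" by (rule Y'_odd)
  have BY: "B * int Y' < 200" using N N_int by simp
  have nc: "[n = (\<rho> ^ 3 - 1) div A + 3 * \<rho> ^ 2 * \<sigma>] (mod A)"
    using quotient_mod[OF b'(1)] n03 by (simp add: cong_def)
  have b3: "[int b ^ 3 = 1] (mod A)" using n(1) n03 by (simp add: cong_iff_dvd_diff)
  have "A dvd 1 + int b * int Y' * n" using relation_1 bna y1 by simp
  from large_check_D[OF chk b' nc n_eq[unfolded n03] b3 A8 B_ge i BY this]
  show False using not_relation_fails unfolding y1 power_one_right by blast
qed

end

lemma (in descent) small_cases_False:
  assumes chk: "small_cases M (int a) k j \<rho>" and M: "int N < M" and nd: "n0 = 3 \<Longrightarrow> \<not> a dvd b - 1"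
  shows False
proof -
  note chk = chk[unfolded small_cases_def]
  have L: "A * B \<le> 1000000" using chk by blast
  show False
  proof (cases "n0 = 1")
    case True
    then have "A dvd int b - 1" using n(1) by simp
    then obtain \<sigma> where "int b = 1 + \<sigma> * A" "0 \<le> \<sigma>" "\<sigma> < B" by (rule sigma_ex) (use A_ge in linarith)+
    then show False using small_check_False[of M 1 \<sigma>] chk True L M nd by metis
  next
    case False
    then have n03: "n0 = 3" using n0 by simp
    obtain m where "A * m = int b ^ 2 + int b + 1" "m > 0" "n = (int b - 1) * m" using n0_3_factor[OF n03 nd[OF n03]] by metis
    then interpret descent_3 a b c n0 k j N Y' x2 y1 n m using n03 nd by unfold_locales auto
    have r: "(\<rho> * \<rho> + \<rho> + 1) mod A = 0" "0 \<le> \<rho>" "\<rho> < A" using chk by blast+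
    show False
    proof (rule root_cases[OF r])
      fix \<sigma> assume "int b = \<rho> + \<sigma> * A" "0 \<le> \<sigma>" "\<sigma> < B"
      then show False using small_check_False[of M \<rho> \<sigma>] chk n03 L M nd by metis
    next
      fix \<sigma> assume "int b = (A - 1 - \<rho>) + \<sigma> * A" "0 \<le> \<sigma>" "\<sigma> < B"
      then show False using small_check_False[of M "A - 1 - \<rho>" \<sigma>] chk n03 L M nd by metis
    qed
  qed
qed

lemma (in descent_3) large_cases_False:
  assumes chk: "large_cases (int a) k js \<rho>" and j: "j \<in> set js"
    and A8: "A \<ge> 8000" and N: "N < 200" and y1: "y1 = 1"
  shows False
proof -
  note chk = chk[unfolded large_cases_def list_all_iff]
  have r: "(\<rho> * \<rho> + \<rho> + 1) mod A = 0" "0 \<le> \<rho>" "\<rho> < A" using chk by blast+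
  have l: "large_check A B \<rho>" "large_check A B (A - 1 - \<rho>)" using chk j by blast+
  show False
    by (rule root_cases[OF r]) (use l large_check_False[OF _ _ _ _ A8 N y1] in blast)+
qed

section \<open>The finite tables\<close>

text \<open>In this and the following tables, \<rho> is a root of X^2 + X + 1 modulo
  \<open>a ^ k\<close>, \<open>k\<close> ranges over 8000 \<le> a^k \<le> 512806639228, and the list
  contains the \<open>j\<close> with a^j < 200.\<close>

lemma large_cases_7:
  assumes "k \<in> {5,6,7,8,9,10,11,12,13}" shows "\<exists>\<rho>. large_cases 7 k [0,1,2] \<rho>"
proof -
  have k5: "large_cases 7 5 [0,1,2] 1353" by code_simp
  have k6: "large_cases 7 6 [0,1,2] 34967" by code_simp
  have k7: "large_cases 7 7 [0,1,2] 82681" by code_simp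
  have k8: "large_cases 7 8 [0,1,2] 2387947" by code_simp
  have k9: "large_cases 7 9 [0,1,2] 14906455" by code_simp
  have k10: "large_cases 7 10 [0,1,2] 135967276" by code_simp
  have k11: "large_cases 7 11 [0,1,2] 700917774" by code_simp
  have k12: "large_cases 7 12 [0,1,2] 4655571260" by code_simp
  have k13: "large_cases 7 13 [0,1,2] 18496858461" by code_simp
  show ?thesis using assms k5 k6 k7 k8 k9 k10 k11 k12 k13 by blast
qed

lemma large_cases_13:
  assumes "k \<in> {4,5,6,7,8,9,10}" shows "\<exists>\<rho>. large_cases 13 k [0,1,2] \<rho>"
proof -
  have k4: "large_cases 13 4 [0,1,2] 7627" by code_simp
  have k5: "large_cases 13 5 [0,1,2] 150432" by code_simp
  have k6: "large_cases 13 6 [0,1,2] 963446" by code_simp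
  have k7: "large_cases 13 7 [0,1,2] 20270682" by code_simp
  have k8: "large_cases 13 8 [0,1,2] 271264750" by code_simp
  have k9: "large_cases 13 9 [0,1,2] 3807388854" by code_simp
  have k10: "large_cases 13 10 [0,1,2] 46225386346" by code_simp
  show ?thesis using assms k4 k5 k6 k7 k8 k9 k10 by blast
qed

lemma large_cases_97:
  assumes "k \<in> {2,3,4,5}" shows "\<exists>\<rho>. large_cases 97 k [0,1] \<rho>"
proof -
  have k2: "large_cases 97 2 [0,1] 4620" by code_simp
  have k3: "large_cases 97 3 [0,1] 61074" by code_simp
  have k4: "large_cases 97 4 [0,1] 43869378" by code_simp
  have k5: "large_cases 97 5 [0,1] 2789067613" by code_simp
  show ?thesis using assms k2 k3 k4 k5 by blast
qed

lemma large_cases_193: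
  assumes "k \<in> {2,3,4,5}" shows "\<exists>\<rho>. large_cases 193 k [0,1] \<rho>"
proof -
  have k2: "large_cases 193 2 [0,1] 17454" by code_simp
  have k3: "large_cases 193 3 [0,1] 168790" by code_simp
  have k4: "large_cases 193 4 [0,1] 373999754" by code_simp
  have k5: "large_cases 193 5 [0,1] 3788464248" by code_simp
  show ?thesis using assms k2 k3 k4 k5 by blast
qed

lemma large_cases_769:
  assumes "k \<in> {2,3,4}" shows "\<exists>\<rho>. large_cases 769 k [0] \<rho>"
proof -
  have k2: "large_cases 769 2 [0] 286428" by code_simp
  have k3: "large_cases 769 3 [0] 222046803" by code_simp
  have k4: "large_cases 769 4 [0] 3416006068" by code_simp
  show ?thesis using assms k2 k3 k4 by blast
qed

lemma large_cases_12289: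
  assumes "k \<in> {1,2}" shows "\<exists>\<rho>. large_cases 12289 k [0] \<rho>"
proof -
  have k1: "large_cases 12289 1 [0] 6048" by code_simp
  have k2: "large_cases 12289 2 [0] 74919792" by code_simp
  show ?thesis using assms k1 k2 by blast
qed

lemma large_cases_786433:
  assumes "k \<in> {1}" shows "\<exists>\<rho>. large_cases 786433 k [0] \<rho>"
proof -
  have k1: "large_cases 786433 1 [0] 392448" by code_simp
  show ?thesis using assms k1 by blast
qed

lemma large_cases_3221225473:
  assumes "k \<in> {1}" shows "\<exists>\<rho>. large_cases 3221225473 k [0] \<rho>"
proof -
  have k1: "large_cases 3221225473 1 [0] 1610563584" by code_simp
  show ?thesis using assms k1 by blast
qed

lemma large_cases_206158430209:
  assumes "k \<in> {1}" shows "\<exists>\<rho>. large_cases 206158430209 k [0] \<rho>"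
proof -
  have k1: "large_cases 206158430209 1 [0] 103078821888" by code_simp
  show ?thesis using assms k1 by blast
qed

text \<open>The cases with \<open>a ^ k < 8000\<close>. The bound is 2190 when \<open>a ^ k\<close>
  is 7 or 13 and 750 otherwise, and \<open>j\<close> ranges over the exponents with
  \<open>a ^ j\<close> below it. The pairs \<open>k = 1\<close>, \<open>j = 0\<close> for 7 and 13
  are left to \<open>minimal_False\<close>.\<close>

lemma small_cases_7_1_1: "small_cases 2190 7 1 1 2" by code_simp
lemma small_cases_7_1_2: "small_cases 2190 7 1 2 2" by code_simp
lemma small_cases_7_1_3: "small_cases 2190 7 1 3 2" by code_simp
lemma small_cases_7_2_0: "small_cases 750 7 2 0 18" by code_simp
lemma small_cases_7_2_1: "small_cases 750 7 2 1 18" by code_simp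
lemma small_cases_7_2_2: "small_cases 750 7 2 2 18" by code_simp
lemma small_cases_7_2_3: "small_cases 750 7 2 3 18" by code_simp
lemma small_cases_7_3_0: "small_cases 750 7 3 0 18" by code_simp
lemma small_cases_7_3_1: "small_cases 750 7 3 1 18" by code_simp
lemma small_cases_7_3_2: "small_cases 750 7 3 2 18" by code_simp
lemma small_cases_7_3_3: "small_cases 750 7 3 3 18" by code_simp
lemma small_cases_7_4_0: "small_cases 750 7 4 0 1047" by code_simp
lemma small_cases_7_4_1: "small_cases 750 7 4 1 1047" by code_simp
lemma small_cases_7_4_2: "small_cases 750 7 4 2 1047" by code_simp
lemma small_cases_7_4_3: "small_cases 750 7 4 3 1047" by code_simp

lemmas small_cases_7_first = small_cases_7_1_1 small_cases_7_1_2 small_cases_7_1_3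
lemmas small_cases_7 = small_cases_7_2_0 small_cases_7_2_1 small_cases_7_2_2 small_cases_7_2_3 small_cases_7_3_0 small_cases_7_3_1 small_cases_7_3_2 small_cases_7_3_3 small_cases_7_4_0 small_cases_7_4_1 small_cases_7_4_2 small_cases_7_4_3

lemma small_cases_13_1_1: "small_cases 2190 13 1 1 3" by code_simp
lemma small_cases_13_1_2: "small_cases 2190 13 1 2 3" by code_simp
lemma small_cases_13_2_0: "small_cases 750 13 2 0 22" by code_simp
lemma small_cases_13_2_1: "small_cases 750 13 2 1 22" by code_simp
lemma small_cases_13_2_2: "small_cases 750 13 2 2 22" by code_simp
lemma small_cases_13_3_0: "small_cases 750 13 3 0 1036" by code_simp
lemma small_cases_13_3_1: "small_cases 750 13 3 1 1036" by code_simp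
lemma small_cases_13_3_2: "small_cases 750 13 3 2 1036" by code_simp

lemmas small_cases_13_first = small_cases_13_1_1 small_cases_13_1_2
lemmas small_cases_13 = small_cases_13_2_0 small_cases_13_2_1 small_cases_13_2_2 small_cases_13_3_0 small_cases_13_3_1 small_cases_13_3_2

lemma small_cases_97_1_0: "small_cases 750 97 1 0 35" by code_simp
lemma small_cases_97_1_1: "small_cases 750 97 1 1 35" by code_simp


lemma small_cases_193_1_0: "small_cases 750 193 1 0 84" by code_simp
lemma small_cases_193_1_1: "small_cases 750 193 1 1 84" by code_simp


lemma small_cases_769_1_0: "small_cases 750 769 1 0 360" by code_simp

section \<open>From two solutions of opposite parity to the congruences\<close>

text \<open>The order of \<open>b\<close> divides the odd number \<open>Y\<close> and, by Fermat,
  \<open>2 ^ r * 3\<close>.\<close>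

lemma cube_cong_one:
  fixes a b r Y :: nat
  assumes a: "prime a" "a = 2 ^ r * 3 + 1" and ab: "coprime a b" and Y: "odd Y" "[b ^ Y = 1] (mod a)"
  shows "[b ^ 3 = 1] (mod a)"
proof -
  have "\<not> a dvd b" using a(1) ab by (metis coprime_absorb_left not_prime_unit)
  then have "[b ^ (a - 1) = 1] (mod a)" using a(1) fermat_theorem by blast
  then have "ord a b dvd a - 1" by (simp only: ord_divides)
  moreover have "a - 1 = 2 ^ r * 3" using a(2) by simp
  ultimately have "ord a b dvd 2 ^ r * 3" by (simp only:)
  moreover have dY: "ord a b dvd Y" using Y(2) by (simp only: ord_divides)
  have "odd (ord a b)" using dY Y(1) dvd_trans by blast
  then have "coprime (ord a b) (2 ^ r)" by simp
  ultimately have "ord a b dvd 3" by (simp add: coprime_dvd_mult_right_iff)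
  then show ?thesis by (simp only: ord_divides)
qed

text \<open>\<open>n0\<close> is the order of \<open>b\<close> modulo \<open>a\<close>. The exponent
  of \<open>a\<close> in \<open>b ^ (y2 - y1) - 1\<close> is computed twice: the difference of the
  equations shows it to be \<open>x1\<close>, lifting the exponent shows it to be
  \<open>k + j\<close>.\<close>

lemma descent_exists:
  fixes a b c x1 x2 y1 y2 :: nat
  assumes a: "prime a" "a \<ge> 7" "a mod 3 = 1" and b: "b > 1" and c: "c > 0"
    and cop: "coprime a b" "coprime a c"
    and e1: "b ^ y1 + c = a ^ x1" and e2: "b ^ y2 + c = a ^ x2"
    and x: "x1 < x2" and y: "0 < y1" "y1 < y2" and par: "odd (y2 - y1)"
    and cube: "[b ^ (y2 - y1) = 1] (mod a) \<Longrightarrow> [b ^ 3 = 1] (mod a)"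
  obtains n0 k j N Y' n where "descent a b c n0 k j N Y' x2 y1 n" "x1 = k + j" "y2 = y1 + n0 * N" "n0 = 3 \<Longrightarrow> \<not> a dvd b - 1"
proof -
  define Y where "Y = y2 - y1"
  define D where "D = int b ^ Y - 1"
  have pa: "prime (int a)" using a(1) by simp
  have ia: "int a > 1" using a(2) by simp
  have y2: "y2 = y1 + Y" using y by (simp add: Y_def)
  have nab: "\<not> a dvd b" using a(1) cop(1) by (metis coprime_absorb_left not_prime_unit)
  have D: "int b ^ y1 * D = int a ^ x1 * (int a ^ (x2 - x1) - 1)"
  proof -
    have "int (b ^ y1 + c) = int (a ^ x1)" "int (b ^ (y1 + Y) + c) = int (a ^ x2)" using e1 e2 y2 by simp_all
    moreover have "int a ^ x2 = int a ^ x1 * int a ^ (x2 - x1)" using x by (simp flip: power_add)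
    ultimately show ?thesis unfolding D_def by (simp add: power_add algebra_simps)
  qed
  have cpb: "coprime (int a ^ i) (int b ^ y1)" for i using cop(1) by simp
  have D1: "int a ^ x1 dvd D" using D cpb[of x1] by (metis coprime_dvd_mult_right_iff dvd_triv_left)
  have D2: "\<not> int a ^ (x1 + 1) dvd D"
  proof
    assume "int a ^ (x1 + 1) dvd D"
    then have "int a ^ x1 * int a dvd int a ^ x1 * (int a ^ (x2 - x1) - 1)" using D by (metis dvd_mult power_add power_one_right)
    then have "int a dvd int a ^ (x2 - x1) - 1" using ia by simp
    moreover have "int a dvd int a ^ (x2 - x1)" using x by (simp add: dvd_power)
    ultimately have "int a dvd int a ^ (x2 - x1) - (int a ^ (x2 - x1) - 1)" by (rule dvd_diff[rotated])
    then show False using ia by simp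
  qed
  have x1: "x1 \<ge> 1"
  proof (rule ccontr)
    assume "\<not> x1 \<ge> 1"
    then have "b ^ y1 + c = 1" using e1 by simp
    moreover have "b ^ y1 > 0" using b by simp
    ultimately show False using c by linarith
  qed
  have "int a ^ 1 dvd int a ^ x1" using x1 by (rule le_imp_power_dvd)
  then have "int a dvd D" using D1 unfolding power_one_right by (rule dvd_trans)
  then have bY: "[b ^ Y = 1] (mod a)" unfolding D_def by (simp add: cong_iff_dvd_diff flip: cong_int_iff)
  then have o3: "ord a b dvd 3" using cube[folded Y_def] by (simp only: ord_divides)
  have oY: "ord a b dvd Y" using bY by (simp only: ord_divides)
  have o1: "ord a b = 1 \<longleftrightarrow> a dvd b - 1"
  proof -
    have "ord a b = 1 \<longleftrightarrow> [b ^ 1 = 1] (mod a)" by (simp only: ord_divides nat_dvd_1_iff_1)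
    also have "\<dots> \<longleftrightarrow> a dvd b - 1" using cong_altdef_nat[of 1 b a] b by simp
    finally show ?thesis .
  qed
  define n0 where "n0 = ord a b"
  have n0: "n0 = 1 \<or> n0 = 3"
  proof -
    have "prime (3::nat)" by simp
    then show ?thesis using o3 unfolding prime_nat_iff n0_def by blast
  qed
  have n0d: "n0 = 3 \<Longrightarrow> \<not> a dvd b - 1" using o1 by (simp add: n0_def)
  have n0p: "n0 > 0" using n0 by auto
  obtain N where N: "Y = n0 * N" using oY by (auto simp: n0_def)
  have Npos: "N > 0"
  proof (rule ccontr)
    assume "\<not> N > 0"
    then have "Y = 0" using N by simp
    then show False using y by (simp add: Y_def)
  qed
  define E where "E = b ^ n0 - 1"
  have bn: "b ^ n0 > 1" using b n0p by (metis one_less_power)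
  have E: "E > 0" "b ^ n0 = 1 + E" using bn by (simp_all add: E_def)
  have "[b ^ n0 = 1] (mod a)" by (simp only: ord_divides n0_def dvd_refl)
  then have aE: "a dvd E" unfolding E_def using bn cong_altdef_nat[of 1 "b ^ n0" a] by simp
  obtain n' where n': "E = a ^ multiplicity a E * n'" "\<not> a dvd n'"
    by (rule multiplicity_decompose'[of E a]) (use E a in auto)
  define k where "k = multiplicity a E"
  have k: "E = a ^ k * n'" "k \<ge> 1"
  proof -
    show Ek: "E = a ^ k * n'" using n'(1) by (simp only: k_def)
    have "k \<noteq> 0"
    proof
      assume "k = 0"
      then have "E = n'" using Ek by simp
      then show False using aE n'(2) by simp
    qed
    then show "k \<ge> 1" by simp
  qed
  obtain Y' where Y': "N = a ^ multiplicity a N * Y'" "\<not> a dvd Y'"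
    by (rule multiplicity_decompose'[of N a]) (use Npos a in auto)
  define j where "j = multiplicity a N"
  have j: "N = a ^ j * Y'" using Y' by (simp add: j_def)
  have "odd Y" using par unfolding Y_def .
  then have oddY': "odd Y'" using N j by simp
  have ndvd: "\<not> int a dvd int Y' * int n'" using Y'(2) n'(2) pa by (simp add: prime_dvd_mult_iff)
  have bnz: "int b ^ n0 = 1 + int a ^ k * int n'"
  proof -
    have "int (b ^ n0) = int (1 + a ^ k * n')" using E k by simp
    then show ?thesis by simp
  qed
  \<comment> \<open>Truncation after the linear term is lifting the exponent: modulo
    \<open>a ^ (k + j + 1)\<close>, \<open>D\<close> is \<open>a ^ (k + j)\<close> times a number
    prime to \<open>a\<close>.\<close>
  have "int a ^ ((1 + 1) * k + j) dvd (1 + int a ^ k * int n') ^ N - (\<Sum>i\<le>1. int (N choose i) * (int a ^ k * int n') ^ i)"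
    by (rule binomial_congruence) (use a k j in auto)
  moreover have "(1 + int a ^ k * int n') ^ N = int b ^ Y" unfolding bnz[symmetric] N power_mult ..
  then have "(1 + int a ^ k * int n') ^ N - (\<Sum>i\<le>1. int (N choose i) * (int a ^ k * int n') ^ i) = D - int N * (int a ^ k * int n')"
    unfolding binomial_sums(1) D_def by simp
  moreover have "int N * (int a ^ k * int n') = int a ^ (k + j) * (int Y' * int n')" unfolding j by (simp add: power_add)
  ultimately have l: "int a ^ ((1 + 1) * k + j) dvd D - int a ^ (k + j) * (int Y' * int n')" by (simp only:)
  have "int a ^ (k + j + 1) dvd int a ^ ((1 + 1) * k + j)" using k(2) by (intro le_imp_power_dvd) simp
  then have lte: "int a ^ (k + j + 1) dvd D - int a ^ (k + j) * (int Y' * int n')" using l by (rule dvd_trans)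
  have kj: "int a ^ (k + j) dvd D"
  proof -
    have "int a ^ (k + j) dvd D - int a ^ (k + j) * (int Y' * int n')" by (rule dvd_trans[OF _ lte]) (intro le_imp_power_dvd, simp)
    then have "int a ^ (k + j) dvd (D - int a ^ (k + j) * (int Y' * int n')) + int a ^ (k + j) * (int Y' * int n')" by (intro dvd_add) auto
    then show ?thesis by simp
  qed
  have kj1: "\<not> int a ^ (k + j + 1) dvd D"
  proof
    assume "int a ^ (k + j + 1) dvd D"
    then have "int a ^ (k + j + 1) dvd D - (D - int a ^ (k + j) * (int Y' * int n'))" using lte by (rule dvd_diff)
    moreover have "D - (D - int a ^ (k + j) * (int Y' * int n')) = int a ^ (k + j) * (int Y' * int n')" by simp
    ultimately have "int a ^ (k + j) * int a dvd int a ^ (k + j) * (int Y' * int n')" by (simp only: power_add power_one_right)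
    then show False using ndvd ia by simp
  qed
  have x1kj: "x1 = k + j"
  proof (rule antisym)
    show "x1 \<le> k + j"
    proof (rule ccontr)
      assume "\<not> x1 \<le> k + j"
      then have "int a ^ (k + j + 1) dvd int a ^ x1" by (intro le_imp_power_dvd) simp
      then show False using D1 kj1 dvd_trans by blast
    qed
    show "k + j \<le> x1"
    proof (rule ccontr)
      assume "\<not> k + j \<le> x1"
      then have "int a ^ (x1 + 1) dvd int a ^ (k + j)" by (intro le_imp_power_dvd) simp
      then show False using D2 kj dvd_trans by blast
    qed
  qed
  have n'a: "\<not> int a dvd int n'" using n'(2) by (simp only: int_dvd_int_iff not_False_eq_True)
  have y1': "y1 \<ge> 1" using y by simp
  have e1': "b ^ y1 + c = a ^ (k + j)" using e1 by (simp only: x1kj)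
  have e2': "b ^ (y1 + n0 * N) + c = a ^ x2" using e2 by (simp only: y2 N)
  have "descent a b c n0 k j N Y' x2 y1 (int n')"
    by (rule descent.intro) fact+
  then show ?thesis using that x1kj y2 N n0d by blast
qed

section \<open>Case distinction by the size of A\<close>

lemma exp_85: "exp (85 / 10 :: real) \<le> 8000"
proof -
  have "exp (17 / 256 :: real) \<le> 10709 / 10000"
    by (rule order_trans[OF exp_bound]) (simp_all add: power2_eq_square)
  then have "exp (17 / 128 :: real) \<le> 11469 / 10000" by (rule exp_upper_double) simp_all
  then have "exp (17 / 64 :: real) \<le> 13154 / 10000" by (rule exp_upper_double) simp_all
  then have "exp (17 / 32 :: real) \<le> 17303 / 10000" by (rule exp_upper_double) simp_all
  then have "exp (17 / 16 :: real) \<le> 29940 / 10000" by (rule exp_upper_double) simp_all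
  then have "exp (17 / 8 :: real) \<le> 89641 / 10000" by (rule exp_upper_double) simp_all
  then have "exp (17 / 4 :: real) \<le> 80356 / 1000" by (rule exp_upper_double) simp_all
  then show ?thesis by (rule exp_upper_double) simp_all
qed

lemma exp_386: "exp (386 / 100 :: real) \<le> 49"
  using exp_193 by (rule exp_upper_double) simp_all

lemma exponent_bounds:
  assumes "(7::int) \<le> a"
  shows "L \<le> a ^ k \<Longrightarrow> a ^ l < L \<Longrightarrow> l < k" "a ^ k \<le> U \<Longrightarrow> U < a ^ h \<Longrightarrow> k < h"
proof -
  assume "L \<le> a ^ k" "a ^ l < L"
  then have "a ^ l < a ^ k" by linarith
  then show "l < k" by (rule power_less_imp_less_exp[rotated]) (use assms in simp)
next
  assume "a ^ k \<le> U" "U < a ^ h"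
  then have "a ^ k < a ^ h" by linarith
  then show "k < h" by (rule power_less_imp_less_exp[rotated]) (use assms in simp)
qed

context descent
begin

lemma padic: "padic_setup a b c N k j n0 y1 (k + j) x2"
proof (rule padic_setup.intro)
  show "int a ^ k dvd int b ^ n0 - 1" using n(1) by simp
  show "a ^ j \<le> N" using Y' Y'_pos by simp
qed (use a b c cop n0 k e1 e2 in auto)

lemma ell_ge:
  assumes "exp t \<le> L" "L \<le> real (a ^ k)" shows "t \<le> padic_setup.ell a k"
proof -
  have "exp t \<le> real a ^ k" using assms by simp
  then have "t \<le> ln (real a ^ k)" using a by (subst ln_ge_iff) auto
  then show ?thesis unfolding padic_setup.ell_def[OF padic] using a by (simp add: ln_realpow)
qed

lemma real_A: "int L \<le> A \<Longrightarrow> real L \<le> real (a ^ k)"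
  by (simp only: of_nat_le_iff flip: of_nat_power)

lemma N_bounds:
  shows "A \<ge> 8000 \<Longrightarrow> N < 200" and "A \<ge> 49 \<Longrightarrow> N < 750" and "a = 13 \<Longrightarrow> N < 2190" and "a = 7 \<Longrightarrow> k = 1 \<Longrightarrow> N < 2190"
proof -
  show "N < 200" if "A \<ge> 8000"
    using padic_setup.N_less_200[OF padic ell_ge[OF exp_85]] real_A[of 8000] that by simp
  show "N < 750" if "A \<ge> 49"
    using padic_setup.N_less_750[OF padic ell_ge[OF exp_386]] real_A[of 49] that by simp
  show "N < 2190" if a13: "a = 13"
  proof -
    have "a ^ 1 \<le> a ^ k" using k a by (intro power_increasing) auto
    then have "13 \<le> real (a ^ k)" using a13 by (metis of_nat_le_iff of_nat_numeral power_one_right)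
    moreover have "exp (127 / 50) \<le> (13::real)" using exp_254 by linarith
    then have "exp (254 / 100) \<le> (13::real)" by simp
    ultimately show ?thesis using padic_setup.N_less_2190[OF padic ell_ge] by blast
  qed
  show "N < 2190" if "a = 7" "k = 1"
    using padic_setup.N_less_2190_base_7[OF padic that] .
qed

lemma a_le_A: "int a \<le> A"
proof -
  have "int a ^ 1 \<le> A" using k a by (intro power_increasing) auto
  then show ?thesis unfolding power_one_right .
qed

lemma B_le_N: "a ^ j \<le> N" using Y' Y'_pos by simp

lemma j_less: assumes "N < M" "M \<le> a ^ h" shows "j < h"
proof -
  have "a ^ j < a ^ h" using B_le_N assms by linarith
  then show ?thesis by (rule power_less_imp_less_exp[rotated]) (use a in simp)
qed

lemma large_False:
  assumes r: "r \<in> exceptional_exponents" "a = 2 ^ r * 3 + 1" and nd: "n0 = 3 \<Longrightarrow> \<not> a dvd b - 1"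
    and A8: "A \<ge> 8000"
  shows False
proof -
  have N: "N < 200" by (rule N_bounds(1)[OF A8])
  have n03: "n0 = 3" using n0 n0_1_small A8 N by fastforce
  obtain m where "A * m = int b ^ 2 + int b + 1" "m > 0" "n = (int b - 1) * m" using n0_3_factor[OF n03 nd[OF n03]] by metis
  then interpret descent_3 a b c n0 k j N Y' x2 y1 n m using n03 nd by unfold_locales auto
  have y1: "y1 = 1" by (rule y1_eq_1[OF A8 N])
  have U: "A \<le> 512806639228" by (rule A_le[OF A8 N y1])
  have lc: False if "large_cases (int a) k js \<rho>" "j \<in> set js" for js \<rho>
    by (rule large_cases_False[OF that A8 N y1])
  have ia: "(7::int) \<le> int a" using a by simp
  note lower = exponent_bounds(1)[OF ia A8] and upper = exponent_bounds(2)[OF ia U]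
  have aU: "int a \<le> 512806639228" using U a_le_A by linarith
  \<comment> \<open>3 * 2^41 exceeds the bound for \<open>A\<close>, hence for \<open>a\<close>. All
    exponents of the list from 41 on are excluded by size; those below give the nine primes.\<close>
  have "r < 41"
  proof (rule ccontr)
    assume "\<not> r < 41"
    then have "(2::int) ^ 41 \<le> 2 ^ r" by (intro power_increasing) auto
    moreover have "int a = 2 ^ r * 3 + 1" using r(2) by simp
    ultimately show False using aU by simp
  qed
  then consider "a = 7" | "a = 13" | "a = 97" | "a = 193" | "a = 769" | "a = 12289" | "a = 786433" | "a = 3221225473" | "a = 206158430209"
    using r unfolding exceptional_exponents_def by auto
  then show False
  proof cases
    case 1
    have "4 < k" by (rule lower) (simp add: 1)
    moreover have "k < 14" by (rule upper) (simp add: 1)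
    ultimately have "k \<in> {5,6,7,8,9,10,11,12,13}" unfolding insert_iff empty_iff by presburger
    then obtain \<rho> where lk: "large_cases 7 k [0,1,2] \<rho>" using large_cases_7 by blast
    have "j < 3" using j_less[OF N, of 3] by (simp add: 1)
    then have "j = 0 \<or> j = 1 \<or> j = 2" by linarith
    then have jl: "j \<in> set [0,1,2]" by auto
    show False by (rule lc[OF _ jl, of \<rho>]) (use lk 1 in simp)
  next
    case 2
    have "3 < k" by (rule lower) (simp add: 2)
    moreover have "k < 11" by (rule upper) (simp add: 2)
    ultimately have "k \<in> {4,5,6,7,8,9,10}" unfolding insert_iff empty_iff by presburger
    then obtain \<rho> where lk: "large_cases 13 k [0,1,2] \<rho>" using large_cases_13 by blast
    have "j < 3" using j_less[OF N, of 3] by (simp add: 2)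
    then have "j = 0 \<or> j = 1 \<or> j = 2" by linarith
    then have jl: "j \<in> set [0,1,2]" by auto
    show False by (rule lc[OF _ jl, of \<rho>]) (use lk 2 in simp)
  next
    case 3
    have "1 < k" by (rule lower) (simp add: 3)
    moreover have "k < 6" by (rule upper) (simp add: 3)
    ultimately have "k \<in> {2,3,4,5}" unfolding insert_iff empty_iff by presburger
    then obtain \<rho> where lk: "large_cases 97 k [0,1] \<rho>" using large_cases_97 by blast
    have "j < 2" using j_less[OF N, of 2] by (simp add: 3)
    then have "j = 0 \<or> j = 1" by linarith
    then have jl: "j \<in> set [0,1]" by auto
    show False by (rule lc[OF _ jl, of \<rho>]) (use lk 3 in simp)
  next
    case 4
    have "1 < k" by (rule lower) (simp add: 4)
    moreover have "k < 6" by (rule upper) (simp add: 4)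
    ultimately have "k \<in> {2,3,4,5}" unfolding insert_iff empty_iff by presburger
    then obtain \<rho> where lk: "large_cases 193 k [0,1] \<rho>" using large_cases_193 by blast
    have "j < 2" using j_less[OF N, of 2] by (simp add: 4)
    then have "j = 0 \<or> j = 1" by linarith
    then have jl: "j \<in> set [0,1]" by auto
    show False by (rule lc[OF _ jl, of \<rho>]) (use lk 4 in simp)
  next
    case 5
    have "1 < k" by (rule lower) (simp add: 5)
    moreover have "k < 5" by (rule upper) (simp add: 5)
    ultimately have "k \<in> {2,3,4}" unfolding insert_iff empty_iff by presburger
    then obtain \<rho> where lk: "large_cases 769 k [0] \<rho>" using large_cases_769 by blast
    have "j < 1" using j_less[OF N, of 1] by (simp add: 5)
    then have "j = 0" by linarith
    then have jl: "j \<in> set [0]" by auto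
    show False by (rule lc[OF _ jl, of \<rho>]) (use lk 5 in simp)
  next
    case 6
    have "0 < k" by (rule lower) (simp add: 6)
    moreover have "k < 3" by (rule upper) (simp add: 6)
    ultimately have "k \<in> {1,2}" unfolding insert_iff empty_iff by presburger
    then obtain \<rho> where lk: "large_cases 12289 k [0] \<rho>" using large_cases_12289 by blast
    have "j < 1" using j_less[OF N, of 1] by (simp add: 6)
    then have "j = 0" by linarith
    then have jl: "j \<in> set [0]" by auto
    show False by (rule lc[OF _ jl, of \<rho>]) (use lk 6 in simp)
  next
    case 7
    have "0 < k" by (rule lower) (simp add: 7)
    moreover have "k < 2" by (rule upper) (simp add: 7)
    ultimately have "k \<in> {1}" unfolding insert_iff empty_iff by presburger
    then obtain \<rho> where lk: "large_cases 786433 k [0] \<rho>" using large_cases_786433 by blast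
    have "j < 1" using j_less[OF N, of 1] by (simp add: 7)
    then have "j = 0" by linarith
    then have jl: "j \<in> set [0]" by auto
    show False by (rule lc[OF _ jl, of \<rho>]) (use lk 7 in simp)
  next
    case 8
    have "0 < k" by (rule lower) (simp add: 8)
    moreover have "k < 2" by (rule upper) (simp add: 8)
    ultimately have "k \<in> {1}" unfolding insert_iff empty_iff by presburger
    then obtain \<rho> where lk: "large_cases 3221225473 k [0] \<rho>" using large_cases_3221225473 by blast
    have "j < 1" using j_less[OF N, of 1] by (simp add: 8)
    then have "j = 0" by linarith
    then have jl: "j \<in> set [0]" by auto
    show False by (rule lc[OF _ jl, of \<rho>]) (use lk 8 in simp)
  next
    case 9
    have "0 < k" by (rule lower) (simp add: 9)
    moreover have "k < 2" by (rule upper) (simp add: 9)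
    ultimately have "k \<in> {1}" unfolding insert_iff empty_iff by presburger
    then obtain \<rho> where lk: "large_cases 206158430209 k [0] \<rho>" using large_cases_206158430209 by blast
    have "j < 1" using j_less[OF N, of 1] by (simp add: 9)
    then have "j = 0" by linarith
    then have jl: "j \<in> set [0]" by auto
    show False by (rule lc[OF _ jl, of \<rho>]) (use lk 9 in simp)
  qed
qed

lemma small_False:
  assumes r: "r \<in> exceptional_exponents" "a = 2 ^ r * 3 + 1" and nd: "n0 = 3 \<Longrightarrow> \<not> a dvd b - 1"
    and A8: "A < 8000"
  shows "k = 1 \<and> j = 0 \<and> (a = 7 \<or> a = 13)"
proof -
  have sc: False if "small_cases M (int a) k j \<rho>" "int N < M" for M \<rho>
    by (rule small_cases_False[OF that nd])
  have kh: "k < h" if "8000 \<le> int a ^ h" for h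
  proof -
    have "A < int a ^ h" using that A8 by linarith
    then show ?thesis by (rule power_less_imp_less_exp[rotated]) (use a in simp)
  qed
  have A49: "A \<ge> 49" if "k > 1 \<or> a \<ge> 49"
  proof (cases "k > 1")
    case True
    then have "int a ^ 2 \<le> A" using a by (intro power_increasing) auto
    moreover have "7 * 7 \<le> int a ^ 2" unfolding power2_eq_square using a by (intro mult_mono) auto
    ultimately show ?thesis by linarith
  next
    case False
    then have "49 \<le> int a" using that by simp
    then show ?thesis using a_le_A by linarith
  qed
  \<comment> \<open>3 * 2^12 + 1 = 12289 is above 8000, so five primes remain.\<close>
  have "r < 12"
  proof (rule ccontr)
    assume "\<not> r < 12"
    then have "(2::int) ^ 12 \<le> 2 ^ r" by (intro power_increasing) auto
    moreover have "int a = 2 ^ r * 3 + 1" using r(2) by simp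
    ultimately show False using A8 a_le_A by simp
  qed
  then consider "a = 7" | "a = 13" | "a = 97" | "a = 193" | "a = 769"
    using r unfolding exceptional_exponents_def by auto
  then show ?thesis
  proof cases
    case 1
    have k5: "k < 5" by (rule kh) (simp add: 1)
    show ?thesis
    proof (cases "k = 1")
      case True
      have N: "N < 2190" using N_bounds(4) 1 True by simp
      have "j < 4" using j_less[OF N, of 4] by (simp add: 1)
      then consider "j = 0" | "j = 1" | "j = 2" | "j = 3" by linarith
      then show ?thesis using small_cases_7_first sc[of 2190] N True 1 by cases auto
    next
      case False
      then have N: "N < 750" using N_bounds(2) A49 k by simp
      have "j < 4" using j_less[OF N, of 4] by (simp add: 1)
      then have "j = 0 \<or> j = 1 \<or> j = 2 \<or> j = 3" by linarith
      moreover have "k = 2 \<or> k = 3 \<or> k = 4" using k k5 False by linarith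
      ultimately have False using small_cases_7 sc[of 750] N 1 by (elim disjE) auto
      then show ?thesis ..
    qed
  next
    case 2
    have k4: "k < 4" by (rule kh) (simp add: 2)
    show ?thesis
    proof (cases "k = 1")
      case True
      have N: "N < 2190" using N_bounds(3) 2 by simp
      have "j < 3" using j_less[OF N, of 3] by (simp add: 2)
      then consider "j = 0" | "j = 1" | "j = 2" by linarith
      then show ?thesis using small_cases_13_first sc[of 2190] N True 2 by cases auto
    next
      case False
      then have N: "N < 750" using N_bounds(2) A49 k by simp
      have "j < 3" using j_less[OF N, of 3] by (simp add: 2)
      then have "j = 0 \<or> j = 1 \<or> j = 2" by linarith
      moreover have "k = 2 \<or> k = 3" using k k4 False by linarith
      ultimately have False using small_cases_13 sc[of 750] N 2 by (elim disjE) auto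
      then show ?thesis ..
    qed
  next
    case 3
    have "k < 2" by (rule kh) (simp add: 3)
    then have k1: "k = 1" using k by linarith
    have N: "N < 750" using N_bounds(2) A49 3 by simp
    have "j < 2" using j_less[OF N, of 2] by (simp add: 3)
    then have "j = 0 \<or> j = 1" by linarith
    then have False using small_cases_97_1_0 small_cases_97_1_1 sc[of 750] N 3 k1 by (elim disjE) auto
    then show ?thesis ..
  next
    case 4
    have "k < 2" by (rule kh) (simp add: 4)
    then have k1: "k = 1" using k by linarith
    have N: "N < 750" using N_bounds(2) A49 4 by simp
    have "j < 2" using j_less[OF N, of 2] by (simp add: 4)
    then have "j = 0 \<or> j = 1" by linarith
    then have False using small_cases_193_1_0 small_cases_193_1_1 sc[of 750] N 4 k1 by (elim disjE) auto
    then show ?thesis ..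
  next
    case 5
    have "k < 2" by (rule kh) (simp add: 5)
    then have k1: "k = 1" using k by linarith
    have N: "N < 750" using N_bounds(2) A49 5 by simp
    have "j < 1" using j_less[OF N, of 1] by (simp add: 5)
    then have "j = 0" by linarith
    then have False using small_cases_769_1_0 sc[of 750] N 5 k1 by auto
    then show ?thesis ..
  qed
qed

text \<open>Here \<open>x1 = 1\<close>, so \<open>b < a\<close> is a nontrivial cube root of unity:
  2 or 4 modulo 7, and 3 or 9 modulo 13. For 7 the equation fails modulo 16. For 13 it fails modulo
  4 or 5, and the oddness of \<open>N\<close> is essential: 3 ^ 7 + 10 = 13 ^ 3 does hold, but
  belongs to the other parity.\<close>

lemma minimal_False:
  assumes kj: "k = 1" "j = 0" and a': "a = 7 \<or> a = 13"
  shows False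
proof -
  have n03: "n0 = 3" using n0_1_j(1) n0 kj by auto
  have NY: "N = Y'" using Y'(1) kj by simp
  then have oN: "odd N" using Y'(2) by simp
  have dv: "(int b ^ 3) mod int a = 1 mod int a" using n(1) n03 kj by (simp add: mod_eq_dvd_iff)
  have p: "int b ^ y1 < int a" using power_b_less kj by simp
  have "int b < int a" using b_less kj by simp
  then have ba: "b < a" by simp
  have y1_2: "b ^ y1 < a" using p by (simp flip: of_nat_power)
  have ce: "c = a - b ^ y1" using e1 kj by simp
  define e where "e = y1 + 3 * N"
  have e: "b ^ e + c = a ^ x2" using e2 n03 by (simp add: e_def)
  have N1: "N \<ge> 1" by (rule N_pos)
  from a' show False
  proof
    assume a7: "a = 7"
    have "b = 2 \<or> b = 3 \<or> b = 4 \<or> b = 5 \<or> b = 6" using ba b a7 by linarith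
    then have b24: "b = 2 \<or> b = 4" using dv a7 by auto
    have "y1 < 3"
    proof (rule ccontr)
      assume "\<not> y1 < 3"
      then have "b ^ 3 \<le> b ^ y1" using b by (intro power_increasing) auto
      then show False using y1_2 a7 b24 by auto
    qed
    then have "y1 = 1 \<or> y1 = 2" using y1 by linarith
    then have c35: "c = 5 \<or> c = 3" using ce y1_2 a7 b24 by auto
    have "e \<ge> 4" using y1 N1 by (simp add: e_def)
    then have "b ^ 4 dvd b ^ e" by (rule le_imp_power_dvd)
    moreover have "16 dvd b ^ 4" using b24 by auto
    ultimately have "16 dvd b ^ e" by (rule dvd_trans[rotated])
    then obtain q where "b ^ e = 16 * q" by blast
    then have "7 ^ x2 mod 16 = c mod 16" using e a7 by (metis mod_mult_self4)
    moreover have "(7::nat) ^ x2 mod 16 \<in> {1, 7}"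
    proof (induction x2)
      case (Suc t)
      have "(7::nat) ^ Suc t mod 16 = 7 * (7 ^ t mod 16) mod 16" by (simp add: mod_mult_right_eq)
      then show ?case using Suc by auto
    qed simp
    ultimately show False using c35 by auto
  next
    assume a13: "a = 13"
    have "b = 2 \<or> b = 3 \<or> b = 4 \<or> b = 5 \<or> b = 6 \<or> b = 7 \<or> b = 8 \<or> b = 9 \<or> b = 10 \<or> b = 11 \<or> b = 12" using ba b a13 by presburger
    then have b39: "b = 3 \<or> b = 9" using dv a13 by auto
    have "y1 < 3"
    proof (rule ccontr)
      assume "\<not> y1 < 3"
      then have "b ^ 3 \<le> b ^ y1" using b by (intro power_increasing) auto
      then show False using y1_2 a13 b39 by auto
    qed
    then have y12: "y1 = 1 \<or> y1 = 2" using y1 by linarith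
    have m4: "(13::nat) ^ x2 mod 4 = 1"
      using power_mod[of "13::nat" 4 x2] by simp
    have m3: "(3::nat) ^ (2 * t) mod 4 = 1" for t
      using power_mod[of "9::nat" 4 t] by (simp add: power_mult)
    have "b = 3 \<and> y1 = 1 \<or> b = 3 \<and> y1 = 2 \<or> b = 9 \<and> y1 = 1" using b39 y12 y1_2 a13 by auto
    then show False
    proof (elim disjE conjE)
      assume by1: "b = 3" "y1 = 1"
      then have c10: "c = 10" using ce a13 by simp
      have "even e" using oN by1 by (simp add: e_def)
      then obtain t where "e = 2 * t" by blast
      then have "(3 ^ e + 10) mod 4 = (3::nat)" using m3[of t] by presburger
      then have "(b ^ e + c) mod 4 = 3" by (simp only: by1 c10)
      then have "13 ^ x2 mod 4 = (3::nat)" by (simp only: e a13)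
      then show False using m4 by simp
    next
      assume by1: "b = 3" "y1 = 2"
      then have c4: "c = 4" using ce a13 by simp
      have "odd e" using oN by1 by (simp add: e_def)
      then obtain t where "e = 2 * t + 1" by (elim oddE)
      then have "3 ^ e = 3 * (3::nat) ^ (2 * t)" by simp
      then have "(3 ^ e + 4) mod 4 = (3::nat)" using m3[of t] by presburger
      then have "(b ^ e + c) mod 4 = 3" by (simp only: by1 c4)
      then have "13 ^ x2 mod 4 = (3::nat)" by (simp only: e a13)
      then show False using m4 by simp
    next
      assume by1: "b = 9" "y1 = 1"
      then have c4: "c = 4" using ce a13 by simp
      have "even e" using oN by1 by (simp add: e_def)
      then obtain t where "e = 2 * t" by blast
      then have "9 ^ e mod 5 = (1::nat)" using power_mod[of "81::nat" 5 t] by (simp add: power_mult)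
      then have "(9 ^ e + 4) mod 5 = (0::nat)" by presburger
      then have "(b ^ e + c) mod 5 = 0" by (simp only: by1 c4)
      then have "5 dvd (13::nat) ^ x2" by (simp only: e a13 dvd_eq_mod_eq_0)
      then have "5 dvd (13::nat)" using prime_dvd_power[of "5::nat" 13 x2] by simp
      then show False by simp
    qed
  qed
qed

end

section \<open>Conclusion\<close>

lemma opposite_parity:
  fixes a b c r x1 x2 y1 y2 :: nat
  assumes r: "r \<in> exceptional_exponents" "a = 2 ^ r * 3 + 1" and a: "prime a" and b: "b > 1" and c: "c > 0"
    and cop: "coprime a b" "coprime a c"
    and e: "b ^ y1 + c = a ^ x1" "b ^ y2 + c = a ^ x2"
    and x: "x1 < x2" and y: "0 < y1" "y1 < y2" and par: "odd (y1 + y2)"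
  shows False
proof -
  have "r \<ge> 1" using r(1) by (auto simp: exceptional_exponents_def)
  then have "(2::nat) ^ 1 \<le> 2 ^ r" by (intro power_increasing) auto
  then have a7: "a \<ge> 7" using r(2) by simp
  have a3: "a mod 3 = 1" using r(2) by presburger
  have par': "odd (y2 - y1)" using par y by presburger
  obtain n0 k j N Y' n where D: "descent a b c n0 k j N Y' x2 y1 n" "n0 = 3 \<Longrightarrow> \<not> a dvd b - 1"
    using descent_exists[OF a a7 a3 b c cop e x y par' cube_cong_one[OF a r(2) cop(1) par']] by metis
  interpret descent a b c n0 k j N Y' x2 y1 n by (rule D(1))
  show False
  proof (cases "A \<ge> 8000")
    case True
    then show False using large_False[OF r D(2)] by blast
  next
    case False
    then have "k = 1 \<and> j = 0 \<and> (a = 7 \<or> a = 13)" using small_False[OF r D(2)] by simp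
    then show False using minimal_False by blast
  qed
qed

lemma two_solutions:
  fixes a b c r x1 x2 y1 y2 :: nat
  assumes r: "r \<in> exceptional_exponents" "a = 2 ^ r * 3 + 1" and a: "prime a" and b: "b > 1" and c: "c > 0"
    and cop: "coprime a b" "coprime a c" "coprime b c"
    and s: "(x1, y1) \<in> sol_set a b c" "(x2, y2) \<in> sol_set a b c" and x: "x1 < x2"
  shows "a = 13 \<and> b = 3 \<and> c = 10 \<and> x1 = 1 \<and> y1 = 1 \<and> x2 = 3 \<and> y2 = 7"
proof -
  have nat_eq: "b ^ y + c = a ^ x" if "(x, y) \<in> sol_set a b c" for x y
  proof -
    have "int (b ^ y + c) = int (a ^ x)" using that by (simp add: sol_set_def)
    then show ?thesis by (simp only: of_nat_eq_iff)
  qed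
  note e = nat_eq[OF s(1)] nat_eq[OF s(2)]
  have pos: "0 < x1" "0 < y1" using s(1) by (auto simp: sol_set_def)
  have "r \<ge> 1" using r(1) by (auto simp: exceptional_exponents_def)
  then have "(2::nat) ^ 1 \<le> 2 ^ r" by (intro power_increasing) auto
  then have a7: "a \<ge> 7" using r(2) by simp
  have a3: "[a = 1] (mod 3)" using r(2) by (simp add: cong_def) presburger
  have "a ^ x1 < a ^ x2" using x a7 by (intro power_strict_increasing) auto
  then have "b ^ y1 < b ^ y2" using e by linarith
  then have y: "y1 < y2" using b by (simp add: power_strict_increasing_iff)
  show ?thesis
  proof (cases "even (y1 + y2)")
    case True
    then show ?thesis using same_parity[OF a a7 a3 b c cop e pos(1) x pos(2) y] by blast
  next
    case False
    then show ?thesis using opposite_parity[OF r a b c cop(1,2) e x pos(2) y] by blast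
  qed
qed

theorem theorem1p3:
  fixes a b c r :: nat
  assumes "r \<in> exceptional_exponents"
    and "a = 2 ^ r * 3 + 1"
    and "prime a"
    and "b > 1" and "c > 0"
    and "coprime a b" and "coprime a c" and "coprime b c"
  shows "if (a, b, c) = (13, 3, 10)
         then finite (sol_set a b c) \<and> card (sol_set a b c) = 2
         else (\<forall>p\<in>sol_set a b c. \<forall>q\<in>sol_set a b c. p = q)"
proof -
  \<comment> \<open>As \<open>x\<close> determines \<open>y\<close>, two different solutions have
    different \<open>x\<close> and can be ordered by it.\<close>
  have same_x: "y = y'" if "(x, y) \<in> sol_set a b c" "(x, y') \<in> sol_set a b c" for x y y'
  proof -
    have "int b ^ y = int b ^ y'" using that by (simp add: sol_set_def)
    then show ?thesis using assms(4) by (simp add: power_inject_exp)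
  qed
  note two = two_solutions[OF assms]
  show ?thesis
  proof (cases "(a, b, c) = (13, 3, 10)")
    case True
    then have abc: "a = 13" "b = 3" "c = 10" by auto
    have s: "(1, 1) \<in> sol_set a b c" "(3, 7) \<in> sol_set a b c" by (simp_all add: abc sol_set_def)
    have "sol_set a b c = {(1, 1), (3, 7)}"
    proof (intro equalityI subsetI)
      fix p assume "p \<in> sol_set a b c"
      then obtain x y where p: "p = (x, y)" "(x, y) \<in> sol_set a b c" by (cases p) auto
      have "x > 0" using p(2) by (simp add: sol_set_def)
      then consider "x = 1" | "1 < x" by linarith
      then show "p \<in> {(1, 1), (3, 7)}"
      proof cases
        case 1
        then show ?thesis using same_x p s(1) by blast
      next
        case 2
        then show ?thesis using two[OF s(1) p(2)] p(1) by simp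
      qed
    qed (use s in auto)
    then show ?thesis using True by simp
  next
    case False
    have "p = q" if p: "p \<in> sol_set a b c" and q: "q \<in> sol_set a b c" for p q
    proof -
      obtain x y x' y' where pq: "p = (x, y)" "q = (x', y')" by (cases p, cases q)
      have s: "(x, y) \<in> sol_set a b c" "(x', y') \<in> sol_set a b c" using p q pq by simp_all
      have "\<not> x < x'" using two[OF s] False by blast
      moreover have "\<not> x' < x" using two[OF s(2,1)] False by blast
      ultimately have "x = x'" by linarith
      then show ?thesis using same_x p q pq by blast
    qed
    then show ?thesis unfolding if_not_P[OF False] by blast
  qed
qed

end
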